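(* The misorientation space $X(G,G)$ is homeomorphic to the 3-sphere $S^3$ if $G$ belongs to the list $\{D_2,D_4,D_6,T,O,I\}$. The misorientation space $X(G,G)$ is homeomorphic to $\mathbb{R}P^3$ if $G$ belongs to the list $\{C_2,C_3,C_4,C_6,D_3\}$.
   Context: For finite subgroups $G_1,G_2\subset \mathrm{SO}(3)$, the misorientation space is the topological orbit space $X(G_1,G_2)=\mathrm{SO}(3)/(G_1\times G_2)=G_1\backslash \mathrm{SO}(3)/G_2$, where $(g_1,g_2)\cdot A=g_1Ag_2^{-1}$. Groups (finite subgroups of $\mathrm{SO}(3)$, specified up to conjugacy): $C_n$ is generated by an axial rotation of order $n$; $D_n$ (order $2n$) is generated by an axial rotation of order $n$ and a rotation of order $2$ about an axis orthogonal to the first axis; $T,O,I$ are the groups of orientation-preserving (rotational) symmetries of a regular tetrahedron, octahedron, icosahedron respectively. *)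

theory Defs
  imports "HOL-Analysis.Analysis" "HOL-Algebra.Multiplicative_Group" "HOL-Algebra.Generated_Groups"
    "HOL-Algebra.Group_Action"
begin

section \<open>The rotation group\<close>

definition SO3 :: "(real^3^3) monoid" where
  "SO3 = \<lparr>carrier = Collect rotation_matrix, mult = (\<lambda>A B. A ** B), one = mat 1\<rparr>"

lemma SO3_simps:
  "A \<in> carrier SO3 \<longleftrightarrow> rotation_matrix A"
  "A \<otimes>\<^bsub>SO3\<^esub> B = A ** B"
  "\<one>\<^bsub>SO3\<^esub> = mat 1"
  by (simp_all add: SO3_def)

lemma rotation_matrix_mult:
  fixes A B :: "real^3^3"
  shows "rotation_matrix A \<Longrightarrow> rotation_matrix B \<Longrightarrow> rotation_matrix (A ** B)"
  by (simp add: rotation_matrix_def orthogonal_matrix_mul det_mul)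

lemma rotation_matrix_transpose:
  fixes A :: "real^3^3"
  shows "rotation_matrix A \<Longrightarrow> rotation_matrix (transpose A)"
  by (simp add: rotation_matrix_def det_transpose orthogonal_matrix_transpose)

lemma group_SO3: "group SO3"
proof (rule groupI)
  show "\<exists>B\<in>carrier SO3. B \<otimes>\<^bsub>SO3\<^esub> A = \<one>\<^bsub>SO3\<^esub>" if "A \<in> carrier SO3" for A
    using that rotation_matrix_transpose[of A]
    by (auto simp: SO3_simps rotation_matrix_def orthogonal_matrix_def
        intro!: bexI[of _ "transpose A"])
qed (auto simp: SO3_simps rotation_matrix_mult matrix_mul_assoc rotation_matrix_def[of "mat 1"]
    orthogonal_matrix_id)

lemma inv_SO3: "A \<in> carrier SO3 \<Longrightarrow> inv\<^bsub>SO3\<^esub> A = transpose A"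
  by (rule group.inv_equality[OF group_SO3])
    (auto simp: SO3_simps rotation_matrix_transpose, simp add: rotation_matrix_def orthogonal_matrix_def)


section \<open>Finite rotation groups, up to conjugacy\<close>

definition rotation_about :: "real^3 \<Rightarrow> real^3^3 \<Rightarrow> bool" where
  "rotation_about a R \<longleftrightarrow> a \<noteq> 0 \<and> R \<in> carrier SO3 \<and> R *v a = a"

text \<open>The predicates below hold of every group in the respective conjugacy class. The condition
  \<open>n > 0\<close> is needed because \<open>group.ord\<close> is 0 for elements of infinite order.\<close>

definition is_C :: "nat \<Rightarrow> (real^3^3) set \<Rightarrow> bool" where
  "is_C n G \<longleftrightarrow> n > 0 \<and> (\<exists>a R. rotation_about a R \<and> group.ord SO3 R = n \<and> G = generate SO3 {R})"

definition is_D :: "nat \<Rightarrow> (real^3^3) set \<Rightarrow> bool" where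
  "is_D n G \<longleftrightarrow> n > 0 \<and> (\<exists>a b R S. rotation_about a R \<and> group.ord SO3 R = n \<and>
     rotation_about b S \<and> group.ord SO3 S = 2 \<and> orthogonal a b \<and> G = generate SO3 {R, S})"

definition rotational_symmetries :: "(real^3) set \<Rightarrow> (real^3^3) set" where
  "rotational_symmetries P = {A \<in> carrier SO3. (\<lambda>x. A *v x) ` P = P}"

text \<open>All solids are centred at the origin, so that their orientation-preserving symmetries are
  linear. A regular solid is any image, under a similarity fixing the origin, of the one with the
  familiar coordinates.\<close>

definition similar_centred :: "(real^3) set \<Rightarrow> (real^3) set \<Rightarrow> bool" where
  "similar_centred P P' \<longleftrightarrow>
     (\<exists>c Q. c > 0 \<and> orthogonal_matrix Q \<and> P' = (\<lambda>x. c *\<^sub>R (Q *v x)) ` P)"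

definition std_tetrahedron :: "(real^3) set" where
  "std_tetrahedron = convex hull
     {vector [1, 1, 1], vector [1, -1, -1], vector [-1, 1, -1], vector [-1, -1, 1]}"

definition std_octahedron :: "(real^3) set" where
  "std_octahedron = convex hull
     (\<Union>s\<in>{1, -1}. {vector [s, 0, 0], vector [0, s, 0], vector [0, 0, s]})"

definition std_icosahedron :: "(real^3) set" where
  "std_icosahedron = (let \<phi> = (1 + sqrt 5) / 2 in convex hull
     (\<Union>s\<in>{1, -1}. \<Union>t\<in>{1, -1}.
        {vector [0, s, t * \<phi>], vector [s, t * \<phi>, 0], vector [t * \<phi>, 0, s]}))"

definition regular_tetrahedron :: "(real^3) set \<Rightarrow> bool" where
  "regular_tetrahedron = similar_centred std_tetrahedron"

definition regular_octahedron :: "(real^3) set \<Rightarrow> bool" where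
  "regular_octahedron = similar_centred std_octahedron"

definition regular_icosahedron :: "(real^3) set \<Rightarrow> bool" where
  "regular_icosahedron = similar_centred std_icosahedron"

definition is_T :: "(real^3^3) set \<Rightarrow> bool" where
  "is_T G \<longleftrightarrow> (\<exists>P. regular_tetrahedron P \<and> G = rotational_symmetries P)"

definition is_O :: "(real^3^3) set \<Rightarrow> bool" where
  "is_O G \<longleftrightarrow> (\<exists>P. regular_octahedron P \<and> G = rotational_symmetries P)"

definition is_I :: "(real^3^3) set \<Rightarrow> bool" where
  "is_I G \<longleftrightarrow> (\<exists>P. regular_icosahedron P \<and> G = rotational_symmetries P)"


section \<open>Orbit spaces\<close>

text \<open>The finest topology on the image of \<open>f\<close> making \<open>f\<close> continuous.\<close>

definition quotient_topology :: "'a topology \<Rightarrow> ('a \<Rightarrow> 'b) \<Rightarrow> 'b topology" where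
  "quotient_topology X f =
     topology (\<lambda>U. U \<subseteq> f ` topspace X \<and> openin X {x \<in> topspace X. f x \<in> U})"

lemma openin_quotient_topology:
  "openin (quotient_topology X f) U \<longleftrightarrow>
     U \<subseteq> f ` topspace X \<and> openin X {x \<in> topspace X. f x \<in> U}"
proof -
  have "istopology (\<lambda>U. U \<subseteq> f ` topspace X \<and> openin X {x \<in> topspace X. f x \<in> U})"
    unfolding istopology_def
  proof (intro conjI allI impI)
    fix S T
    assume "S \<subseteq> f ` topspace X \<and> openin X {x \<in> topspace X. f x \<in> S}"
      and "T \<subseteq> f ` topspace X \<and> openin X {x \<in> topspace X. f x \<in> T}"
    moreover have "{x \<in> topspace X. f x \<in> S \<inter> T} =
        {x \<in> topspace X. f x \<in> S} \<inter> {x \<in> topspace X. f x \<in> T}" by blast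
    ultimately show "S \<inter> T \<subseteq> f ` topspace X" "openin X {x \<in> topspace X. f x \<in> S \<inter> T}"
      by (auto simp: openin_Int)
  next
    fix \<K>
    assume K: "\<forall>K\<in>\<K>. K \<subseteq> f ` topspace X \<and> openin X {x \<in> topspace X. f x \<in> K}"
    then show "\<Union>\<K> \<subseteq> f ` topspace X" by blast
    have "{x \<in> topspace X. f x \<in> \<Union>\<K>} = (\<Union>K\<in>\<K>. {x \<in> topspace X. f x \<in> K})" by blast
    then show "openin X {x \<in> topspace X. f x \<in> \<Union>\<K>}"
      using K by auto
  qed
  then show ?thesis
    by (simp add: quotient_topology_def topology_inverse')
qed

lemma topspace_quotient_topology: "topspace (quotient_topology X f) = f ` topspace X"
proof (rule antisym)
  have "{x \<in> topspace X. f x \<in> f ` topspace X} = topspace X" by blast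
  then have "openin (quotient_topology X f) (f ` topspace X)"
    by (simp add: openin_quotient_topology)
  then show "f ` topspace X \<subseteq> topspace (quotient_topology X f)"
    by (rule openin_subset)
  show "topspace (quotient_topology X f) \<subseteq> f ` topspace X"
    by (metis openin_quotient_topology openin_topspace)
qed

lemma quotient_map_quotient_topology: "quotient_map X (quotient_topology X f) f"
  by (auto simp: quotient_map_def topspace_quotient_topology openin_quotient_topology)

definition misorientation_action ::
    "(real^3^3) \<times> (real^3^3) \<Rightarrow> real^3^3 \<Rightarrow> real^3^3" where
  "misorientation_action = (\<lambda>(g1, g2) A. g1 \<otimes>\<^bsub>SO3\<^esub> A \<otimes>\<^bsub>SO3\<^esub> inv\<^bsub>SO3\<^esub> g2)"

definition misorientation_space ::
    "(real^3^3) set \<Rightarrow> (real^3^3) set \<Rightarrow> (real^3^3) set topology" where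
  "misorientation_space G1 G2 =
     quotient_topology (top_of_set (carrier SO3))
       (orbit (SO3\<lparr>carrier := G1\<rparr> \<times>\<times> SO3\<lparr>carrier := G2\<rparr>) misorientation_action)"

abbreviation S3 :: "(real^4) topology" where
  "S3 \<equiv> top_of_set (sphere 0 1)"

definition RP3 :: "(real^4) set topology" where
  "RP3 = quotient_topology S3 (\<lambda>x. {x, - x})"

end

theory Submission
  imports Defs
begin

text \<open>
  The unit quaternions cover \<open>SO(3)\<close> twice, through a homomorphism \<open>rot\<close>. Hence
  \<open>X(G, G)\<close> is the orbit space of the unit sphere of \<open>\<real>\<^sup>4\<close> under the maps \<open>x \<mapsto> a x b\<close>, where \<open>a\<close>
  and \<open>b\<close> run through the binary group \<open>lift G\<close>. As the sphere is compact, it suffices to find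
  a continuous, positively homogeneous map from the quaternions onto themselves whose fibres are
  exactly the orbits (\<open>orbit_map\<close>, \<open>misorientation_space_sphere\<close>). If the fibres are the orbits only
  up to a sign, the orbit space is \<open>\<real>P\<^sup>3\<close> (\<open>misorientation_space_projective\<close>). Passing to a conjugate
  of \<open>G\<close> is a linear change of variable, so each group can be put in a convenient position.

  Cyclic and dihedral groups. Write quaternions as \<open>z + w j\<close>. The lift of \<open>C\<^sub>n\<close> multiplies \<open>z\<close> by
  \<open>s\<close> and \<open>w\<close> by \<open>t\<close> with \<open>s^n = t^n = \<plusminus>1\<close>, so multiplying the arguments of \<open>z\<close> and of \<open>w\<close>
  by \<open>n\<close> is a projective orbit map. The additional elements of the lift of \<open>D\<^sub>n\<close> act on the
  resulting pair \<open>(Z, W)\<close> by a group of order 8. If \<open>n\<close> is even, this group consists, in suitable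
  coordinates, of the sign changes of an even number of coordinates, which are undone by doubling
  the arguments of pairs of coordinates (\<open>even_fold\<close>). If \<open>n\<close> is odd, doubling arguments undoes all
  but an antipodal map (\<open>odd_fold\<close>).

  Polyhedral groups. A binary group \<open>R\<close> is its own root system: the reflection in
  the hyperplane orthogonal to a unit quaternion \<open>u\<close> is \<open>x \<mapsto> - u (cnj x) u\<close>, so the group of all maps
  \<open>x \<mapsto> a x b\<close> and \<open>x \<mapsto> a (cnj x) b\<close> contains the reflections in the elements of \<open>R\<close>. For the
  tetrahedral, octahedral and icosahedral groups the root systems have type \<open>D\<^sub>4\<close>, \<open>F\<^sub>4\<close> (up to the
  lengths of the roots) and \<open>H\<^sub>4\<close>. Every point can be moved into a chamber, which is a simplicial cone
  with four walls (\<open>chamber_meets_orbit\<close>), and its image there is unique up to symmetries of the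
  chamber (\<open>chamber_unique\<close>). These symmetries form a group of order 3, 2 and 1, respectively, and
  they are all of the orientation preserving form \<open>x \<mapsto> a x b\<close>. Consequently, the quotient of
  \<open>\<real>\<^sup>4\<close> by the maps \<open>x \<mapsto> a x b\<close> is the double of the chamber along its boundary, modulo the symmetries.
  In the coordinates given by the distances from the walls, the chamber is the orthant, and its double
  is \<open>\<real>\<^sup>4\<close>: the second copy is attached by subtracting twice the minimal coordinate from all
  coordinates (\<open>unfold_wall\<close>). This identification commutes with permutations of the coordinates, so
  it remains to divide \<open>\<real>\<^sup>4\<close> by a cyclic group of even permutations, which again amounts to
  multiplying an argument by 3 or by 2 (\<open>chamber.orbit_map_exists\<close>, \<open>tet_fold\<close>, \<open>oct_fold\<close>).
\<close>

section \<open>Quaternions\<close>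

type_synonym quaternion = "complex \<times> complex"

definition quat :: "real \<Rightarrow> real \<Rightarrow> real \<Rightarrow> real \<Rightarrow> quaternion" where
  "quat a b c d = (Complex a b, Complex c d)"

text \<open>The pair \<open>(z, w)\<close> stands for the quaternion \<open>z + w j\<close>, so that \<open>w j = j (cnj w)\<close>.\<close>

definition qmul :: "quaternion \<Rightarrow> quaternion \<Rightarrow> quaternion" (infixl \<open>\<star>\<close> 70) where
  "x \<star> y = (fst x * fst y - snd x * cnj (snd y), fst x * snd y + snd x * cnj (fst y))"

definition qcnj :: "quaternion \<Rightarrow> quaternion" where
  "qcnj x = (cnj (fst x), - snd x)"

definition qone :: quaternion where
  "qone = (1, 0)"

lemma quat_cases: obtains a b c d where "q = quat a b c d"
  unfolding quat_def by (metis complex.exhaust surj_pair)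

lemma quat_eq_iff: "quat a b c d = quat a' b' c' d' \<longleftrightarrow> a = a' \<and> b = b' \<and> c = c' \<and> d = d'"
  by (auto simp: quat_def)

lemma qmul_quat:
  "quat a b c d \<star> quat e f g h =
     quat (a*e - b*f - c*g - d*h) (a*f + b*e + c*h - d*g) (a*g - b*h + c*e + d*f) (a*h + b*g - c*f + d*e)"
  by (simp add: quat_def qmul_def complex_eq_iff algebra_simps)

lemma qcnj_quat: "qcnj (quat a b c d) = quat a (-b) (-c) (-d)"
  by (simp add: quat_def qcnj_def complex_eq_iff)

lemma qone_quat: "qone = quat 1 0 0 0"
  by (simp add: quat_def qone_def complex_eq_iff)

lemma inner_quat: "quat a b c d \<bullet> quat e f g h = a*e + b*f + c*g + d*h"
  by (simp add: quat_def inner_complex_def)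

lemma add_quat: "quat a b c d + quat e f g h = quat (a+e) (b+f) (c+g) (d+h)"
  by (simp add: quat_def complex_eq_iff)

lemma scaleR_quat: "r *\<^sub>R quat a b c d = quat (r*a) (r*b) (r*c) (r*d)"
  by (simp add: quat_def complex_eq_iff)

lemma uminus_quat: "- quat a b c d = quat (-a) (-b) (-c) (-d)"
  by (simp add: quat_def complex_eq_iff)

lemma norm_quat: "norm (quat a b c d) = sqrt (a*a + b*b + c*c + d*d)"
  by (simp add: norm_eq_sqrt_inner inner_quat)

lemma zero_quat: "0 = quat 0 0 0 0"
  by (simp add: quat_def complex_eq_iff zero_prod_def)

lemmas quat_arith = qmul_quat qcnj_quat qone_quat inner_quat add_quat scaleR_quat uminus_quat
  quat_eq_iff zero_quat

lemma qmul_assoc: "x \<star> y \<star> z = x \<star> (y \<star> z)"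
  by (simp add: qmul_def prod_eq_iff algebra_simps)

lemma qmul_one [simp]: "qone \<star> x = x" "x \<star> qone = x"
  by (simp_all add: qmul_def qone_def)

lemma qmul_add: "(x + y) \<star> z = x \<star> z + y \<star> z" "x \<star> (y + z) = x \<star> y + x \<star> z"
  by (simp_all add: qmul_def prod_eq_iff algebra_simps)

lemma qmul_diff: "(x - y) \<star> z = x \<star> z - y \<star> z" "x \<star> (y - z) = x \<star> y - x \<star> z"
  by (simp_all add: qmul_def prod_eq_iff algebra_simps)

lemma qmul_minus [simp]: "(- x) \<star> z = - (x \<star> z)" "x \<star> (- z) = - (x \<star> z)"
  by (simp_all add: qmul_def prod_eq_iff algebra_simps)

lemma qmul_scaleR [simp]: "(r *\<^sub>R x) \<star> z = r *\<^sub>R (x \<star> z)" "x \<star> (r *\<^sub>R z) = r *\<^sub>R (x \<star> z)"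
  by (simp_all add: qmul_def prod_eq_iff algebra_simps)

lemma qcnj_simps [simp]:
  "qcnj (qcnj x) = x" "qcnj qone = qone" "qcnj 0 = 0" "qcnj (- x) = - qcnj x"
  "qcnj (r *\<^sub>R x) = r *\<^sub>R qcnj x" "qcnj (x + y) = qcnj x + qcnj y"
  by (simp_all add: qcnj_def qone_def prod_eq_iff)

lemma qcnj_qmul: "qcnj (x \<star> y) = qcnj y \<star> qcnj x"
  by (simp add: qmul_def qcnj_def prod_eq_iff algebra_simps)

lemma inner_qcnj [simp]: "qcnj x \<bullet> qcnj y = x \<bullet> y"
  by (simp add: qcnj_def inner_prod_def inner_complex_def)

lemma inner_qmul_left: "(a \<star> x) \<bullet> (a \<star> y) = (a \<bullet> a) * (x \<bullet> y)"
  by (cases a rule: quat_cases; cases x rule: quat_cases; cases y rule: quat_cases)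
     (simp add: quat_arith algebra_simps)

lemma inner_qmul_right: "(x \<star> b) \<bullet> (y \<star> b) = (x \<bullet> y) * (b \<bullet> b)"
  by (cases b rule: quat_cases; cases x rule: quat_cases; cases y rule: quat_cases)
     (simp add: quat_arith algebra_simps)

lemma norm_qmul [simp]: "norm (x \<star> y) = norm x * norm y"
  by (simp add: norm_eq_sqrt_inner inner_qmul_left real_sqrt_mult)

lemma norm_qcnj [simp]: "norm (qcnj x) = norm x"
  by (simp add: norm_eq_sqrt_inner)

lemma norm_qone [simp]: "norm qone = 1"
  by (simp add: qone_def norm_Pair)

lemma qmul_qcnj: "x \<star> qcnj x = (x \<bullet> x) *\<^sub>R qone" "qcnj x \<star> x = (x \<bullet> x) *\<^sub>R qone"
  by (cases x rule: quat_cases; simp add: quat_arith algebra_simps)+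

lemma unit_inner: "norm a = 1 \<Longrightarrow> a \<bullet> a = 1"
  by (simp add: dot_square_norm)

lemma unit_qcnj [simp]:
  assumes "norm a = 1"
  shows "a \<star> qcnj a = qone" "qcnj a \<star> a = qone"
  using assms by (simp_all add: qmul_qcnj unit_inner)

lemma unit_cancel [simp]:
  assumes "norm a = 1"
  shows "a \<star> (qcnj a \<star> x) = x" "qcnj a \<star> (a \<star> x) = x"
  using assms by (simp_all flip: qmul_assoc)

lemma unit_cancel_right [simp]:
  assumes "norm a = 1"
  shows "x \<star> a \<star> qcnj a = x" "x \<star> qcnj a \<star> a = x"
  using assms by (simp_all add: qmul_assoc)

lemma continuous_on_qmul [continuous_intros]:
  "continuous_on S f \<Longrightarrow> continuous_on S g \<Longrightarrow> continuous_on S (\<lambda>x. f x \<star> g x)"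
  unfolding qmul_def by (intro continuous_intros)

lemma continuous_on_qcnj [continuous_intros]:
  "continuous_on S f \<Longrightarrow> continuous_on S (\<lambda>x. qcnj (f x))"
  unfolding qcnj_def by (intro continuous_intros)

lemma unit_quat_iff: "norm (quat a b c d) = 1 \<longleftrightarrow> a*a + b*b + c*c + d*d = 1"
  by (simp add: norm_quat)

section \<open>The double cover of the rotation group\<close>

text \<open>The matrix of \<open>x \<mapsto> q x (qcnj q)\<close> on the pure quaternions, for a unit quaternion \<open>q\<close>.\<close>

definition rot :: "quaternion \<Rightarrow> real^3^3" where
  "rot q = (let a = Re (fst q); b = Im (fst q); c = Re (snd q); d = Im (snd q) in
     vector [vector [a*a + b*b - c*c - d*d, 2*(b*c - a*d), 2*(b*d + a*c)],
             vector [2*(b*c + a*d), a*a - b*b + c*c - d*d, 2*(c*d - a*b)],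
             vector [2*(b*d - a*c), 2*(c*d + a*b), a*a - b*b - c*c + d*d]])"

lemma rot_quat: "rot (quat a b c d) = 
     vector [vector [a*a + b*b - c*c - d*d, 2*(b*c - a*d), 2*(b*d + a*c)],
             vector [2*(b*c + a*d), a*a - b*b + c*c - d*d, 2*(c*d - a*b)],
             vector [2*(b*d - a*c), 2*(c*d + a*b), a*a - b*b - c*c + d*d]]"
  by (simp add: rot_def quat_def)

lemma rot_qmul: "rot (x \<star> y) = rot x ** rot y"
  by (cases x rule: quat_cases; cases y rule: quat_cases)
     (simp add: quat_arith rot_quat vec_eq_iff matrix_matrix_mult_def sum_3 forall_3 algebra_simps)

lemma rot_qcnj: "rot (qcnj x) = transpose (rot x)"
  by (cases x rule: quat_cases)
     (simp add: quat_arith rot_quat vec_eq_iff transpose_def forall_3)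

lemma rot_scaleR: "rot (r *\<^sub>R x) = (r * r) *\<^sub>R rot x"
  by (cases x rule: quat_cases)
     (simp add: quat_arith rot_quat vec_eq_iff forall_3 algebra_simps)

lemma rot_minus [simp]: "rot (- x) = rot x"
  using rot_scaleR[of "-1" x] by simp

lemma rot_qone [simp]: "rot qone = mat 1"
  by (simp add: quat_arith rot_quat vec_eq_iff forall_3 mat_def)

lemma rotation_matrix_rot:
  assumes "norm q = 1"
  shows "rotation_matrix (rot q)"
proof -
  have "transpose (rot q) ** rot q = mat 1" "rot q ** transpose (rot q) = mat 1"
    using assms by (simp_all flip: rot_qcnj rot_qmul)
  then have o: "orthogonal_matrix (rot q)"
    by (simp add: orthogonal_matrix_def)
  have "det (rot q) = (q \<bullet> q) ^ 3"
    by (cases q rule: quat_cases)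
       (simp add: quat_arith rot_quat det_3 algebra_simps power3_eq_cube)
  with o assms show ?thesis
    by (simp add: rotation_matrix_def unit_inner)
qed

text \<open>The trace of the matrix is \<open>3 - 4 (b\<^sup>2 + c\<^sup>2 + d\<^sup>2)\<close> on unit quaternions, so that it determines the
  real part up to its sign.\<close>

lemma rot_eq_one_iff:
  assumes "norm q = 1"
  shows "rot q = mat 1 \<longleftrightarrow> q = qone \<or> q = - qone"
proof
  assume r: "rot q = mat 1"
  obtain a b c d where q: "q = quat a b c d" by (rule quat_cases)
  have n: "a*a + b*b + c*c + d*d = 1" using assms q by (simp add: unit_quat_iff)
  have "a*a + b*b - c*c - d*d = 1" "a*a - b*b + c*c - d*d = 1" "a*a - b*b - c*c + d*d = 1"
    using r by (simp_all add: q rot_quat vec_eq_iff forall_3 mat_def)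
  with n have "a*a = 1" "b*b = 0" "c*c = 0" "d*d = 0" by linarith+
  then show "q = qone \<or> q = - qone"
    by (auto simp: q quat_arith square_eq_1_iff)
qed (auto simp: )

lemma rot_eq_iff:
  assumes "norm p = 1" "norm q = 1"
  shows "rot p = rot q \<longleftrightarrow> p = q \<or> p = - q"
proof
  assume "rot p = rot q"
  then have "rot (qcnj q \<star> p) = mat 1"
    using assms by (simp add: rot_qmul) (simp flip: rot_qmul)
  then have "qcnj q \<star> p = qone \<or> qcnj q \<star> p = - qone"
    using assms by (subst (asm) rot_eq_one_iff) auto
  then have "q \<star> (qcnj q \<star> p) = q \<or> q \<star> (qcnj q \<star> p) = - q"
    by auto
  then show "p = q \<or> p = - q"
    using assms by simp
qed auto

text \<open>The half turn about the bisector of the first axis and the given vector does it, that is, a pure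
  quaternion. The bisector vanishes only for the vector opposite to the first axis.\<close>

lemma rot_axis1_transitive:
  assumes "x\<^sup>2 + y\<^sup>2 + z\<^sup>2 = (1::real)"
  shows "\<exists>q. norm q = 1 \<and> rot q *v axis 1 1 = vector [x, y, z]"
proof (cases "x = -1")
  case True
  then have "y = 0" "z = 0" using assms by (simp_all add: sum_power2_eq_zero_iff)
  with True have "norm (quat 0 0 1 0) = 1 \<and> rot (quat 0 0 1 0) *v axis 1 1 = vector [x, y, z]"
    by (simp add: unit_quat_iff rot_quat vec_eq_iff forall_3 matrix_vector_mult_def sum_3 axis_def)
  then show ?thesis by blast
next
  case False
  have "x\<^sup>2 \<le> 1" using assms by (smt (verit) zero_le_power2)
  then have "x > -1" using False by (simp add: abs_square_le_1)
  define b where "b = sqrt ((1 + x) / 2)"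
  have b: "b > 0" "b * b = (1 + x) / 2" using \<open>x > -1\<close> by (simp_all add: b_def)
  define c d where "c = y / (2*b)" "d = z / (2*b)"
  have "c * c + d * d = (y\<^sup>2 + z\<^sup>2) / (4 * (b*b))"
    by (simp add: c_d_def power2_eq_square add_divide_distrib)
  also have "\<dots> = (1 - x) / 2"
  proof -
    have "y\<^sup>2 + z\<^sup>2 = (1 - x) * (1 + x)" using assms by (simp add: algebra_simps power2_eq_square)
    then show ?thesis using \<open>x > -1\<close> by (simp add: b field_simps)
  qed
  finally have cd: "c * c + d * d = (1 - x) / 2" .
  have "b * c * 2 = y" "b * d * 2 = z" using b by (simp_all add: c_d_def)
  then have "norm (quat 0 b c d) = 1 \<and> rot (quat 0 b c d) *v axis 1 1 = vector [x, y, z]"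
    using cd b by (simp add: unit_quat_iff rot_quat vec_eq_iff forall_3 matrix_vector_mult_def sum_3 axis_def field_simps)
  then show ?thesis by blast
qed

lemma rotation_fixing_axis1:
  assumes A: "rotation_matrix (A :: real^3^3)" and f: "A *v axis 1 1 = axis 1 1"
  shows "\<exists>t. A = rot (cis t, 0)"
proof -
  have c1: "A $ 1 $ 1 = 1" "A $ 2 $ 1 = 0" "A $ 3 $ 1 = 0"
    using f by (simp_all add: vec_eq_iff forall_3 matrix_vector_mult_def sum_3 axis_def)
  have o: "transpose A ** A = mat 1" "det A = 1"
    using A by (simp_all add: rotation_matrix_def orthogonal_matrix_def)
  have e0: "A$1$2 = 0" "A$1$3 = 0"
    using o(1) c1 by (simp_all add: vec_eq_iff forall_3 matrix_matrix_mult_def sum_3 transpose_def mat_def)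
  have e: "A$2$2 * A$2$2 + A$3$2 * A$3$2 = 1"
    "A$2$3 * A$2$3 + A$3$3 * A$3$3 = 1" "A$2$2 * A$2$3 + A$3$2 * A$3$3 = 0"
    using o(1) c1 e0 by (simp_all add: vec_eq_iff forall_3 matrix_matrix_mult_def sum_3 transpose_def mat_def)
  have d: "A$2$2 * A$3$3 - A$2$3 * A$3$2 = 1"
    using o(2) c1 e0 by (simp add: det_3)
  have z: "(A$2$2 - A$3$3)\<^sup>2 + (A$3$2 + A$2$3)\<^sup>2 = 0"
    using e d by (simp add: power2_eq_square algebra_simps)
  then have s: "A$3$3 = A$2$2" "A$2$3 = - A$3$2"
    by (simp_all add: sum_power2_eq_zero_iff)
  obtain u where u: "A$2$2 = cos u" "A$3$2 = sin u"
    using e(1) sincos_total_2pi[of "A$2$2" "A$3$2"] by (metis power2_eq_square)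
  have h: "cos u = cos (u/2) * cos (u/2) - sin (u/2) * sin (u/2)" "sin u = 2 * (cos (u/2) * sin (u/2))"
    using cos_double[of "u/2"] sin_double[of "u/2"] by (simp_all add: power2_eq_square)
  have "cos (u/2) * cos (u/2) + sin (u/2) * sin (u/2) = 1"
    by (metis power2_eq_square sin_cos_squared_add2)
  moreover have "(cis (u/2), 0) = quat (cos (u/2)) (sin (u/2)) 0 0"
    by (simp add: quat_def complex_eq_iff)
  ultimately have "A = rot (cis (u/2), 0)"
    using c1 e0 e s u h by (simp add: rot_quat vec_eq_iff forall_3)
  then show ?thesis by blast
qed

text \<open>Two steps: a unit quaternion moves the first axis to its image, and a rotation that fixes the first
  axis is a plane rotation, whose lift has half its angle.\<close>

lemma rot_surj:
  assumes "rotation_matrix (A :: real^3^3)"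
  obtains q where "norm q = 1" "rot q = A"
proof -
  have o: "transpose A ** A = mat 1"
    using assms by (simp_all add: rotation_matrix_def orthogonal_matrix_def)
  then have "(A$1$1)\<^sup>2 + (A$2$1)\<^sup>2 + (A$3$1)\<^sup>2 = 1"
    by (simp add: vec_eq_iff forall_3 matrix_matrix_mult_def sum_3 transpose_def mat_def power2_eq_square)
  then obtain p where p: "norm p = 1" "rot p *v axis 1 1 = vector [A$1$1, A$2$1, A$3$1]"
    using rot_axis1_transitive by blast
  moreover have "vector [A$1$1, A$2$1, A$3$1] = A *v axis 1 1"
    by (simp add: vec_eq_iff forall_3 matrix_vector_mult_def sum_3 axis_def)
  ultimately have "rot (qcnj p) *v (A *v axis 1 1) = rot (qcnj p \<star> p) *v axis 1 1"
    by (simp only: rot_qmul matrix_vector_mul_assoc[symmetric])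
  then have "(rot (qcnj p) ** A) *v axis 1 1 = axis 1 1"
    using p by (simp add: matrix_vector_mul_assoc)
  moreover have "rotation_matrix (rot (qcnj p) ** A)"
    using p assms by (intro rotation_matrix_mult rotation_matrix_rot) auto
  ultimately obtain t where "rot (qcnj p) ** A = rot (cis t, 0)"
    using rotation_fixing_axis1 by blast
  then have "rot p ** (rot (qcnj p) ** A) = rot (p \<star> (cis t, 0))"
    by (simp add: rot_qmul)
  then have "A = rot (p \<star> (cis t, 0))"
    using p by (simp add: matrix_mul_assoc flip: rot_qmul)
  moreover have "norm (p \<star> (cis t, 0)) = 1"
    using p by (simp add: norm_Pair)
  ultimately show ?thesis using that by metis
qed

lemma continuous_on_rot: "continuous_on S rot"
proof -
  have "\<forall>i j. continuous_on S (\<lambda>q. rot q $ i $ j)"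
    unfolding forall_3 by (auto simp: rot_def Let_def intro!: continuous_intros)
  then have "continuous_on S (\<lambda>q. \<chi> i j. rot q $ i $ j)"
    by (intro continuous_on_vec_lambda) auto
  then show ?thesis
    by simp
qed

section \<open>Orbit maps and orbit spaces\<close>

definition lift :: "(real^3^3) set \<Rightarrow> quaternion set" where
  "lift G = {q. norm q = 1 \<and> rot q \<in> G}"

text \<open>Homogeneity makes radial projection compatible with the fibres, so that an orbit map of the whole space
  induces one of the unit sphere.\<close>

definition orbit_map :: "quaternion set \<Rightarrow> (quaternion \<Rightarrow> quaternion) \<Rightarrow> bool" where
  "orbit_map R F \<longleftrightarrow> continuous_on UNIV F \<and> (\<forall>c>0. \<forall>x. F (c *\<^sub>R x) = c *\<^sub>R F x) \<and> surj F \<and>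
     (\<forall>x y. F x = F y \<longleftrightarrow> (\<exists>a\<in>R. \<exists>b\<in>R. y = a \<star> x \<star> b))"

definition projective_orbit_map :: "quaternion set \<Rightarrow> (quaternion \<Rightarrow> quaternion) \<Rightarrow> bool" where
  "projective_orbit_map R F \<longleftrightarrow>
     continuous_on UNIV F \<and> (\<forall>c>0. \<forall>x. F (c *\<^sub>R x) = c *\<^sub>R F x) \<and> surj F \<and>
     (\<forall>x y. F x = F y \<or> F x = - F y \<longleftrightarrow> (\<exists>a\<in>R. \<exists>b\<in>R. y = a \<star> x \<star> b))"

lemma quotient_maps_same_fibres:
  assumes f: "quotient_map X Y f" and g: "quotient_map X Z g"
    and eq: "\<And>x y. x \<in> topspace X \<Longrightarrow> y \<in> topspace X \<Longrightarrow> f x = f y \<longleftrightarrow> g x = g y"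
  shows "Y homeomorphic_space Z"
proof -
  obtain h where h: "continuous_map Y Z h" "\<And>x. x \<in> topspace X \<Longrightarrow> h (f x) = g x"
    using quotient_map_lift_exists[OF f quotient_imp_continuous_map[OF g]] eq by metis
  obtain k where k: "continuous_map Z Y k" "\<And>x. x \<in> topspace X \<Longrightarrow> k (g x) = f x"
    using quotient_map_lift_exists[OF g quotient_imp_continuous_map[OF f]] eq by metis
  have "homeomorphic_maps Y Z h k"
    unfolding homeomorphic_maps_def
    using h k quotient_imp_surjective_map[OF f] quotient_imp_surjective_map[OF g] by force
  then show ?thesis
    unfolding homeomorphic_space_def by blast
qed

lemma lift_props:
  assumes "subgroup G SO3"
  shows "\<And>a. a \<in> lift G \<Longrightarrow> norm a = 1"
    "\<And>a b. a \<in> lift G \<Longrightarrow> b \<in> lift G \<Longrightarrow> a \<star> b \<in> lift G"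
    "\<And>a. a \<in> lift G \<Longrightarrow> qcnj a \<in> lift G"
    "qone \<in> lift G"
    "\<And>a. a \<in> lift G \<Longrightarrow> - a \<in> lift G"
proof -
  fix a b
  show "norm a = 1" "- a \<in> lift G" if "a \<in> lift G"
    using that by (simp_all add: lift_def)
  show "a \<star> b \<in> lift G" if "a \<in> lift G" "b \<in> lift G"
    using that subgroup.m_closed[OF assms] by (simp add: lift_def rot_qmul SO3_simps)
  show "qcnj a \<in> lift G" if "a \<in> lift G"
    using that subgroup.m_inv_closed[OF assms, of "rot a"] inv_SO3[of "rot a"]
    by (simp add: lift_def rot_qcnj SO3_simps rotation_matrix_rot)
  show "qone \<in> lift G"
    using subgroup.one_closed[OF assms] by (simp add: lift_def SO3_simps)
qed

text \<open>Equality of orbits in \<open>SO(3)\<close> allows \<open>q\<close> to be replaced by \<open>- q\<close>, and this sign can be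
  absorbed because lifts are closed under negation.\<close>

lemma orbit_rot_eq_iff:
  fixes G :: "(real^3^3) set"
  assumes G: "subgroup G SO3" and p: "norm p = 1" and q: "norm q = 1"
  defines "orb \<equiv> orbit (SO3\<lparr>carrier := G\<rparr> \<times>\<times> SO3\<lparr>carrier := G\<rparr>) misorientation_action"
  shows "orb (rot p) = orb (rot q) \<longleftrightarrow> (\<exists>a\<in>lift G. \<exists>b\<in>lift G. q = a \<star> p \<star> b)"
proof -
  have rotG: "rotation_matrix A" if "A \<in> G" for A
    using subgroup.subset[OF G] that by (auto simp: SO3_simps)
  have ex: "\<exists>a\<in>lift G. rot a = A" if "A \<in> G" for A
    using rot_surj[OF rotG[OF that]] that by (metis (mono_tags, lifting) lift_def mem_Collect_eq)
  have orb: "orb (rot x) = {rot (a \<star> x \<star> b) | a b. a \<in> lift G \<and> b \<in> lift G}" for x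
  proof (intro equalityI subsetI)
    fix B assume "B \<in> orb (rot x)"
    then obtain A C where AC: "A \<in> G" "C \<in> G" "B = A ** rot x ** transpose C"
      using subgroup.subset[OF G] 
      by (auto simp: orb_def orbit_def misorientation_action_def SO3_simps inv_SO3 rotG)
    then obtain a c where "a \<in> lift G" "c \<in> lift G" "rot a = A" "rot c = C"
      using ex by metis
    then have "B = rot (a \<star> x \<star> qcnj c)" "a \<in> lift G" "qcnj c \<in> lift G"
      using AC lift_props[OF G] by (simp_all add: rot_qmul rot_qcnj)
    then show "B \<in> {rot (a \<star> x \<star> b) | a b. a \<in> lift G \<and> b \<in> lift G}" by blast
  next
    fix B assume "B \<in> {rot (a \<star> x \<star> b) | a b. a \<in> lift G \<and> b \<in> lift G}"
    then obtain a b where ab: "a \<in> lift G" "b \<in> lift G" "B = rot (a \<star> x \<star> b)" by blast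
    then have "qcnj b \<in> lift G" using lift_props[OF G] by blast
    with ab have "rot a \<in> G" "rot (qcnj b) \<in> G" by (simp_all add: lift_def)
    then have "B = misorientation_action (rot a, rot (qcnj b)) (rot x)" 
      "(rot a, rot (qcnj b)) \<in> carrier (SO3\<lparr>carrier := G\<rparr> \<times>\<times> SO3\<lparr>carrier := G\<rparr>)"
      using ab rotG by (simp_all add: misorientation_action_def SO3_simps inv_SO3 rot_qmul flip: rot_qcnj)
    then show "B \<in> orb (rot x)" unfolding orb_def orbit_def by blast
  qed
  show ?thesis
  proof
    assume "orb (rot p) = orb (rot q)"
    moreover have "rot q \<in> orb (rot q)"
      unfolding orb using lift_props(4)[OF G] by (metis (mono_tags, lifting) mem_Collect_eq qmul_one)
    ultimately obtain a b where ab: "a \<in> lift G" "b \<in> lift G" "rot q = rot (a \<star> p \<star> b)"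
      unfolding orb by blast
    then have "q = a \<star> p \<star> b \<or> q = (- a) \<star> p \<star> b"
      using rot_eq_iff[of q "a \<star> p \<star> b"] p q lift_props(1)[OF G] by auto
    then show "\<exists>a\<in>lift G. \<exists>b\<in>lift G. q = a \<star> p \<star> b"
      using ab lift_props(5)[OF G] by blast
  next
    assume "\<exists>a\<in>lift G. \<exists>b\<in>lift G. q = a \<star> p \<star> b"
    then obtain a b where ab: "a \<in> lift G" "b \<in> lift G" "q = a \<star> p \<star> b" by blast
    have "p = qcnj a \<star> q \<star> qcnj b"
      using ab lift_props(1)[OF G] by (simp add: qmul_assoc)
    moreover have "qcnj a \<in> lift G" "qcnj b \<in> lift G" using ab lift_props(3)[OF G] by blast+
    moreover have sub: "orb (rot (c \<star> x \<star> d)) \<subseteq> orb (rot x)" if "c \<in> lift G" "d \<in> lift G" for c d x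
    proof -
      have "rot (u \<star> (c \<star> x \<star> d) \<star> v) = rot ((u \<star> c) \<star> x \<star> (d \<star> v))" for u v
        by (simp add: qmul_assoc)
      then show ?thesis unfolding orb using that lift_props(2)[OF G] by blast
    qed
    ultimately show "orb (rot p) = orb (rot q)"
      using ab(1,2) sub[of "qcnj a" "qcnj b" q] sub[of a b p] unfolding ab(3)[symmetric] by (metis subset_antisym)
  qed
qed

lemma vector_4:
  "(vector [a, b, c, d] :: 'a::zero^4) $ 1 = a" "(vector [a, b, c, d] :: 'a^4) $ 2 = b"
  "(vector [a, b, c, d] :: 'a^4) $ 3 = c" "(vector [a, b, c, d] :: 'a^4) $ 4 = d"
  unfolding vector_def by simp_all

definition vec4 :: "quaternion \<Rightarrow> real^4" where
  "vec4 q = vector [Re (fst q), Im (fst q), Re (snd q), Im (snd q)]"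

lemma vec4_simps:
  "vec4 (- x) = - vec4 x" "norm (vec4 x) = norm x" "vec4 x = vec4 y \<longleftrightarrow> x = y"
proof -
  show "vec4 (- x) = - vec4 x"
    by (simp add: vec4_def vec_eq_iff forall_4 vector_4)
  show "vec4 x = vec4 y \<longleftrightarrow> x = y"
    by (auto simp add: vector_4 vec4_def vec_eq_iff forall_4 prod_eq_iff complex_eq_iff)
  show "norm (vec4 x) = norm x"
    by (simp add: vector_4 vec4_def norm_eq_sqrt_inner inner_vec_def sum_4 inner_prod_def inner_complex_def)
qed

lemma vec4_surj: "\<exists>x. vec4 x = v"
proof
  show "vec4 (Complex (v$1) (v$2), Complex (v$3) (v$4)) = v"
    by (simp add: vec4_def vec_eq_iff forall_4 vector_4)
qed

lemma continuous_on_vec4: "continuous_on S vec4"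
proof -
  have "\<forall>i. continuous_on S (\<lambda>q. vec4 q $ i)"
    unfolding forall_4 by (auto simp: vec4_def vector_4 intro!: continuous_intros)
  then have "continuous_on S (\<lambda>q. \<chi> i. vec4 q $ i)"
    by (intro continuous_on_vec_lambda) auto
  then show ?thesis by simp
qed

lemma quotient_map_sphere:
  fixes F :: "quaternion \<Rightarrow> quaternion"
  assumes cont: "continuous_on UNIV F" and hom: "\<And>c x. c > 0 \<Longrightarrow> F (c *\<^sub>R x) = c *\<^sub>R F x"
    and surj: "surj F" and nz: "\<And>x. F x = 0 \<Longrightarrow> x = 0"
  shows "quotient_map (top_of_set (sphere 0 1)) S3 (\<lambda>q. vec4 (sgn (F q)))"
proof (rule continuous_imp_quotient_map)
  have nz': "F x \<noteq> 0" if "x \<in> sphere 0 1" for x using nz[of x] that by auto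
  have "continuous_on (sphere 0 1) (\<lambda>q. sgn (F q))"
    unfolding sgn_div_norm using nz'
    by (intro continuous_intros continuous_on_subset[OF cont]) auto
  then have "continuous_on (sphere 0 1) (\<lambda>q. vec4 (sgn (F q)))"
    using continuous_on_compose[OF _ continuous_on_vec4] by (simp add: comp_def)
  then show "continuous_map (top_of_set (sphere 0 1)) S3 (\<lambda>q. vec4 (sgn (F q)))"
    using nz' by (auto simp: vec4_simps norm_sgn image_subset_iff)
  show "compact_space (top_of_set (sphere (0::quaternion) 1))"
    by (simp add: compact_space_subtopology)
  show "Hausdorff_space S3"
    by (simp add: Hausdorff_space_subtopology)
  show "(\<lambda>q. vec4 (sgn (F q))) ` topspace (top_of_set (sphere 0 1)) = topspace S3"
  proof (intro equalityI subsetI)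
    fix v :: "real^4" assume "v \<in> topspace S3"
    then have v: "norm v = 1" by simp
    obtain x where x: "vec4 x = v" using vec4_surj by blast
    then have nx: "norm x = 1" using v vec4_simps(2) by metis
    obtain y where y: "F y = x" using surj by (metis surjD)
    have F0: "F 0 = 0" using hom[of 2 0] by (simp add: scaleR_2)
    then have "y \<noteq> 0" using y nx by auto
    then have "F (sgn y) = (1 / norm y) *\<^sub>R x"
      using hom[of "1 / norm y" y] y by (simp add: sgn_div_norm divide_inverse)
    then have "sgn (F (sgn y)) = x"
      using nx \<open>y \<noteq> 0\<close> by (simp add: sgn_scaleR sgn_div_norm)
    then have "v = vec4 (sgn (F (sgn y)))" using x by simp
    moreover have "sgn y \<in> topspace (top_of_set (sphere 0 1))"
      using \<open>y \<noteq> 0\<close> by (simp add: norm_sgn)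
    ultimately show "v \<in> (\<lambda>q. vec4 (sgn (F q))) ` topspace (top_of_set (sphere 0 1))" by blast
  qed (use nz' in \<open>auto simp: vec4_simps norm_sgn\<close>)
qed

lemma quotient_map_misorientation_space:
  fixes G :: "(real^3^3) set"
  shows "quotient_map (top_of_set (sphere 0 1)) (misorientation_space G G)
           (\<lambda>q. orbit (SO3\<lparr>carrier := G\<rparr> \<times>\<times> SO3\<lparr>carrier := G\<rparr>) misorientation_action (rot q))"
proof -
  have "quotient_map (top_of_set (sphere (0::quaternion) 1)) (top_of_set (carrier SO3)) rot"
  proof (rule continuous_imp_quotient_map)
    show "continuous_map (top_of_set (sphere 0 1)) (top_of_set (carrier SO3)) rot"
      by (auto simp: continuous_on_rot SO3_simps rotation_matrix_rot image_subset_iff)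
    show "rot ` topspace (top_of_set (sphere 0 1)) = topspace (top_of_set (carrier SO3))"
      using rot_surj by (force simp: SO3_simps rotation_matrix_rot)
  qed (simp_all add: compact_space_subtopology Hausdorff_space_subtopology)
  then show ?thesis
    using quotient_map_compose[OF _ quotient_map_quotient_topology]
    unfolding misorientation_space_def comp_def by blast
qed

text \<open>If the values of \<open>F\<close> are positively proportional, then by homogeneity some multiple of \<open>q\<close> lies in
  the orbit of \<open>p\<close>. The motions preserve norms, hence the multiple is \<open>q\<close> itself.\<close>

lemma eq_if_sgn_eq:
  fixes F :: "quaternion \<Rightarrow> quaternion"
  assumes "subgroup G SO3" and hom: "\<And>c x. c > 0 \<Longrightarrow> F (c *\<^sub>R x) = c *\<^sub>R F x"
    and nz: "F p \<noteq> 0" "F q \<noteq> 0"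
    and fib: "\<And>x y. F x = F y \<Longrightarrow> (\<exists>a\<in>lift G. \<exists>b\<in>lift G. y = a \<star> x \<star> b)"
    and pq: "norm p = 1" "norm q = 1" "sgn (F p) = sgn (F q)"
  shows "F p = F q"
proof -
  define c where "c = norm (F p) / norm (F q)"
  have c: "c > 0" using nz by (simp add: c_def)
  have "F p = c *\<^sub>R F q"
    using pq(3) nz unfolding sgn_div_norm c_def
    by (metis (no_types, opaque_lifting) divide_inverse norm_eq_zero right_inverse scaleR_one scaleR_scaleR)
  then have "F p = F (c *\<^sub>R q)" using hom c by simp
  then obtain a b where "a \<in> lift G" "b \<in> lift G" "c *\<^sub>R q = a \<star> p \<star> b" using fib by blast
  then have "norm (c *\<^sub>R q) = 1" using pq lift_props(1)[OF assms(1)] by simp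
  then have "c = 1" using pq c by simp
  with \<open>F p = c *\<^sub>R F q\<close> show ?thesis by simp
qed

theorem misorientation_space_sphere:
  assumes G: "subgroup G SO3" and F: "orbit_map (lift G) F"
  shows "misorientation_space G G homeomorphic_space S3"
proof -
  have cont: "continuous_on UNIV F" and hom: "\<And>c x. c > 0 \<Longrightarrow> F (c *\<^sub>R x) = c *\<^sub>R F x" and surj: "surj F"
    and fib: "\<And>x y. F x = F y \<longleftrightarrow> (\<exists>a\<in>lift G. \<exists>b\<in>lift G. y = a \<star> x \<star> b)"
    using F unfolding orbit_map_def by blast+
  have F0: "F 0 = 0" using hom[of 2 0] by (simp add: scaleR_2)
  have nz: "x = 0" if "F x = 0" for x
    using fib[of x 0] F0 that lift_props(1)[OF G] by (metis norm_eq_zero norm_qmul mult_1 mult_1_right)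
  show ?thesis
  proof (rule quotient_maps_same_fibres[OF quotient_map_misorientation_space quotient_map_sphere[OF cont hom surj nz]])
    fix p q :: quaternion
    assume "p \<in> topspace (top_of_set (sphere 0 1))" "q \<in> topspace (top_of_set (sphere 0 1))"
    then have pq: "norm p = 1" "norm q = 1" by simp_all
    then have z: "F p \<noteq> 0" "F q \<noteq> 0" using nz[of p] nz[of q] by auto
    have "F p = F q" if "sgn (F p) = sgn (F q)"
      using eq_if_sgn_eq[OF G hom z _ pq that] fib by blast
    then have "vec4 (sgn (F p)) = vec4 (sgn (F q)) \<longleftrightarrow> F p = F q"
      unfolding vec4_simps by metis
    then show "orbit (SO3\<lparr>carrier := G\<rparr> \<times>\<times> SO3\<lparr>carrier := G\<rparr>) misorientation_action (rot p) =
          orbit (SO3\<lparr>carrier := G\<rparr> \<times>\<times> SO3\<lparr>carrier := G\<rparr>) misorientation_action (rot q) \<longleftrightarrow>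
          vec4 (sgn (F p)) = vec4 (sgn (F q))"
      using orbit_rot_eq_iff[OF G pq] fib by simp
  qed auto
qed

theorem misorientation_space_projective:
  assumes G: "subgroup G SO3" and F: "projective_orbit_map (lift G) F"
  shows "misorientation_space G G homeomorphic_space RP3"
proof -
  have cont: "continuous_on UNIV F" and hom: "\<And>c x. c > 0 \<Longrightarrow> F (c *\<^sub>R x) = c *\<^sub>R F x" and surj: "surj F"
    and fib: "\<And>x y. F x = F y \<or> F x = - F y \<longleftrightarrow> (\<exists>a\<in>lift G. \<exists>b\<in>lift G. y = a \<star> x \<star> b)"
    using F unfolding projective_orbit_map_def by blast+
  have F0: "F 0 = 0" using hom[of 2 0] by (simp add: scaleR_2)
  have nz: "x = 0" if "F x = 0" for x
    using fib[of x 0] F0 that lift_props(1)[OF G] by (metis norm_eq_zero norm_qmul mult_1 mult_1_right)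
  define g where "g q = vec4 (sgn (F q))" for q
  have g: "quotient_map (top_of_set (sphere 0 1)) S3 g"
    unfolding g_def by (rule quotient_map_sphere[OF cont hom surj nz])
  have "quotient_map (top_of_set (sphere 0 1)) RP3 ((\<lambda>x. {x, - x}) \<circ> g)"
    unfolding RP3_def using quotient_map_compose[OF g quotient_map_quotient_topology] .
  then show ?thesis
  proof (rule quotient_maps_same_fibres[OF quotient_map_misorientation_space])
    fix p q :: quaternion
    assume "p \<in> topspace (top_of_set (sphere 0 1))" "q \<in> topspace (top_of_set (sphere 0 1))"
    then have pq: "norm p = 1" "norm q = 1" by simp_all
    then have z: "F p \<noteq> 0" "F q \<noteq> 0" using nz[of p] nz[of q] by auto
    have *: "F x = F y" if "sgn (F x) = sgn (F y)" "norm x = 1" "norm y = 1" "F x \<noteq> 0" "F y \<noteq> 0" for x y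
      using eq_if_sgn_eq[OF G hom that(4,5) _ that(2,3,1)] fib by blast
    \<comment> \<open>With a unit quaternion of value \<open>- F q\<close>, the case of opposite signs reduces to that of equal
      signs.\<close>
    obtain q' where q': "norm q' = 1" "F q' = - F q"
    proof -
      obtain r where r: "F r = - F q" using surj by (metis surjD)
      then obtain a b where "a \<in> lift G" "b \<in> lift G" "r = a \<star> q \<star> b" using fib[of q r] by auto
      then have "norm r = 1" using pq lift_props(1)[OF G] by simp
      with r show ?thesis using that by blast
    qed
    have "((\<lambda>x. {x, - x}) \<circ> g) p = ((\<lambda>x. {x, - x}) \<circ> g) q \<longleftrightarrow> g p = g q \<or> g p = - g q"
      by (auto simp: doubleton_eq_iff)
    also have "\<dots> \<longleftrightarrow> sgn (F p) = sgn (F q) \<or> sgn (F p) = sgn (F q')"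
      using q' by (simp add: g_def sgn_minus vec4_simps flip: vec4_simps(1))
    also have "\<dots> \<longleftrightarrow> F p = F q \<or> F p = - F q"
    proof -
      have "F q' \<noteq> 0" using q'(2) z(2) by simp
      then have "sgn (F p) = sgn (F q) \<longleftrightarrow> F p = F q" "sgn (F p) = sgn (F q') \<longleftrightarrow> F p = F q'"
        using * pq q'(1) z by metis+
      then show ?thesis unfolding q'(2)[symmetric] by simp
    qed
    finally show "orbit (SO3\<lparr>carrier := G\<rparr> \<times>\<times> SO3\<lparr>carrier := G\<rparr>) misorientation_action (rot p) =
          orbit (SO3\<lparr>carrier := G\<rparr> \<times>\<times> SO3\<lparr>carrier := G\<rparr>) misorientation_action (rot q) \<longleftrightarrow>
          ((\<lambda>x. {x, - x}) \<circ> g) p = ((\<lambda>x. {x, - x}) \<circ> g) q"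
      using orbit_rot_eq_iff[OF G pq] fib by simp
  qed
qed

section \<open>Multiplying arguments of complex numbers\<close>

text \<open>Multiplies the argument by \<open>n\<close> and keeps the absolute value. The value at 0 is 0.\<close>

definition pw :: "nat \<Rightarrow> complex \<Rightarrow> complex" where
  "pw n z = norm z *\<^sub>R sgn z ^ n"

lemma norm_pw [simp]: "norm (pw n z) = norm z"
  by (cases "z = 0") (simp_all add: pw_def norm_power norm_sgn)

lemma pw_0 [simp]: "pw n 0 = 0"
  by (simp add: pw_def)

lemma pw_eq_0 [simp]: "pw n z = 0 \<longleftrightarrow> z = 0"
  by (metis norm_eq_zero norm_pw)

lemma pw_scaleR: "c > 0 \<Longrightarrow> pw n (c *\<^sub>R z) = c *\<^sub>R pw n z"
  by (simp add: pw_def sgn_scaleR)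

lemma pw_mult:
  assumes "norm u = 1"
  shows "pw n (u * z) = u ^ n * pw n z"
  using assms by (simp add: pw_def sgn_mult norm_mult power_mult_distrib sgn_div_norm)

lemma pw_minus: "pw n (- z) = (-1) ^ n * pw n z"
  using pw_mult[of "-1" n z] by simp

lemma pw_cnj: "pw n (cnj z) = cnj (pw n z)"
  by (simp add: pw_def sgn_div_norm)

lemma pw_eq_iff:
  assumes n: "n > 0"
  shows "pw n z' = pw n z \<longleftrightarrow> (\<exists>u. u ^ n = 1 \<and> z' = u * z)"
proof
  assume eq: "pw n z' = pw n z"
  then have nrm: "norm z' = norm z" by (metis norm_pw)
  show "\<exists>u. u ^ n = 1 \<and> z' = u * z"
  proof (cases "z = 0")
    case True
    then show ?thesis using nrm by (intro exI[of _ 1]) auto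
  next
    case False
    define u where "u = z' / z"
    have u: "norm u = 1" "z' = u * z" using nrm False by (simp_all add: u_def norm_divide)
    then have "u ^ n * pw n z = pw n z" using eq pw_mult by metis
    then show ?thesis using False u by auto
  qed
next
  assume "\<exists>u. u ^ n = 1 \<and> z' = u * z"
  then obtain u where u: "u ^ n = 1" "z' = u * z" by blast
  then have "norm u = 1" using n by (metis power_eq_1_iff norm_one norm_power norm_ge_zero power_eq_imp_eq_base power_one zero_le_one)
  with u show "pw n z' = pw n z" by (simp add: pw_mult)
qed

lemma complex_root_exists:
  fixes c :: complex
  assumes "n > 0" "norm c = 1"
  obtains u where "norm u = 1" "u ^ n = c"
proof -
  have "c \<noteq> 0" "sgn c = c" using assms(2) by (auto simp: sgn_div_norm)
  then have "c = cis (Arg c)" by (simp add: cis_Arg)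
  then obtain t where "c = cis t" by blast
  moreover have "cis (t / n) ^ n = cis (n * (t / n))" by (rule Complex.DeMoivre)
  moreover have "n * (t / n) = t" using assms(1) by simp
  ultimately have "cis (t / n) ^ n = c" by (simp only:)
  then show ?thesis using that norm_cis by blast
qed

lemma pw_surj:
  assumes n: "n > 0"
  obtains z where "pw n z = w"
proof (cases "w = 0")
  case True
  then show ?thesis using that by (metis pw_0)
next
  case False
  then obtain u where u: "norm u = 1" "u ^ n = sgn w"
    using complex_root_exists[OF n, of "sgn w"] by (metis norm_sgn)
  have "pw n (u * of_real (norm w)) = u ^ n * pw n (of_real (norm w))"
    using u by (simp add: pw_mult)
  also have "\<dots> = w"
    using False u by (simp add: pw_def sgn_div_norm scaleR_conv_of_real)
  finally show ?thesis using that by blast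
qed

lemma continuous_on_pw [continuous_intros]:
  assumes "continuous_on S f"
  shows "continuous_on S (\<lambda>x. pw n (f x))"
proof -
  have "isCont (pw n) z" for z
  proof (cases "z = 0")
    case True
    have "((\<lambda>w. norm (pw n w)) \<longlongrightarrow> 0) (at 0)"
      by (simp add: tendsto_norm_zero)
    then have "(pw n \<longlongrightarrow> 0) (at 0)"
      by (rule tendsto_norm_zero_cancel)
    with True show ?thesis by (simp add: isCont_def)
  next
    case False
    then show ?thesis
      unfolding pw_def[abs_def] sgn_div_norm by (intro continuous_intros) auto
  qed
  then have "continuous_on UNIV (pw n)"
    by (simp add: continuous_at_imp_continuous_on)
  then show ?thesis
    using continuous_on_compose2[OF _ assms] by blast
qed

lemma pw2_eq_iff: "pw 2 z' = pw 2 z \<longleftrightarrow> z' = z \<or> z' = - z"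
  unfolding pw_eq_iff[OF zero_less_numeral[of "num.Bit0 num.One"], simplified]
  by (auto simp: power2_eq_1_iff)

lemma pw2_i: "pw 2 (\<i> * z) = - pw 2 z"
  by (simp add: pw_mult)

lemma pw_eq_minus_iff:
  assumes "n > 0"
  shows "pw n z' = - pw n z \<longleftrightarrow> (\<exists>u. u ^ n = - 1 \<and> z' = u * z)"
proof -
  obtain r :: complex where r: "norm r = 1" "r ^ n = - 1" by (rule complex_root_exists[OF assms, of "-1"]) simp_all
  then have "r \<noteq> 0" by auto
  have "pw n z' = - pw n z \<longleftrightarrow> pw n z' = pw n (r * z)" using r by (simp add: pw_mult)
  also have "\<dots> \<longleftrightarrow> (\<exists>u. u ^ n = 1 \<and> z' = u * (r * z))" by (rule pw_eq_iff[OF assms])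
  also have "\<dots> \<longleftrightarrow> (\<exists>u. u ^ n = - 1 \<and> z' = u * z)"
  proof
    assume "\<exists>u. u ^ n = 1 \<and> z' = u * (r * z)"
    then obtain u where "u ^ n = 1" "z' = u * (r * z)" by blast
    then show "\<exists>u. u ^ n = - 1 \<and> z' = u * z"
      using r by (intro exI[of _ "u * r"]) (auto simp: power_mult_distrib)
  next
    assume "\<exists>u. u ^ n = - 1 \<and> z' = u * z"
    then obtain u where "u ^ n = - 1" "z' = u * z" by blast
    then show "\<exists>u. u ^ n = 1 \<and> z' = u * (r * z)"
      using r \<open>r \<noteq> 0\<close> by (intro exI[of _ "u / r"]) (auto simp: power_divide)
  qed
  finally show ?thesis .
qed

section \<open>Orbit maps for cyclic and dihedral groups\<close>

text \<open>The lift of \<open>C\<^sub>n\<close> with the first coordinate axis as its axis, and of \<open>D\<^sub>n\<close> with \<open>j\<close> as the lift of a half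
  turn. Both have \<open>2 n\<close>-th roots of unity because a rotation by an angle lifts to half of the angle.\<close>

definition cyclic_lift :: "nat \<Rightarrow> quaternion set" where
  "cyclic_lift n = {(u, 0) | u. u ^ (2 * n) = 1}"

definition dihedral_lift :: "nat \<Rightarrow> quaternion set" where
  "dihedral_lift n = cyclic_lift n \<union> {(0, u) | u. u ^ (2 * n) = 1}"

text \<open>The motion given by \<open>u\<close> and \<open>v\<close> multiplies \<open>z\<close> by \<open>s = u v\<close> and \<open>w\<close> by \<open>t = u (cnj v)\<close>.
  Here \<open>s^n = t^n = \<plusminus>1\<close>. Conversely, \<open>u\<close> is recovered from \<open>s\<close> and \<open>t\<close> as a square root of \<open>s t\<close>.\<close>

lemma cyclic_orbit_iff:
  assumes n: "n > 0"
  shows "(\<exists>a\<in>cyclic_lift n. \<exists>b\<in>cyclic_lift n. (z', w') = a \<star> (z, w) \<star> b) \<longleftrightarrow>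
    pw n z' = pw n z \<and> pw n w' = pw n w \<or> pw n z' = - pw n z \<and> pw n w' = - pw n w"
    (is "?L \<longleftrightarrow> ?R")
proof
  have unit: "norm u = 1" if "u ^ (2 * n) = 1" for u :: complex
    using that n by (metis norm_one norm_power norm_ge_zero power_eq_imp_eq_base power_one zero_le_one mult_pos_pos zero_less_numeral)
  have inv: "cnj u * u = 1" if "norm u = 1" for u
    using that by (metis complex_norm_square mult.commute of_real_1 one_power2)
  {
    assume ?L
    then obtain u v where uv: "u ^ (2 * n) = 1" "v ^ (2 * n) = 1" "z' = u * z * v" "w' = u * w * cnj v"
      by (auto simp: cyclic_lift_def qmul_def)
    have "(u ^ n)\<^sup>2 = 1" "(v ^ n)\<^sup>2 = 1" using uv by (simp_all add: power_mult[symmetric] mult.commute)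
    then have pm: "u ^ n = 1 \<or> u ^ n = - 1" "v ^ n = 1 \<or> v ^ n = - 1" by (simp_all add: power2_eq_1_iff)
    have "z' = (u * v) * z" "w' = (u * cnj v) * w" using uv by simp_all
    moreover have "norm (u * v) = 1" "norm (u * cnj v) = 1" using unit uv by (simp_all add: norm_mult)
    ultimately have pw: "pw n z' = (u * v) ^ n * pw n z" "pw n w' = (u * cnj v) ^ n * pw n w"
      by (metis pw_mult)+
    have cv: "cnj (v ^ n) = v ^ n"
      using pm(2) by (elim disjE) (simp_all only: complex_cnj_one complex_cnj_minus)
    have "(u * v) ^ n = u ^ n * v ^ n" "(u * cnj v) ^ n = u ^ n * cnj (v ^ n)"
      by (simp_all add: power_mult_distrib)
    then have "(u * v) ^ n = u ^ n * v ^ n" "(u * cnj v) ^ n = u ^ n * v ^ n"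
      by (simp_all only: cv)
    moreover have "u ^ n * v ^ n = 1 \<or> u ^ n * v ^ n = - 1"
      using pm by (elim disjE) simp_all
    ultimately show ?R unfolding pw by (elim disjE) simp_all
  }
  assume ?R
  then obtain e s t where e: "e = 1 \<or> e = - 1" "s ^ n = e" "t ^ n = e" "z' = s * z" "w' = t * w"
    unfolding pw_eq_iff[OF n] pw_eq_minus_iff[OF n] by blast
  have "(s ^ n)\<^sup>2 = 1" "(t ^ n)\<^sup>2 = 1" using e(1) by (auto simp: e(2,3))
  then have st: "s ^ (2 * n) = 1" "t ^ (2 * n) = 1" by (simp_all add: power_mult[symmetric] mult.commute)
  define u where "u = csqrt (s * t)"
  have uu: "u * u = s * t" by (metis u_def power2_csqrt power2_eq_square)
  have "u ^ (2 * n) = (u * u) ^ n" by (simp add: power_mult power2_eq_square)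
  also have "\<dots> = s ^ n * t ^ n" by (simp add: uu power_mult_distrib)
  finally have u: "u ^ (2 * n) = 1" using e(1) by (auto simp: e(2,3))
  define v where "v = s * cnj u"
  have cu: "cnj u ^ (2 * n) = 1" using u by (metis complex_cnj_one complex_cnj_power)
  then have v: "v ^ (2 * n) = 1" using st by (simp add: v_def power_mult_distrib)
  have "u * v = s * (cnj u * u)" by (simp add: v_def)
  then have uv: "u * v = s" using inv unit[OF u] by simp
  have "u * cnj v = cnj s * (u * u)" by (simp add: v_def)
  also have "\<dots> = (cnj s * s) * t" by (simp add: uu)
  finally have ucv: "u * cnj v = t" using inv unit[OF st(1)] by simp
  have "(z', w') = (u, 0) \<star> (z, w) \<star> (v, 0)"
    using e by (simp add: qmul_def flip: uv ucv)
  then show ?L using u v unfolding cyclic_lift_def by blast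
qed

lemma cyclic_orbit_map:
  assumes n: "n > 0"
  shows "projective_orbit_map (cyclic_lift n) (\<lambda>x. (pw n (fst x), pw n (snd x)))"
  unfolding projective_orbit_map_def
proof (intro conjI allI impI)
  have "\<exists>x. y = (pw n (fst x), pw n (snd x))" for y :: quaternion
  proof -
    obtain z w where "pw n z = fst y" "pw n w = snd y" using pw_surj[OF n] by metis
    then show ?thesis by (intro exI[of _ "(z, w)"]) simp
  qed
  then show "surj (\<lambda>x. (pw n (fst x), pw n (snd x)))" unfolding surj_def by blast
  fix x y :: quaternion
  obtain z w z' w' where [simp]: "x = (z, w)" "y = (z', w')" by (cases x, cases y) blast
  show "((pw n (fst x), pw n (snd x)) = (pw n (fst y), pw n (snd y)) \<or>
         (pw n (fst x), pw n (snd x)) = - (pw n (fst y), pw n (snd y))) \<longleftrightarrow>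
        (\<exists>a\<in>cyclic_lift n. \<exists>b\<in>cyclic_lift n. y = a \<star> x \<star> b)"
    using cyclic_orbit_iff[OF n, of z' w' z w] by (auto simp: uminus_prod_def)
qed (auto intro!: continuous_intros simp: pw_scaleR)

text \<open>The dihedral lift is the union of the cyclic lift and its coset of \<open>j\<close>, on either side.\<close>

lemma dihedral_orbit_iff:
  fixes x y :: quaternion
  defines "j \<equiv> (0, 1)"
  shows "(\<exists>a\<in>dihedral_lift n. \<exists>b\<in>dihedral_lift n. y = a \<star> x \<star> b) \<longleftrightarrow>
    (\<exists>s\<in>{x, j \<star> x, x \<star> j, j \<star> x \<star> j}. \<exists>a\<in>cyclic_lift n. \<exists>b\<in>cyclic_lift n. y = a \<star> s \<star> b)"
    (is "?L \<longleftrightarrow> ?R")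
proof
  have l: "a \<in> cyclic_lift n \<or> (\<exists>c\<in>cyclic_lift n. a = c \<star> j)" if "a \<in> dihedral_lift n" for a
    using that by (auto simp: dihedral_lift_def cyclic_lift_def j_def qmul_def)
  have r: "a \<in> cyclic_lift n \<or> (\<exists>c\<in>cyclic_lift n. a = j \<star> c)" if "a \<in> dihedral_lift n" for a
  proof -
    have "\<exists>v. v ^ (2 * n) = 1 \<and> u = cnj v" if "u ^ (2 * n) = 1" for u :: complex
      using that by (metis complex_cnj_cnj complex_cnj_one complex_cnj_power)
    then show ?thesis
      using that by (force simp: dihedral_lift_def cyclic_lift_def j_def qmul_def)
  qed
  {
    assume ?L
    then obtain a b where "a \<in> dihedral_lift n" "b \<in> dihedral_lift n" "y = a \<star> x \<star> b" by blast
    then show ?R using l[of a] r[of b] by (auto simp only: qmul_assoc bex_simps) (metis qmul_assoc insertI1 insertI2)+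
  }
  have C: "a \<in> dihedral_lift n" "a \<star> j \<in> dihedral_lift n" "j \<star> a \<in> dihedral_lift n" if "a \<in> cyclic_lift n" for a
  proof -
    have "cnj u ^ (2 * n) = 1" if "u ^ (2 * n) = 1" for u :: complex
      using that by (metis complex_cnj_one complex_cnj_power)
    then show "a \<in> dihedral_lift n" "a \<star> j \<in> dihedral_lift n" "j \<star> a \<in> dihedral_lift n"
      using that by (auto simp: dihedral_lift_def cyclic_lift_def j_def qmul_def)
  qed
  assume ?R
  then obtain s a b where s: "s \<in> {x, j \<star> x, x \<star> j, j \<star> x \<star> j}" 
    and ab: "a \<in> cyclic_lift n" "b \<in> cyclic_lift n" "y = a \<star> s \<star> b" by blast
  from s have "y = a \<star> x \<star> b \<or> y = (a \<star> j) \<star> x \<star> b \<or> y = a \<star> x \<star> (j \<star> b) \<or> y = (a \<star> j) \<star> x \<star> (j \<star> b)"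
    by (auto simp: ab qmul_assoc)
  then show ?L using ab C by blast
qed

text \<open>Doubling the arguments of \<open>u\<close> and \<open>v\<close> divides by their signs; doubling the argument of the complex
  number made of the two imaginary parts divides by the simultaneous conjugation that is left.\<close>

lemma pw2_sum_iff:
  "Re (pw 2 u) = Re (pw 2 u') \<and> Re (pw 2 v) = Re (pw 2 v') \<and> 
    pw 2 (Complex (Im (pw 2 u)) (Im (pw 2 v))) = pw 2 (Complex (Im (pw 2 u')) (Im (pw 2 v'))) \<longleftrightarrow>
   (u' = u \<or> u' = - u) \<and> (v' = v \<or> v' = - v) \<or> 
   (u' = cnj u \<or> u' = - cnj u) \<and> (v' = cnj v \<or> v' = - cnj v)" (is "?L \<longleftrightarrow> ?R")
proof -
  have "?L \<longleftrightarrow> pw 2 u' = pw 2 u \<and> pw 2 v' = pw 2 v \<or> pw 2 u' = pw 2 (cnj u) \<and> pw 2 v' = pw 2 (cnj v)"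
  proof -
    have "pw 2 (Complex a b) = pw 2 (Complex a' b') \<longleftrightarrow> a' = a \<and> b' = b \<or> a' = - a \<and> b' = - b" for a b a' b'
      unfolding pw2_eq_iff by (auto simp: complex_eq_iff)
    then show ?thesis unfolding pw_cnj by (simp add: complex_eq_iff[of "pw 2 _"]) metis
  qed
  also have "\<dots> \<longleftrightarrow> ?R" unfolding pw2_eq_iff by blast
  finally show ?thesis .
qed

text \<open>In the coordinates \<open>Z + W\<close> and \<open>Z - W\<close>, swapping \<open>Z\<close> and \<open>W\<close> changes the sign of the second one.\<close>

definition even_fold :: "quaternion \<Rightarrow> quaternion" where
  "even_fold x = (let U = pw 2 (fst x + snd x); V = pw 2 (fst x - snd x)
     in (Complex (Re U) (Re V), pw 2 (Complex (Im U) (Im V))))"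

lemma even_fold_eq_iff:
  "even_fold (Z, W) = even_fold (Z', W') \<longleftrightarrow>
     (\<exists>(A, B)\<in>{(Z, W), (W, Z), (cnj Z, cnj W), (cnj W, cnj Z)}. (Z', W') = (A, B) \<or> (Z', W') = (- A, - B))"
    (is "?L \<longleftrightarrow> ?R")
proof -
  have h: "(Z', W') = (A, B) \<longleftrightarrow> Z' + W' = A + B \<and> Z' - W' = A - B"
    "(Z', W') = (- A, - B) \<longleftrightarrow> Z' + W' = - (A + B) \<and> Z' - W' = - (A - B)"
    "(Z', W') = (B, A) \<longleftrightarrow> Z' + W' = A + B \<and> Z' - W' = - (A - B)"
    "(Z', W') = (- B, - A) \<longleftrightarrow> Z' + W' = - (A + B) \<and> Z' - W' = A - B" for A B
    by (auto simp: complex_eq_iff)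
  have "?L \<longleftrightarrow> (Z' + W' = Z + W \<or> Z' + W' = - (Z + W)) \<and> (Z' - W' = Z - W \<or> Z' - W' = - (Z - W)) \<or>
    (Z' + W' = cnj (Z + W) \<or> Z' + W' = - cnj (Z + W)) \<and> (Z' - W' = cnj (Z - W) \<or> Z' - W' = - cnj (Z - W))"
    unfolding pw2_sum_iff[symmetric] by (simp add: even_fold_def Let_def)
  also have "\<dots> \<longleftrightarrow> ?R"
  proof -
    have "?R \<longleftrightarrow> (Z', W') = (Z, W) \<or> (Z', W') = (- Z, - W) \<or> (Z', W') = (W, Z) \<or> (Z', W') = (- W, - Z) \<or>
       (Z', W') = (cnj Z, cnj W) \<or> (Z', W') = (- cnj Z, - cnj W) \<or>
       (Z', W') = (cnj W, cnj Z) \<or> (Z', W') = (- cnj W, - cnj Z)"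
      by auto
    then show ?thesis
      unfolding h[where A = Z and B = W] h[where A = "cnj Z" and B = "cnj W"] complex_cnj_add complex_cnj_diff by argo
  qed
  finally show ?thesis .
qed

lemma even_fold_surj: "\<exists>x. even_fold x = y"
proof -
  obtain c where c: "pw 2 c = snd y" using pw_surj[of 2] by auto
  obtain u where u: "pw 2 u = Complex (Re (fst y)) (Re c)" using pw_surj[of 2] by auto
  obtain v where v: "pw 2 v = Complex (Im (fst y)) (Im c)" using pw_surj[of 2] by auto
  have "even_fold ((u + v) / 2, (u - v) / 2) = y"
    by (simp add: even_fold_def Let_def u v c add_divide_distrib[symmetric] diff_divide_distrib[symmetric]
      prod_eq_iff)
  then show ?thesis ..
qed


lemma even_fold_scaleR: "c > 0 \<Longrightarrow> even_fold (c *\<^sub>R x) = c *\<^sub>R even_fold x"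
proof -
  assume c: "c > 0"
  have "Complex (c * a) (c * b) = c *\<^sub>R Complex a b" for a b by (simp add: complex_eq_iff)
  then show ?thesis
    using c by (simp add: even_fold_def Let_def pw_scaleR flip: scaleR_add_right scaleR_diff_right)
qed

lemma Complex_of_real_eq: "Complex a b = of_real a + \<i> * of_real b"
  by (simp add: complex_eq_iff)

lemma continuous_on_even_fold: "continuous_on UNIV even_fold"
  unfolding even_fold_def Let_def Complex_of_real_eq by (intro continuous_intros)

lemma dihedral_even_orbit_map:
  assumes n: "n > 0" "even n"
  shows "orbit_map (dihedral_lift n) (\<lambda>x. even_fold (pw n (fst x), pw n (snd x)))"
  unfolding orbit_map_def
proof (intro conjI allI impI)
  show "continuous_on UNIV (\<lambda>x. even_fold (pw n (fst x), pw n (snd x)))"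
    by (rule continuous_on_compose2[OF continuous_on_even_fold]) (auto intro!: continuous_intros)
  show "surj (\<lambda>x. even_fold (pw n (fst x), pw n (snd x)))"
    unfolding surj_def
  proof
    fix y
    obtain X where X: "even_fold X = y" using even_fold_surj by blast
    obtain z w where "pw n z = fst X" "pw n w = snd X" using pw_surj[OF n(1)] by metis
    then show "\<exists>x. y = even_fold (pw n (fst x), pw n (snd x))"
      using X by (intro exI[of _ "(z, w)"]) simp
  qed
  fix x y :: quaternion
  obtain z w z' w' where xy [simp]: "x = (z, w)" "y = (z', w')" by (cases x, cases y) blast
  have ev: "pw n (- t) = pw n t" for t using n by (simp add: pw_minus)
  show "even_fold (pw n (fst x), pw n (snd x)) = even_fold (pw n (fst y), pw n (snd y)) \<longleftrightarrow>
        (\<exists>a\<in>dihedral_lift n. \<exists>b\<in>dihedral_lift n. y = a \<star> x \<star> b)"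
    (is "_ \<longleftrightarrow> ?R")
  proof -
    have P: "(\<exists>a\<in>cyclic_lift n. \<exists>b\<in>cyclic_lift n. (z', w') = a \<star> (A, B) \<star> b) \<longleftrightarrow>
        (pw n z', pw n w') = (pw n A, pw n B) \<or> (pw n z', pw n w') = (- pw n A, - pw n B)" for A B
      using cyclic_orbit_iff[OF n(1), of z' w' A B] by simp
    have j: "(0, 1) \<star> x = (- cnj w, cnj z)" "x \<star> (0, 1) = (- w, z)" "(- cnj w, cnj z) \<star> (0, 1) = (- cnj z, - cnj w)"
      by (simp_all add: qmul_def)
    have "?R \<longleftrightarrow> (\<exists>s\<in>{(z, w), (- cnj w, cnj z), (- w, z), (- cnj z, - cnj w)}.
        \<exists>a\<in>cyclic_lift n. \<exists>b\<in>cyclic_lift n. y = a \<star> s \<star> b)"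
      unfolding dihedral_orbit_iff j by simp
    then show ?thesis
      by (simp only: bex_simps P ev pw_cnj even_fold_eq_iff fst_conv snd_conv prod.case minus_minus xy) argo
  qed
next
  fix c :: real and x :: quaternion
  assume "c > 0"
  then show "even_fold (pw n (fst (c *\<^sub>R x)), pw n (snd (c *\<^sub>R x))) = c *\<^sub>R even_fold (pw n (fst x), pw n (snd x))"
    using even_fold_scaleR[of c "(pw n (fst x), pw n (snd x))"] by (simp add: pw_scaleR)
qed

text \<open>Real and imaginary parts are paired because the residual group is generated by the simultaneous
  conjugation, which changes the sign of the second pair, and by \<open>(Z, W) \<mapsto> (- W, Z)\<close>, which multiplies
  both pairs by the imaginary unit and therefore becomes the antipodal map.\<close>

definition odd_fold :: "quaternion \<Rightarrow> quaternion" where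
  "odd_fold x = (pw 2 (Complex (Re (fst x)) (Re (snd x))), pw 2 (Complex (Im (fst x)) (Im (snd x))))"

lemma odd_fold_scaleR: "c > 0 \<Longrightarrow> odd_fold (c *\<^sub>R x) = c *\<^sub>R odd_fold x"
proof -
  assume c: "c > 0"
  have "Complex (c * a) (c * b) = c *\<^sub>R Complex a b" for a b by (simp add: complex_eq_iff)
  then show ?thesis
    using c by (simp add: odd_fold_def pw_scaleR)
qed

lemma pw2_minus_iff: "pw 2 z' = - pw 2 z \<longleftrightarrow> z' = \<i> * z \<or> z' = - (\<i> * z)"
  unfolding pw2_i[symmetric] pw2_eq_iff ..

lemma odd_fold_eq_iff:
  "odd_fold (Z, W) = odd_fold (Z', W') \<or> odd_fold (Z, W) = - odd_fold (Z', W') \<longleftrightarrow>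
     (\<exists>(A, B)\<in>{(Z, W), (- W, Z), (- cnj Z, - cnj W), (- cnj W, cnj Z)}. (Z', W') = (A, B) \<or> (Z', W') = (- A, - B))"
    (is "?L \<longleftrightarrow> ?R")
proof -
  define r m r' m' where rm: "r = Complex (Re Z) (Re W)" "m = Complex (Im Z) (Im W)" 
    "r' = Complex (Re Z') (Re W')" "m' = Complex (Im Z') (Im W')"
  have "?L \<longleftrightarrow> (pw 2 r' = pw 2 r \<and> pw 2 m' = pw 2 m) \<or> (pw 2 r' = - pw 2 r \<and> pw 2 m' = - pw 2 m)"
    unfolding odd_fold_def rm by auto
  also have "\<dots> \<longleftrightarrow> (r' = r \<or> r' = - r) \<and> (m' = m \<or> m' = - m) \<or>
     (r' = \<i> * r \<or> r' = - (\<i> * r)) \<and> (m' = \<i> * m \<or> m' = - (\<i> * m))"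
    unfolding pw2_minus_iff pw2_eq_iff ..
  also have "\<dots> \<longleftrightarrow> ?R"
  proof -
    have eqs: "r' = r \<and> m' = m \<longleftrightarrow> (Z', W') = (Z, W)" "r' = - r \<and> m' = - m \<longleftrightarrow> (Z', W') = (- Z, - W)"
      "r' = r \<and> m' = - m \<longleftrightarrow> (Z', W') = (cnj Z, cnj W)" "r' = - r \<and> m' = m \<longleftrightarrow> (Z', W') = (- cnj Z, - cnj W)"
      "r' = \<i> * r \<and> m' = \<i> * m \<longleftrightarrow> (Z', W') = (- W, Z)"
      "r' = - (\<i> * r) \<and> m' = - (\<i> * m) \<longleftrightarrow> (Z', W') = (W, - Z)"
      "r' = \<i> * r \<and> m' = - (\<i> * m) \<longleftrightarrow> (Z', W') = (- cnj W, cnj Z)"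
      "r' = - (\<i> * r) \<and> m' = \<i> * m \<longleftrightarrow> (Z', W') = (cnj W, - cnj Z)"
      unfolding rm by (auto simp: complex_eq_iff)
    have "?R \<longleftrightarrow> (Z', W') = (Z, W) \<or> (Z', W') = (- Z, - W) \<or> (Z', W') = (- W, Z) \<or> (Z', W') = (W, - Z) \<or>
       (Z', W') = (cnj Z, cnj W) \<or> (Z', W') = (- cnj Z, - cnj W) \<or>
       (Z', W') = (- cnj W, cnj Z) \<or> (Z', W') = (cnj W, - cnj Z)"
      by auto
    then show ?thesis unfolding eqs[symmetric] by argo
  qed
  finally show ?thesis .
qed

lemma odd_fold_surj: "\<exists>x. odd_fold x = y"
proof -
  obtain r where r: "pw 2 r = fst y" using pw_surj[of 2] by auto
  obtain m where m: "pw 2 m = snd y" using pw_surj[of 2] by auto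
  have "odd_fold (Complex (Re r) (Re m), Complex (Im r) (Im m)) = y"
    by (simp add: odd_fold_def r m)
  then show ?thesis ..
qed

lemma continuous_on_odd_fold: "continuous_on UNIV odd_fold"
  unfolding odd_fold_def Complex_of_real_eq by (intro continuous_intros)

lemma dihedral_odd_orbit_map:
  assumes n: "odd n"
  shows "projective_orbit_map (dihedral_lift n) (\<lambda>x. odd_fold (pw n (fst x), pw n (snd x)))"
  unfolding projective_orbit_map_def
proof (intro conjI allI impI)
  have n0: "n > 0" using n by (cases n) auto
  show "continuous_on UNIV (\<lambda>x. odd_fold (pw n (fst x), pw n (snd x)))"
    by (rule continuous_on_compose2[OF continuous_on_odd_fold]) (auto intro!: continuous_intros)
  show "surj (\<lambda>x. odd_fold (pw n (fst x), pw n (snd x)))"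
    unfolding surj_def
  proof
    fix y
    obtain X where X: "odd_fold X = y" using odd_fold_surj by blast
    obtain z w where "pw n z = fst X" "pw n w = snd X" using pw_surj[OF n0] by metis
    then show "\<exists>x. y = odd_fold (pw n (fst x), pw n (snd x))"
      using X by (intro exI[of _ "(z, w)"]) simp
  qed
  fix x y :: quaternion
  obtain z w z' w' where xy [simp]: "x = (z, w)" "y = (z', w')" by (cases x, cases y) blast
  have od: "pw n (- t) = - pw n t" for t using n by (simp add: pw_minus)
  show "odd_fold (pw n (fst x), pw n (snd x)) = odd_fold (pw n (fst y), pw n (snd y)) \<or>
        odd_fold (pw n (fst x), pw n (snd x)) = - odd_fold (pw n (fst y), pw n (snd y)) \<longleftrightarrow>
        (\<exists>a\<in>dihedral_lift n. \<exists>b\<in>dihedral_lift n. y = a \<star> x \<star> b)"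
    (is "_ \<longleftrightarrow> ?R")
  proof -
    have P: "(\<exists>a\<in>cyclic_lift n. \<exists>b\<in>cyclic_lift n. (z', w') = a \<star> (A, B) \<star> b) \<longleftrightarrow>
        (pw n z', pw n w') = (pw n A, pw n B) \<or> (pw n z', pw n w') = (- pw n A, - pw n B)" for A B
      using cyclic_orbit_iff[OF n0, of z' w' A B] by simp
    have j: "(0, 1) \<star> x = (- cnj w, cnj z)" "x \<star> (0, 1) = (- w, z)" "(- cnj w, cnj z) \<star> (0, 1) = (- cnj z, - cnj w)"
      by (simp_all add: qmul_def)
    have "?R \<longleftrightarrow> (\<exists>s\<in>{(z, w), (- cnj w, cnj z), (- w, z), (- cnj z, - cnj w)}.
        \<exists>a\<in>cyclic_lift n. \<exists>b\<in>cyclic_lift n. y = a \<star> s \<star> b)"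
      unfolding dihedral_orbit_iff j by simp
    then show ?thesis
      by (simp only: bex_simps P od pw_cnj odd_fold_eq_iff fst_conv snd_conv prod.case minus_minus xy) argo
  qed
next
  fix c :: real and x :: quaternion
  assume "c > 0"
  then show "odd_fold (pw n (fst (c *\<^sub>R x)), pw n (snd (c *\<^sub>R x))) = c *\<^sub>R odd_fold (pw n (fst x), pw n (snd x))"
    using odd_fold_scaleR[of c "(pw n (fst x), pw n (snd x))"] by (simp add: pw_scaleR)
qed

section \<open>Lifts of cyclic and dihedral groups\<close>

text \<open>The subgroups of the unit quaternions that contain \<open>-1\<close>, that is, the full preimages of subgroups of
  \<open>SO(3)\<close>.\<close>

definition binary_group :: "quaternion set \<Rightarrow> bool" where
  "binary_group D \<longleftrightarrow> qone \<in> D \<and> (\<forall>a\<in>D. norm a = 1 \<and> qcnj a \<in> D \<and> - a \<in> D \<and> (\<forall>b\<in>D. a \<star> b \<in> D))"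

lemma binary_group_lift: "subgroup G SO3 \<Longrightarrow> binary_group (lift G)"
  unfolding binary_group_def using lift_props by blast

lemma subgroup_rot_image:
  assumes "binary_group D"
  shows "subgroup (rot ` D) SO3"
proof (rule group.subgroupI[OF group_SO3])
  show "rot ` D \<subseteq> carrier SO3"
    using assms by (auto simp: binary_group_def SO3_simps rotation_matrix_rot)
  show "rot ` D \<noteq> {}" using assms by (auto simp: binary_group_def)
  fix A assume "A \<in> rot ` D"
  then obtain a where a: "a \<in> D" "A = rot a" by blast
  then have "inv\<^bsub>SO3\<^esub> A = rot (qcnj a)"
    using assms by (simp add: binary_group_def rot_qcnj inv_SO3 SO3_simps rotation_matrix_rot)
  then show "inv\<^bsub>SO3\<^esub> A \<in> rot ` D" using a assms by (auto simp: binary_group_def)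
  fix B assume "B \<in> rot ` D"
  then obtain b where b: "b \<in> D" "B = rot b" by blast
  then have "A \<otimes>\<^bsub>SO3\<^esub> B = rot (a \<star> b)" by (simp add: a SO3_simps rot_qmul)
  then show "A \<otimes>\<^bsub>SO3\<^esub> B \<in> rot ` D" using a b assms by (auto simp: binary_group_def)
qed

lemma lift_rot_image:
  assumes "binary_group D"
  shows "lift (rot ` D) = D"
proof (intro equalityI subsetI)
  fix q assume "q \<in> lift (rot ` D)"
  then obtain d where d: "norm q = 1" "d \<in> D" "rot q = rot d" by (auto simp: lift_def)
  then have "q = d \<or> q = - d" using assms by (subst (asm) rot_eq_iff) (auto simp: binary_group_def)
  then show "q \<in> D" using d assms by (auto simp: binary_group_def)
qed (use assms in \<open>auto simp: lift_def binary_group_def\<close>)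

definition qconj :: "quaternion \<Rightarrow> quaternion \<Rightarrow> quaternion" where
  "qconj p a = p \<star> a \<star> qcnj p"

lemma qconj_cancel: "norm p = 1 \<Longrightarrow> qconj p (qconj (qcnj p) a) = a" "norm p = 1 \<Longrightarrow> qconj (qcnj p) (qconj p a) = a"
  by (simp_all add: qconj_def qmul_assoc)

lemma qconj_qmul: "norm p = 1 \<Longrightarrow> qconj p (a \<star> b) = qconj p a \<star> qconj p b"
  by (simp add: qconj_def qmul_assoc)

lemma binary_group_qconj:
  assumes "binary_group D" "norm p = 1"
  shows "binary_group (qconj p ` D)"
proof -
  have "qconj p qone = qone" using assms by (simp add: qconj_def)
  moreover have "norm (qconj p a) = 1" "qcnj (qconj p a) = qconj p (qcnj a)" "- qconj p a = qconj p (- a)" 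
    if "a \<in> D" for a
    using assms that by (simp_all add: qconj_def binary_group_def qcnj_qmul qmul_assoc)
  ultimately show ?thesis
    using assms unfolding binary_group_def by (auto simp flip: qconj_qmul[OF assms(2)]) (metis image_eqI)
qed

text \<open>Conjugation is an automorphism, so it carries orbits of \<open>R\<close> to orbits of the conjugate of \<open>R\<close>.\<close>

lemma qconj_orbit_iff:
  assumes "norm p = 1"
  shows "(\<exists>a\<in>R. \<exists>b\<in>R. qconj (qcnj p) y = a \<star> qconj (qcnj p) x \<star> b) \<longleftrightarrow>
    (\<exists>a\<in>qconj p ` R. \<exists>b\<in>qconj p ` R. y = a \<star> x \<star> b)"
proof -
  have "qconj (qcnj p) y = a \<star> qconj (qcnj p) x \<star> b \<longleftrightarrow> y = qconj p a \<star> x \<star> qconj p b" for a b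
    by (metis assms qconj_cancel qconj_qmul)
  then show ?thesis by simp
qed

lemma qconj_regular:
  assumes "norm p = 1" "continuous_on UNIV F" "\<forall>c>0. \<forall>x. F (c *\<^sub>R x) = c *\<^sub>R F x" "surj F"
  shows "continuous_on UNIV (\<lambda>x. F (qconj (qcnj p) x))"
    "\<forall>c>0. \<forall>x. F (qconj (qcnj p) (c *\<^sub>R x)) = c *\<^sub>R F (qconj (qcnj p) x)"
    "surj (\<lambda>x. F (qconj (qcnj p) x))"
proof -
  show "continuous_on UNIV (\<lambda>x. F (qconj (qcnj p) x))"
    unfolding qconj_def by (rule continuous_on_compose2[OF assms(2)]) (auto intro!: continuous_intros)
  show "\<forall>c>0. \<forall>x. F (qconj (qcnj p) (c *\<^sub>R x)) = c *\<^sub>R F (qconj (qcnj p) x)"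
    using assms(3) by (simp add: qconj_def del: split_paired_All)
  show "surj (\<lambda>x. F (qconj (qcnj p) x))"
    unfolding surj_def
  proof
    fix y
    obtain x where "y = F x" using assms(4) by (rule surjE)
    then have "y = F (qconj (qcnj p) (qconj p x))" by (simp only: qconj_cancel(2)[OF assms(1)])
    then show "\<exists>x. y = F (qconj (qcnj p) x)" by blast
  qed
qed

lemma orbit_map_qconj:
  assumes p: "norm p = 1" and F: "orbit_map R F"
  shows "orbit_map (qconj p ` R) (\<lambda>x. F (qconj (qcnj p) x))"
proof -
  have F': "continuous_on UNIV F" "\<forall>c>0. \<forall>x. F (c *\<^sub>R x) = c *\<^sub>R F x" "surj F"
    "\<And>x y. F x = F y \<longleftrightarrow> (\<exists>a\<in>R. \<exists>b\<in>R. y = a \<star> x \<star> b)"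
    using F unfolding orbit_map_def by blast+
  show ?thesis
    unfolding orbit_map_def F'(4) qconj_orbit_iff[OF p]
    using qconj_regular[OF p F'(1-3)] by blast
qed

lemma projective_orbit_map_qconj:
  assumes p: "norm p = 1" and F: "projective_orbit_map R F"
  shows "projective_orbit_map (qconj p ` R) (\<lambda>x. F (qconj (qcnj p) x))"
proof -
  have F': "continuous_on UNIV F" "\<forall>c>0. \<forall>x. F (c *\<^sub>R x) = c *\<^sub>R F x" "surj F"
    "\<And>x y. F x = F y \<or> F x = - F y \<longleftrightarrow> (\<exists>a\<in>R. \<exists>b\<in>R. y = a \<star> x \<star> b)"
    using F unfolding projective_orbit_map_def by blast+
  show ?thesis
    unfolding projective_orbit_map_def F'(4) qconj_orbit_iff[OF p]
    using qconj_regular[OF p F'(1-3)] by blast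
qed

lemma unity_root_norm:
  fixes u :: complex
  assumes "u ^ m = 1" "m > 0"
  shows "norm u = 1"
  using assms by (metis norm_one norm_power norm_ge_zero power_eq_imp_eq_base power_one zero_le_one)

lemma cnj_power_one: "u ^ m = 1 \<Longrightarrow> cnj u ^ m = 1"
  by (metis complex_cnj_one complex_cnj_power)

lemma binary_group_cyclic:
  assumes "n > 0" shows "binary_group (cyclic_lift n)"
  unfolding binary_group_def cyclic_lift_def
  using unity_root_norm[of _ "2 * n"] assms
  by (auto simp: qone_def qmul_def qcnj_def norm_Pair cnj_power_one power_mult_distrib)

lemma binary_group_dihedral:
  assumes "n > 0" shows "binary_group (dihedral_lift n)"
  unfolding binary_group_def dihedral_lift_def cyclic_lift_def
  using unity_root_norm[of _ "2 * n"] assms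
  by (auto simp: qone_def qmul_def qcnj_def norm_Pair cnj_power_one power_mult_distrib)

text \<open>As \<open>rot\<close> does not see the sign, the image depends only on the square, an \<open>n\<close>-th root of unity.\<close>

lemma card_rot_cyclic:
  assumes n: "n > 0"
  shows "finite (rot ` qconj p ` cyclic_lift n)" "card (rot ` qconj p ` cyclic_lift n) \<le> n"
proof -
  define h where "h w = rot (qconj p (csqrt w, 0))" for w
  have "rot (qconj p (u, 0)) = h (u ^ 2)" for u
  proof -
    have "csqrt (u ^ 2) = u \<or> csqrt (u ^ 2) = - u"
      by (metis power2_csqrt power2_eq_iff)
    moreover have "qconj p (- u, 0) = - qconj p (u, 0)"
      by (simp add: qconj_def qmul_def)
    ultimately show ?thesis unfolding h_def by (metis rot_minus)
  qed
  then have sub: "rot ` qconj p ` cyclic_lift n \<subseteq> h ` {w. w ^ n = 1}"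
    by (auto simp: cyclic_lift_def power_mult)
  have fin: "finite {w::complex. w ^ n = 1}" using n finite_roots_unity[of n] by simp
  then show "finite (rot ` qconj p ` cyclic_lift n)" using sub finite_surj by blast
  have "card (rot ` qconj p ` cyclic_lift n) \<le> card (h ` {w::complex. w ^ n = 1})"
    using sub fin by (intro card_mono) auto
  also have "\<dots> \<le> card {w::complex. w ^ n = 1}" using fin by (rule card_image_le)
  also have "\<dots> = n" using n by (simp add: card_roots_unity_eq)
  finally show "card (rot ` qconj p ` cyclic_lift n) \<le> n" .
qed

lemma rotation_about_axis1:
  assumes p: "norm p = 1" and ax: "rot p *v axis 1 1 = a /\<^sub>R norm a" and R: "rotation_about a R"
  obtains t where "R = rot (qconj p (cis t, 0))"
proof -
  have R': "rotation_matrix R" "R *v a = a" using R by (simp_all add: rotation_about_def SO3_simps)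
  let ?B = "rot (qcnj p) ** (R ** rot p)"
  have "rotation_matrix ?B"
    using p R' by (intro rotation_matrix_mult rotation_matrix_rot) auto
  moreover have "?B *v axis 1 1 = rot (qcnj p) *v (R *v (rot p *v axis 1 1))"
    by (simp only: matrix_vector_mul_assoc matrix_mul_assoc)
  then have "?B *v axis 1 1 = rot (qcnj p) *v (rot p *v axis 1 1)"
    by (simp only: ax matrix_vector_mult_scaleR R')
  then have "?B *v axis 1 1 = axis 1 1"
    using p by (simp add: matrix_vector_mul_assoc flip: rot_qmul)
  ultimately obtain t where t: "?B = rot (cis t, 0)" using rotation_fixing_axis1 by blast
  have "rot p ** ?B ** rot (qcnj p) = R"
    using p by (simp add: matrix_mul_assoc flip: rot_qmul)
       (simp add: p rot_qmul[symmetric] flip: matrix_mul_assoc)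
  then have "R = rot (qconj p (cis t, 0))" by (simp add: t qconj_def rot_qmul)
  then show ?thesis using that by blast
qed

lemma rot_qconj_pow:
  assumes "norm p = 1"
  shows "rot (qconj p (c, 0)) [^]\<^bsub>SO3\<^esub> (k::nat) = rot (qconj p (c ^ k, 0))"
proof (induction k)
  case 0
  have "qconj p (1, 0) = qone" using assms by (simp add: qconj_def flip: qone_def)
  then show ?case by (simp add: SO3_simps)
next
  case (Suc k)
  have "(c ^ Suc k, 0) = (c ^ k, 0) \<star> (c, 0)" by (simp add: qmul_def)
  then show ?case using Suc assms by (simp add: SO3_simps qconj_qmul rot_qmul)
qed

text \<open>The group generated by \<open>R\<close> lies in the image of the cyclic lift, which has at most \<open>n\<close> elements, so the
  order of \<open>R\<close> forces equality.\<close>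

lemma generate_cyclic:
  assumes n: "n > 0" and p: "norm p = 1" and R: "R = rot (qconj p (cis t, 0))" and ord: "group.ord SO3 R = n"
  shows "generate SO3 {R} = rot ` qconj p ` cyclic_lift n"
proof -
  interpret group SO3 by (rule group_SO3)
  have Rc: "R \<in> carrier SO3" using p by (simp add: R SO3_simps rotation_matrix_rot qconj_def norm_Pair)
  have bg: "binary_group (qconj p ` cyclic_lift n)"
    using binary_group_cyclic[OF n] binary_group_qconj p by blast
  have "rot (qconj p (cis t ^ n, 0)) = mat 1"
    using pow_ord_eq_1[OF Rc] ord rot_qconj_pow[OF p, of "cis t" n] by (simp add: R SO3_simps)
  moreover have "norm (qconj p (cis t ^ n, 0)) = 1" using p by (simp add: qconj_def norm_Pair norm_power)
  ultimately have "qconj p (cis t ^ n, 0) = qone \<or> qconj p (cis t ^ n, 0) = - qone"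
    using rot_eq_one_iff by blast
  then have "qconj (qcnj p) (qconj p (cis t ^ n, 0)) = qone \<or> qconj (qcnj p) (qconj p (cis t ^ n, 0)) = - qone"
    using p by (auto simp: qconj_def)
  then have "cis t ^ n = 1 \<or> cis t ^ n = - 1"
    unfolding qconj_cancel(2)[OF p] by (auto simp: qone_def)
  then have "cis t ^ (2 * n) = 1" by (auto simp: mult.commute power_mult)
  then have "R \<in> rot ` qconj p ` cyclic_lift n" unfolding R cyclic_lift_def by blast
  then have "generate SO3 {R} \<subseteq> rot ` qconj p ` cyclic_lift n"
    by (intro generate_subgroup_incl[OF _ subgroup_rot_image[OF bg]]) auto
  moreover have "card (generate SO3 {R}) = n" using generate_pow_card[OF Rc] ord by simp
  ultimately show ?thesis
    using card_rot_cyclic[OF n, of p] by (intro card_seteq) auto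
qed

lemma is_C_lift:
  assumes "is_C n G"
  obtains p where "n > 0" "norm p = 1" "subgroup G SO3" "lift G = qconj p ` cyclic_lift n"
proof -
  obtain a R where R: "n > 0" "rotation_about a R" "group.ord SO3 R = n" "G = generate SO3 {R}"
    using assms by (auto simp: is_C_def)
  then have "norm (a /\<^sub>R norm a) = 1" by (auto simp: rotation_about_def)
  then obtain A :: "real^3^3" where A: "rotation_matrix A" "A *v axis 1 1 = a /\<^sub>R norm a"
    using rotation_matrix_exists_basis[of "a /\<^sub>R norm a" 1] by auto
  then obtain p where p: "norm p = 1" "rot p = A" using rot_surj by blast
  obtain t where "R = rot (qconj p (cis t, 0))"
    using rotation_about_axis1[OF p(1) _ R(2)] p A by blast
  then have G: "G = rot ` qconj p ` cyclic_lift n" using generate_cyclic p R by blast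
  have "binary_group (qconj p ` cyclic_lift n)" 
    using binary_group_cyclic binary_group_qconj p R by blast
  then show ?thesis using that p R(1) G subgroup_rot_image lift_rot_image by blast
qed

text \<open>The vectors are completed to a positively oriented orthonormal basis by their cross product.\<close>

lemma rot_frame:
  fixes u v :: "real^3"
  assumes "norm u = 1" "norm v = 1" "u \<bullet> v = 0"
  obtains p where "norm p = 1" "rot p *v axis 1 1 = u" "rot p *v axis 2 1 = v"
proof -
  define M :: "real^3^3" where "M = vector [
      vector [u$1, v$1, u$2 * v$3 - u$3 * v$2],
      vector [u$2, v$2, u$3 * v$1 - u$1 * v$3],
      vector [u$3, v$3, u$1 * v$2 - u$2 * v$1]]"
  have uv: "u$1 * u$1 + u$2 * u$2 + u$3 * u$3 = 1" "v$1 * v$1 + v$2 * v$2 + v$3 * v$3 = 1"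
    "u$1 * v$1 + u$2 * v$2 + u$3 * v$3 = 0"
    using assms by (simp_all add: norm_eq_1 inner_vec_def sum_3)
  have lag: "(u$2 * v$3 - u$3 * v$2)\<^sup>2 + (u$3 * v$1 - u$1 * v$3)\<^sup>2 + (u$1 * v$2 - u$2 * v$1)\<^sup>2 = 1"
  proof -
    have "(u$2 * v$3 - u$3 * v$2)\<^sup>2 + (u$3 * v$1 - u$1 * v$3)\<^sup>2 + (u$1 * v$2 - u$2 * v$1)\<^sup>2 =
      (u$1 * u$1 + u$2 * u$2 + u$3 * u$3) * (v$1 * v$1 + v$2 * v$2 + v$3 * v$3) - (u$1 * v$1 + u$2 * v$2 + u$3 * v$3)\<^sup>2"
      by (simp add: power2_eq_square algebra_simps)
    then show ?thesis by (simp add: uv)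
  qed
  have "transpose M ** M = mat 1"
    using uv lag by (simp add: M_def vec_eq_iff forall_3 matrix_matrix_mult_def sum_3 transpose_def mat_def
       power2_eq_square) (simp add: algebra_simps)
  moreover have "det M = 1"
    using lag by (simp add: M_def det_3 power2_eq_square algebra_simps)
  ultimately have "rotation_matrix M" by (simp add: rotation_matrix_def orthogonal_matrix)
  then obtain p where "norm p = 1" "rot p = M" using rot_surj by blast
  moreover have "M *v axis 1 1 = u" "M *v axis 2 1 = v"
    by (simp_all add: M_def vec_eq_iff forall_3 matrix_vector_mult_def sum_3 axis_def)
  ultimately show ?thesis using that by blast
qed

text \<open>A lift of an element of order 2 has square \<open>-1\<close>, hence is a pure quaternion. It fixes the second
  axis only if it is \<open>j\<close> or \<open>- j\<close>.\<close>

lemma half_turn_about_axis2: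
  assumes p: "norm p = 1" and ax: "rot p *v axis 2 1 = b /\<^sub>R norm b" and S: "rotation_about b S"
    and ord: "group.ord SO3 S = 2"
  shows "S = rot (qconj p (0, 1))"
proof -
  interpret group SO3 by (rule group_SO3)
  have S': "rotation_matrix S" "S *v b = b" "S \<in> carrier SO3" using S by (simp_all add: rotation_about_def SO3_simps)
  obtain s where s: "norm s = 1" "rot s = S" using rot_surj S' by blast
  define q where "q = qconj (qcnj p) s"
  have "norm q = 1" using p s by (simp add: q_def qconj_def)
  moreover have "S = rot (qconj p q)" using p s by (simp add: q_def qconj_cancel)
  ultimately have q: "norm q = 1" "S = rot (qconj p q)" by blast+
  have "S [^]\<^bsub>SO3\<^esub> (2::nat) = \<one>\<^bsub>SO3\<^esub>" using pow_ord_eq_1[OF S'(3)] ord by simp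
  then have "S ** S = mat 1" by (simp add: numeral_2_eq_2 SO3_simps)
  then have "rot (s \<star> s) = mat 1" by (simp add: rot_qmul s)
  then have "s \<star> s = qone \<or> s \<star> s = - qone" using rot_eq_one_iff s by simp
  moreover have "q \<star> q = qconj (qcnj p) (s \<star> s)" using p by (simp add: q_def qconj_qmul)
  ultimately have qq: "q \<star> q = qone \<or> q \<star> q = - qone" using p by (auto simp: qconj_def)
  have ne: "q \<noteq> qone" "q \<noteq> - qone"
  proof -
    have "S \<noteq> mat 1" using ord ord_id unfolding SO3_simps(3) by auto
    then show "q \<noteq> qone" "q \<noteq> - qone" using q(2) p by (auto simp: qconj_def)
  qed
  have "rot q *v axis 2 1 = axis 2 1"
  proof -
    have "rot p *v (rot q *v axis 2 1) = rot (p \<star> q \<star> qcnj p \<star> p) *v axis 2 1"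
      using p by (simp add: matrix_vector_mul_assoc rot_qmul)
    also have "\<dots> = S *v (rot p *v axis 2 1)"
      unfolding q(2) qconj_def by (simp only: rot_qmul matrix_vector_mul_assoc)
    also have "\<dots> = rot p *v axis 2 1" by (simp only: ax matrix_vector_mult_scaleR S')
    finally have "rot (qcnj p) *v (rot p *v (rot q *v axis 2 1)) = rot (qcnj p) *v (rot p *v axis 2 1)" by simp
    then show ?thesis using p by (simp add: matrix_vector_mul_assoc matrix_mul_assoc flip: rot_qmul)
  qed
  moreover obtain a b c d where abcd: "q = quat a b c d" by (rule quat_cases)
  ultimately have "a*a - b*b + c*c - d*d = 1"
    by (simp add: rot_quat vec_eq_iff forall_3 matrix_vector_mult_def sum_3 axis_def)
  moreover have n: "a*a + b*b + c*c + d*d = 1" using q abcd by (simp add: unit_quat_iff)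
  ultimately have "b*b + d*d = 0" by linarith
  then have bd: "b = 0" "d = 0" by (simp_all add: sum_squares_eq_zero_iff)
  have "a * c = 0" using qq by (auto simp: abcd quat_arith)
  moreover have "a*a = 1" if "c = 0" using n bd that by simp
  ultimately have "a = 0" using ne bd by (auto simp: abcd quat_arith square_eq_1_iff)
  then have "c = 1 \<or> c = - 1" using n bd by (simp add: square_eq_1_iff)
  then have "q = (0, 1) \<or> q = - (0, 1)" using \<open>a = 0\<close> bd by (auto simp: abcd quat_def complex_eq_iff)
  moreover have "qconj p (- (0, 1)) = - qconj p (0, 1)" by (simp only: qconj_def qmul_minus)
  ultimately show ?thesis using q(2) rot_minus by metis
qed

lemma is_D_lift:
  assumes "is_D n G"
  obtains p where "n > 0" "norm p = 1" "subgroup G SO3" "lift G = qconj p ` dihedral_lift n"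
proof -
  obtain a b R S where R: "n > 0" "rotation_about a R" "group.ord SO3 R = n" 
    "rotation_about b S" "group.ord SO3 S = 2" "orthogonal a b" "G = generate SO3 {R, S}"
    using assms by (auto simp: is_D_def)
  then have "norm (a /\<^sub>R norm a) = 1" "norm (b /\<^sub>R norm b) = 1" "(a /\<^sub>R norm a) \<bullet> (b /\<^sub>R norm b) = 0"
    by (auto simp: rotation_about_def orthogonal_def)
  then obtain p where p: "norm p = 1" "rot p *v axis 1 1 = a /\<^sub>R norm a" "rot p *v axis 2 1 = b /\<^sub>R norm b"
    using rot_frame by blast
  obtain t where t: "R = rot (qconj p (cis t, 0))"
    using rotation_about_axis1[OF p(1,2) R(2)] by blast
  then have C: "generate SO3 {R} = rot ` qconj p ` cyclic_lift n" using generate_cyclic p R by blast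
  have S: "S = rot (qconj p (0, 1))" using half_turn_about_axis2 p R by blast
  have bg: "binary_group (qconj p ` dihedral_lift n)" 
    using binary_group_dihedral binary_group_qconj p R by blast
  interpret group SO3 by (rule group_SO3)
  have RS: "R \<in> carrier SO3" "S \<in> carrier SO3" using R by (simp_all add: rotation_about_def)
  have G: "G = rot ` qconj p ` dihedral_lift n"
  proof (intro equalityI subsetI)
    have "R \<in> generate SO3 {R}" by (rule generate.incl) simp
    then have "R \<in> rot ` qconj p ` dihedral_lift n" using C by (auto simp: dihedral_lift_def)
    moreover have "S \<in> rot ` qconj p ` dihedral_lift n" unfolding S dihedral_lift_def by auto
    ultimately show "A \<in> rot ` qconj p ` dihedral_lift n" if "A \<in> G" for A
      using generate_subgroup_incl[OF _ subgroup_rot_image[OF bg], of "{R, S}"] that R by blast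
  next
    fix A assume "A \<in> rot ` qconj p ` dihedral_lift n"
    moreover have "rot ` qconj p ` cyclic_lift n \<subseteq> G"
      using C mono_generate[of "{R}" "{R, S}"] R by auto
    moreover have "rot (qconj p (0, u)) \<in> G" if "u ^ (2 * n) = 1" for u
    proof -
      have "(0, u) = (u, 0) \<star> (0, 1)" by (simp add: qmul_def)
      then have "rot (qconj p (0, u)) = rot (qconj p (u, 0)) \<otimes>\<^bsub>SO3\<^esub> S"
        using p by (simp only: S SO3_simps qconj_qmul rot_qmul)
      moreover have "rot (qconj p (u, 0)) \<in> generate SO3 {R}"
        unfolding C cyclic_lift_def using that by blast
      then have "rot (qconj p (u, 0)) \<in> G" using mono_generate[of "{R}" "{R, S}"] R by auto
      moreover have "S \<in> G" unfolding R by (rule generate.incl) simp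
      ultimately show ?thesis unfolding R by (metis generate.eng)
    qed
    ultimately show "A \<in> G" unfolding dihedral_lift_def by blast
  qed
  then show ?thesis using that p R(1) bg subgroup_rot_image lift_rot_image by blast
qed

theorem cyclic_misorientation_space:
  assumes "is_C n G"
  shows "misorientation_space G G homeomorphic_space RP3"
proof -
  obtain p where p: "n > 0" "norm p = 1" "subgroup G SO3" "lift G = qconj p ` cyclic_lift n"
    using is_C_lift[OF assms] .
  show ?thesis
    by (rule misorientation_space_projective[OF p(3)], unfold p(4),
        rule projective_orbit_map_qconj[OF p(2) cyclic_orbit_map[OF p(1)]])
qed

theorem even_dihedral_misorientation_space:
  assumes "is_D n G" "even n"
  shows "misorientation_space G G homeomorphic_space S3"
proof -
  obtain p where p: "n > 0" "norm p = 1" "subgroup G SO3" "lift G = qconj p ` dihedral_lift n"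
    using is_D_lift[OF assms(1)] .
  show ?thesis
    by (rule misorientation_space_sphere[OF p(3)], unfold p(4),
        rule orbit_map_qconj[OF p(2) dihedral_even_orbit_map[OF p(1) assms(2)]])
qed

theorem odd_dihedral_misorientation_space:
  assumes "is_D n G" "odd n"
  shows "misorientation_space G G homeomorphic_space RP3"
proof -
  obtain p where p: "n > 0" "norm p = 1" "subgroup G SO3" "lift G = qconj p ` dihedral_lift n"
    using is_D_lift[OF assms(1)] .
  show ?thesis
    by (rule misorientation_space_projective[OF p(3)], unfold p(4),
        rule projective_orbit_map_qconj[OF p(2) dihedral_odd_orbit_map[OF assms(2)]])
qed

section \<open>Chambers of reflection groups\<close>

text \<open>Reflections are of the form \<open>x \<mapsto> a (cnj x) b\<close>, which makes a binary group a root system.\<close>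

lemma reflection_eq_qmul:
  assumes "norm a = 1"
  shows "x - (2 * (x \<bullet> a)) *\<^sub>R a = (- a) \<star> qcnj x \<star> a"
proof -
  have "a \<star> qcnj x + x \<star> qcnj a = (2 * (x \<bullet> a)) *\<^sub>R qone"
    by (cases a rule: quat_cases; cases x rule: quat_cases) (simp add: quat_arith algebra_simps)
  then have "(a \<star> qcnj x + x \<star> qcnj a) \<star> a = (2 * (x \<bullet> a)) *\<^sub>R a" by simp
  then show ?thesis using assms by (simp add: qmul_add algebra_simps)
qed

lemma ex_max_on_finite: 
  fixes \<phi> :: "'b \<Rightarrow> real"
  assumes "finite M" "M \<noteq> {}"
  obtains m where "m \<in> M" "\<And>n. n \<in> M \<Longrightarrow> \<phi> n \<le> \<phi> m"
proof -
  have "Max (\<phi> ` M) \<in> \<phi> ` M" using assms by simp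
  then obtain m where "m \<in> M" "\<phi> m = Max (\<phi> ` M)" by auto
  then show ?thesis using that[of m] assms by simp
qed

text \<open>A binary group \<open>R\<close> viewed as a root system. The \<open>\<alpha> i\<close> are the simple roots and the \<open>\<omega> i\<close> form the dual
  basis, so \<open>r \<bullet> \<omega> i\<close> is a coefficient of \<open>r\<close>, and positivity says that all coefficients of a root
  have the same sign. The set \<open>K\<close> collects the permutations of the simple roots that are induced by
  motions \<open>x \<mapsto> a x b\<close>; no permutation is induced by an orientation reversing motion.\<close>

locale chamber =
  fixes R :: "quaternion set" and \<alpha> \<omega> :: "4 \<Rightarrow> quaternion" and K :: "(4 \<Rightarrow> 4) set"
  assumes finite_R: "finite R" and group_R: "binary_group R"
    and simple_R: "\<alpha> i \<in> R"
    and dual: "\<alpha> i \<bullet> \<omega> j = (if i = j then 1 else 0)"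
    and expand: "x = (\<Sum>i\<in>UNIV. (x \<bullet> \<omega> i) *\<^sub>R \<alpha> i)"
    and positivity: "r \<in> R \<Longrightarrow> (\<forall>i. r \<bullet> \<omega> i \<ge> 0) \<or> (\<forall>i. r \<bullet> \<omega> i \<le> 0)"
    and symmetry_iff: "bij \<pi> \<Longrightarrow> (\<exists>a\<in>R. \<exists>b\<in>R. \<forall>i. a \<star> \<alpha> i \<star> b = \<alpha> (\<pi> i)) \<longleftrightarrow> \<pi> \<in> K"
    and K_bij: "\<pi> \<in> K \<Longrightarrow> bij \<pi>"
    and no_odd_symmetry: "bij \<pi> \<Longrightarrow> a \<in> R \<Longrightarrow> b \<in> R \<Longrightarrow> \<exists>i. a \<star> qcnj (\<alpha> i) \<star> b \<noteq> \<alpha> (\<pi> i)"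
begin

text \<open>The first argument tells whether the motion preserves the orientation.\<close>

definition motion :: "bool \<Rightarrow> (quaternion \<Rightarrow> quaternion) \<Rightarrow> bool" where
  "motion e f \<longleftrightarrow> (\<exists>a\<in>R. \<exists>b\<in>R. f = (\<lambda>x. a \<star> (if e then x else qcnj x) \<star> b))"

lemma R_props: "a \<in> R \<Longrightarrow> norm a = 1" "a \<in> R \<Longrightarrow> qcnj a \<in> R" "a \<in> R \<Longrightarrow> - a \<in> R" 
  "a \<in> R \<Longrightarrow> b \<in> R \<Longrightarrow> a \<star> b \<in> R" "qone \<in> R"
  using group_R by (auto simp: binary_group_def)

lemma motion_comp:
  assumes "motion e f" "motion e' g"
  shows "motion (e = e') (\<lambda>x. f (g x))"
proof -
  obtain a b c d where R: "a \<in> R" "b \<in> R" "c \<in> R" "d \<in> R"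
    and f: "f = (\<lambda>x. a \<star> (if e then x else qcnj x) \<star> b)" and g: "g = (\<lambda>x. c \<star> (if e' then x else qcnj x) \<star> d)"
    using assms unfolding motion_def by blast
  show ?thesis
  proof (cases e)
    case True
    then have "(\<lambda>x. f (g x)) = (\<lambda>x. (a \<star> c) \<star> (if e = e' then x else qcnj x) \<star> (d \<star> b))"
      by (auto simp: f g qmul_assoc)
    then show ?thesis unfolding motion_def using R R_props by blast
  next
    case False
    then have "(\<lambda>x. f (g x)) = (\<lambda>x. (a \<star> qcnj d) \<star> (if e = e' then x else qcnj x) \<star> (qcnj c \<star> b))"
      by (auto simp: f g qmul_assoc qcnj_qmul)
    then show ?thesis unfolding motion_def using R R_props by blast
  qed
qed

lemma motion_inverse:
  assumes "motion e f"
  obtains g where "motion e g" "\<And>x. g (f x) = x" "\<And>x. f (g x) = x"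
proof -
  obtain a b where R: "a \<in> R" "b \<in> R" and f: "f = (\<lambda>x. a \<star> (if e then x else qcnj x) \<star> b)"
    using assms unfolding motion_def by blast
  have n: "norm a = 1" "norm b = 1" using R R_props by auto
  show ?thesis
  proof (cases e)
    case True
    have "motion e (\<lambda>x. qcnj a \<star> (if e then x else qcnj x) \<star> qcnj b)"
      unfolding motion_def using R R_props by blast
    then show ?thesis using that[of "\<lambda>x. qcnj a \<star> x \<star> qcnj b"] True n by (simp add: f qmul_assoc)
  next
    case False
    have "motion e (\<lambda>x. b \<star> (if e then x else qcnj x) \<star> a)"
      unfolding motion_def using R by blast
    then show ?thesis using that[of "\<lambda>x. b \<star> qcnj x \<star> a"] False n by (simp add: f qmul_assoc qcnj_qmul)
  qed
qed

lemma motion_props: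
  assumes "motion e f"
  shows "f x \<bullet> f y = x \<bullet> y" "f (x + y) = f x + f y" "f (c *\<^sub>R x) = c *\<^sub>R f x" "r \<in> R \<Longrightarrow> f r \<in> R"
    "f (x - y) = f x - f y" "continuous_on S f"
proof -
  obtain a b where R: "a \<in> R" "b \<in> R" and f: "f = (\<lambda>x. a \<star> (if e then x else qcnj x) \<star> b)"
    using assms unfolding motion_def by blast
  have n: "a \<bullet> a = 1" "b \<bullet> b = 1" using unit_inner[OF R_props(1)[OF R(1)]] unit_inner[OF R_props(1)[OF R(2)]] .
  show "f x \<bullet> f y = x \<bullet> y" by (simp add: f n inner_qmul_left inner_qmul_right)
  show add: "f (x + y) = f x + f y" and sc: "f (c *\<^sub>R x) = c *\<^sub>R f x" for x y c by (auto simp: f qmul_add)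
  show "f (x - y) = f x - f y" using add[of x "- y"] sc[of "-1" y] by simp
  show "f r \<in> R" if "r \<in> R" using that R R_props by (auto simp: f)
  show "continuous_on S f"
    by (cases e) (auto simp: f intro!: continuous_intros)
qed

lemma finite_motions: "finite {f. \<exists>e. motion e f}"
proof -
  have "{f. \<exists>e. motion e f} = (\<lambda>(e, a, b) x. a \<star> (if e then x else qcnj x) \<star> b) ` (UNIV \<times> R \<times> R)"
    unfolding motion_def by (auto simp: image_iff) metis+
  then show ?thesis using finite_R by simp
qed

lemma motion_id: "motion True (\<lambda>x. x)"
  unfolding motion_def using R_props(5) by (intro bexI[of _ qone]) auto

definition refl :: "4 \<Rightarrow> quaternion \<Rightarrow> quaternion" where
  "refl i x = x - (2 * (x \<bullet> \<alpha> i)) *\<^sub>R \<alpha> i"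

lemma motion_refl: "motion False (refl i)"
  unfolding motion_def using reflection_eq_qmul[OF R_props(1)[OF simple_R[of i]]] simple_R[of i] R_props(3)[OF simple_R[of i]]
  by (intro bexI[of _ "- \<alpha> i"] bexI[of _ "\<alpha> i"]) (auto simp: refl_def)

text \<open>A point in the interior of the chamber, at equal distances from all walls.\<close>

definition \<rho> :: quaternion where "\<rho> = (\<Sum>i\<in>UNIV. \<omega> i)"

lemma simple_rho: "\<alpha> i \<bullet> \<rho> = 1"
  by (simp add: \<rho>_def inner_sum_right dual)

lemma inner_expand: "x \<bullet> y = (\<Sum>i\<in>UNIV. (x \<bullet> \<omega> i) * (\<alpha> i \<bullet> y))"
  by (subst expand[of x]) (simp add: inner_sum_left)

definition C :: "quaternion set" where "C = {x. \<forall>i. x \<bullet> \<alpha> i \<ge> 0}"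

lemma coords_eq: "(\<And>i. x \<bullet> \<alpha> i = y \<bullet> \<alpha> i) \<Longrightarrow> x = y"
proof -
  assume a: "\<And>i. x \<bullet> \<alpha> i = y \<bullet> \<alpha> i"
  have "z \<bullet> x = z \<bullet> y" for z
    unfolding inner_expand[of z x] inner_expand[of z y] using a by (simp add: inner_commute)
  then show "x = y" by (metis inner_commute vector_eq_rdot)
qed

text \<open>Among the finitely many images of \<open>x\<close> choose the one with the largest inner product with \<open>\<rho>\<close>. If it
  were on the wrong side of a wall, reflecting it in that wall would increase the inner product.\<close>

lemma chamber_meets_orbit:
  obtains e f where "motion e f" "f x \<in> C"
proof -
  obtain f where f: "f \<in> {f. \<exists>e. motion e f}" and max: "\<And>g. g \<in> {f. \<exists>e. motion e f} \<Longrightarrow> g x \<bullet> \<rho> \<le> f x \<bullet> \<rho>"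
    using ex_max_on_finite[OF finite_motions, of "\<lambda>f. f x \<bullet> \<rho>"] motion_id by blast
  then obtain e where e: "motion e f" by blast
  have "f x \<bullet> \<alpha> i \<ge> 0" for i
  proof -
    have "refl i (f x) \<bullet> \<rho> \<le> f x \<bullet> \<rho>"
      using motion_comp[OF motion_refl e] max by blast
    then show ?thesis by (simp add: refl_def inner_diff_left simple_rho)
  qed
  then show ?thesis using that e by (auto simp: C_def)
qed

text \<open>If the motion makes a simple root negative, then the inner product of this root with \<open>x\<close> is nonnegative as
  \<open>x\<close> lies in the chamber, and nonpositive as \<open>f x\<close> does.\<close>

lemma wall_of_negative:
  assumes f: "motion e f" and x: "x \<in> C" "f x \<in> C" and neg: "f (\<alpha> i) \<bullet> \<omega> j < 0"
  shows "x \<bullet> \<alpha> i = 0"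
proof -
  have "\<forall>k. f (\<alpha> i) \<bullet> \<omega> k \<le> 0"
    using positivity[OF motion_props(4)[OF f simple_R]] neg by (metis not_less)
  then have "f (\<alpha> i) \<bullet> f x \<le> 0"
    unfolding inner_expand[of "f (\<alpha> i)" "f x"] using x by (intro sum_nonpos mult_nonpos_nonneg) (auto simp: C_def inner_commute)
  then have "x \<bullet> \<alpha> i \<le> 0" by (simp add: motion_props[OF f] inner_commute)
  then show ?thesis using x by (auto simp: C_def intro: antisym)
qed

lemma negative_rho:
  assumes "r \<in> R" "r \<bullet> \<omega> j < 0"
  shows "r \<bullet> \<rho> < 0"
proof -
  have "\<forall>k. r \<bullet> \<omega> k \<le> 0" using positivity[OF assms(1)] assms(2) by (metis not_less)
  then have "(\<Sum>k\<in>UNIV. r \<bullet> \<omega> k) < 0" using assms(2) by (intro sum_strict_mono_ex1[where g = "\<lambda>_. 0", simplified]) auto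
  then show ?thesis by (simp add: \<rho>_def inner_sum_right)
qed

text \<open>Simple roots span the extremal rays of the cone of nonnegative combinations of simple roots, and
  \<open>f\<close> maps this cone onto itself.\<close>

lemma permutes_simple_roots:
  assumes f: "motion e f" and g: "motion e g" and inv: "\<And>x. g (f x) = x" "\<And>x. f (g x) = x"
    and pos: "\<And>i j. f (\<alpha> i) \<bullet> \<omega> j \<ge> 0" "\<And>i j. g (\<alpha> i) \<bullet> \<omega> j \<ge> 0"
  obtains \<pi> where "bij \<pi>" "\<And>i. f (\<alpha> i) = \<alpha> (\<pi> i)"
proof -
  have ex: "\<exists>j. f (\<alpha> i) = \<alpha> j" for i
  proof -
    have "f (\<alpha> i) \<noteq> 0"
      using R_props(1)[OF motion_props(4)[OF f simple_R[of i]]] by auto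
    then obtain j where j: "f (\<alpha> i) \<bullet> \<omega> j \<noteq> 0" using expand[of "f (\<alpha> i)"] by force
    then have jpos: "f (\<alpha> i) \<bullet> \<omega> j > 0" using pos(1)[of i j] by linarith
    have lin: "g (\<Sum>k\<in>A. c k *\<^sub>R \<alpha> k) = (\<Sum>k\<in>A. c k *\<^sub>R g (\<alpha> k))" if "finite A" for A c
      using that motion_props(3)[OF g, of 0 0] by (induction A) (simp_all add: motion_props[OF g])
    have "\<alpha> i = g (\<Sum>k\<in>UNIV. (f (\<alpha> i) \<bullet> \<omega> k) *\<^sub>R \<alpha> k)" using expand[of "f (\<alpha> i)"] inv by simp
    then have ai: "\<alpha> i = (\<Sum>k\<in>UNIV. (f (\<alpha> i) \<bullet> \<omega> k) *\<^sub>R g (\<alpha> k))" by (simp add: lin)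
    have zero: "g (\<alpha> j) \<bullet> \<omega> l = 0" if "l \<noteq> i" for l
    proof -
      have "0 = (\<Sum>k\<in>UNIV. (f (\<alpha> i) \<bullet> \<omega> k) * (g (\<alpha> k) \<bullet> \<omega> l))"
        using dual[of i l] that by (subst (asm) ai) (simp add: inner_sum_left)
      moreover have "\<forall>k\<in>UNIV. (f (\<alpha> i) \<bullet> \<omega> k) * (g (\<alpha> k) \<bullet> \<omega> l) \<ge> 0" using pos by simp
      ultimately have "(f (\<alpha> i) \<bullet> \<omega> j) * (g (\<alpha> j) \<bullet> \<omega> l) = 0"
        by (metis (mono_tags, lifting) finite_class.finite_UNIV sum_nonneg_eq_0_iff UNIV_I)
      then show ?thesis using jpos by simp
    qed
    have "g (\<alpha> j) = (\<Sum>k\<in>UNIV. (if k = i then (g (\<alpha> j) \<bullet> \<omega> i) *\<^sub>R \<alpha> i else 0))"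
      by (subst expand[of "g (\<alpha> j)"], rule sum.cong) (auto simp: zero)
    then have gj: "g (\<alpha> j) = (g (\<alpha> j) \<bullet> \<omega> i) *\<^sub>R \<alpha> i" by simp
    then have "norm (g (\<alpha> j)) = \<bar>g (\<alpha> j) \<bullet> \<omega> i\<bar> * norm (\<alpha> i)" by (metis norm_scaleR)
    then have "g (\<alpha> j) \<bullet> \<omega> i = 1"
      using R_props(1)[OF motion_props(4)[OF g simple_R[of j]]] R_props(1)[OF simple_R[of i]] pos(2)[of j i] by simp
    then have "g (\<alpha> j) = \<alpha> i" using gj by simp
    then show ?thesis using inv(2) by metis
  qed
  then obtain \<pi> where \<pi>: "\<And>i. f (\<alpha> i) = \<alpha> (\<pi> i)" by metis
  have "inj \<alpha>" by (rule injI) (metis dual zero_neq_one)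
  then have "inj \<pi>" by (metis \<pi> inv(1) injI inj_eq)
  then have "bij \<pi>" by (simp add: bij_def finite_UNIV_inj_surj)
  then show ?thesis using that \<pi> by blast
qed

lemma symmetry_of_motion:
  assumes f: "motion e f" and g: "motion e g" and inv: "\<And>x. g (f x) = x" "\<And>x. f (g x) = x"
    and pos: "\<And>i j. f (\<alpha> i) \<bullet> \<omega> j \<ge> 0" "\<And>i j. g (\<alpha> i) \<bullet> \<omega> j \<ge> 0"
  obtains \<pi> where "e" "\<pi> \<in> K" "\<And>i. f (\<alpha> i) = \<alpha> (\<pi> i)"
proof -
  obtain \<pi> where \<pi>: "bij \<pi>" "\<And>i. f (\<alpha> i) = \<alpha> (\<pi> i)" using permutes_simple_roots[OF assms] by blast
  obtain a b where ab: "a \<in> R" "b \<in> R" "f = (\<lambda>x. a \<star> (if e then x else qcnj x) \<star> b)"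
    using f unfolding motion_def by blast
  have e
  proof (rule ccontr)
    assume "\<not> e"
    then show False using no_odd_symmetry[OF \<pi>(1) ab(1,2)] \<pi>(2) ab(3) by simp
  qed
  then have "\<pi> \<in> K" using symmetry_iff[OF \<pi>(1)] \<pi>(2) ab by auto
  with \<open>e\<close> \<pi>(2) that show ?thesis by blast
qed

text \<open>Among the motions with the same value at \<open>x\<close> as \<open>f\<close>, take the one that moves \<open>\<rho>\<close> least. If it made
  a simple root negative, then \<open>x\<close> would lie on the corresponding wall, and composing with the
  reflection in it would improve the motion. The same applies to the inverse motion, so the
  motion permutes the simple roots.\<close>

lemma chamber_unique:
  assumes f: "motion e f" and x: "x \<in> C" "f x \<in> C"
  obtains g \<pi> where "motion True g" "g x = f x" "\<pi> \<in> K" "\<And>i. g (\<alpha> i) = \<alpha> (\<pi> i)"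
proof -
  let ?M = "{h. \<exists>e. motion e h} \<inter> {h. h x = f x}"
  have "finite ?M" "f \<in> ?M" using finite_motions f by auto
  then obtain h where h: "h \<in> ?M" and max: "\<And>k. k \<in> ?M \<Longrightarrow> k \<rho> \<bullet> \<rho> \<le> h \<rho> \<bullet> \<rho>"
    using ex_max_on_finite[of ?M "\<lambda>k. k \<rho> \<bullet> \<rho>"] by blast
  obtain e' where e': "motion e' h" "h x = f x" using h by auto
  obtain k where k: "motion e' k" "\<And>x. k (h x) = x" "\<And>x. h (k x) = x" using motion_inverse[OF e'(1)] by metis
  have "h x \<in> C" unfolding e'(2) by (rule x(2))
  moreover have "k (h x) \<in> C" unfolding k(2) by (rule x(1))
  ultimately have hC: "h x \<in> C" "k (h x) \<in> C" .
  have 1: "h (\<alpha> i) \<bullet> \<omega> j \<ge> 0" for i j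
  proof (rule ccontr)
    assume neg: "\<not> h (\<alpha> i) \<bullet> \<omega> j \<ge> 0"
    then have "x \<bullet> \<alpha> i = 0" using wall_of_negative[OF e'(1) x(1) hC(1), of i j] by simp
    then have "(\<lambda>x. h (refl i x)) \<in> ?M" using motion_comp[OF e'(1) motion_refl[of i]] e' by (auto simp: refl_def)
    then have "h (refl i \<rho>) \<bullet> \<rho> \<le> h \<rho> \<bullet> \<rho>" using max by blast
    moreover have "h (refl i \<rho>) \<bullet> \<rho> = h \<rho> \<bullet> \<rho> - 2 * (h (\<alpha> i) \<bullet> \<rho>)"
    proof -
      have "\<rho> \<bullet> \<alpha> i = 1" using simple_rho[of i] by (simp only: inner_commute)
      then have "refl i \<rho> = \<rho> - 2 *\<^sub>R \<alpha> i" by (simp only: refl_def mult_1_right)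
      then have "h (refl i \<rho>) = h \<rho> - 2 *\<^sub>R h (\<alpha> i)" by (simp only: motion_props(3,5)[OF e'(1)])
      then show ?thesis by (simp only: inner_diff_left inner_scaleR_left)
    qed
    moreover have "h (\<alpha> i) \<bullet> \<rho> < 0"
      using negative_rho[of "h (\<alpha> i)" j] neg motion_props(4)[OF e'(1) simple_R] by simp
    ultimately show False by linarith
  qed
  have 2: "k (\<alpha> i) \<bullet> \<omega> j \<ge> 0" for i j
  proof (rule ccontr)
    assume neg: "\<not> k (\<alpha> i) \<bullet> \<omega> j \<ge> 0"
    then have "h x \<bullet> \<alpha> i = 0" using wall_of_negative[OF k(1) hC(1) hC(2), of i j] by simp
    then have "(\<lambda>x. refl i (h x)) \<in> ?M" using motion_comp[OF motion_refl[of i] e'(1)] e' by (auto simp: refl_def)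
    then have "refl i (h \<rho>) \<bullet> \<rho> \<le> h \<rho> \<bullet> \<rho>" using max by blast
    moreover have "h \<rho> \<bullet> \<alpha> i = k (\<alpha> i) \<bullet> \<rho>"
      using motion_props(1)[OF e'(1), of \<rho> "k (\<alpha> i)"] k(3) by (simp add: inner_commute)
    then have "refl i (h \<rho>) \<bullet> \<rho> = h \<rho> \<bullet> \<rho> - 2 * (k (\<alpha> i) \<bullet> \<rho>)"
      using simple_rho[of i] by (simp add: refl_def inner_diff_left)
    moreover have "k (\<alpha> i) \<bullet> \<rho> < 0"
      using negative_rho[of "k (\<alpha> i)" j] neg motion_props(4)[OF k(1) simple_R] by simp
    ultimately show False by linarith
  qed
  obtain \<pi> where "e'" "\<pi> \<in> K" "\<And>i. h (\<alpha> i) = \<alpha> (\<pi> i)"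
    using symmetry_of_motion[OF e'(1) k 1 2] by blast
  then show ?thesis using that e' by auto
qed

text \<open>An interior point lies on no wall, so the given motion itself is a symmetry. In particular, it preserves
  the orientation.\<close>

lemma chamber_interior_unique:
  assumes f: "motion e f" and x: "x \<in> C" "f x \<in> C" and int: "\<And>i. x \<bullet> \<alpha> i > 0"
  obtains \<pi> where "e" "\<pi> \<in> K" "\<And>i. f (\<alpha> i) = \<alpha> (\<pi> i)"
proof -
  obtain k where k: "motion e k" "\<And>x. k (f x) = x" "\<And>x. f (k x) = x" using motion_inverse[OF f] by metis
  have 1: "f (\<alpha> i) \<bullet> \<omega> j \<ge> 0" for i j
    using wall_of_negative[OF f x, of i j] int[of i] by (metis less_irrefl not_less)
  have kx: "k (\<alpha> i) \<bullet> x \<noteq> 0" for i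
  proof -
    have kR: "k (\<alpha> i) \<in> R" using motion_props(4)[OF k(1) simple_R] .
    then have "k (\<alpha> i) \<noteq> 0" using R_props(1)[OF kR] by auto
    then obtain j where j: "k (\<alpha> i) \<bullet> \<omega> j \<noteq> 0" using expand[of "k (\<alpha> i)"] by force
    have int': "\<alpha> l \<bullet> x > 0" for l using int[of l] by (simp add: inner_commute)
    from positivity[OF kR] show ?thesis
    proof
      assume A: "\<forall>l. 0 \<le> k (\<alpha> i) \<bullet> \<omega> l"
      have "0 < (\<Sum>l\<in>UNIV. (k (\<alpha> i) \<bullet> \<omega> l) * (\<alpha> l \<bullet> x))"
      proof (rule sum_pos2[of _ j])
        show "0 < (k (\<alpha> i) \<bullet> \<omega> j) * (\<alpha> j \<bullet> x)" using j A int' by (simp add: order.strict_iff_order)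
        show "0 \<le> (k (\<alpha> i) \<bullet> \<omega> l) * (\<alpha> l \<bullet> x)" for l using A int'[of l] by simp
      qed simp_all
      then show ?thesis by (simp flip: inner_expand[of "k (\<alpha> i)" x])
    next
      assume A: "\<forall>l. k (\<alpha> i) \<bullet> \<omega> l \<le> 0"
      have "0 < (\<Sum>l\<in>UNIV. - (k (\<alpha> i) \<bullet> \<omega> l) * (\<alpha> l \<bullet> x))"
      proof (rule sum_pos2[of _ j])
        have "- (k (\<alpha> i) \<bullet> \<omega> j) > 0" using j A by (simp add: order.strict_iff_order)
        then show "0 < - (k (\<alpha> i) \<bullet> \<omega> j) * (\<alpha> j \<bullet> x)" using int' mult_pos_pos by blast
        show "0 \<le> - (k (\<alpha> i) \<bullet> \<omega> l) * (\<alpha> l \<bullet> x)" for l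
          using A int'[of l] by (simp add: mult_nonpos_nonneg)
      qed simp_all
      then show ?thesis by (simp add: sum_negf flip: inner_expand[of "k (\<alpha> i)" x])
    qed
  qed
  have 2: "k (\<alpha> i) \<bullet> \<omega> j \<ge> 0" for i j
  proof (rule ccontr)
    assume "\<not> k (\<alpha> i) \<bullet> \<omega> j \<ge> 0"
    then have "f x \<bullet> \<alpha> i = 0" using wall_of_negative[OF k(1) x(2), of i j] x k by simp
    moreover have "f x \<bullet> \<alpha> i = k (\<alpha> i) \<bullet> x"
      using motion_props(1)[OF f, of x "k (\<alpha> i)"] k(3) by (simp add: inner_commute)
    ultimately show False using kx by simp
  qed
  show ?thesis using symmetry_of_motion[OF f k 1 2] that by blast
qed

end

section \<open>Folding and doubling a chamber\<close>

definition vmin :: "real^4 \<Rightarrow> real" where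
  "vmin v = Min (range (($) v))"

lemma vmin_le: "vmin v \<le> v $ i"
  by (simp add: vmin_def)

lemma vmin_attained: obtains i where "vmin v = v $ i"
proof -
  have "vmin v \<in> range (($) v)" unfolding vmin_def by (rule Min_in) auto
  then show ?thesis using that by blast
qed

lemma vmin_eqI: "v $ i = m \<Longrightarrow> (\<And>j. m \<le> v $ j) \<Longrightarrow> vmin v = m"
  by (metis vmin_attained vmin_le order_antisym)

lemma vmin_permute: "bij \<pi> \<Longrightarrow> vmin (\<chi> i. v $ \<pi> i) = vmin v"
proof -
  assume "bij \<pi>"
  then have "range (\<lambda>i. v $ \<pi> i) = range (($) v)"
    by (metis bij_is_surj image_image)
  then show ?thesis by (simp add: vmin_def)
qed

lemma vmin_scaleR: "c > 0 \<Longrightarrow> vmin (c *\<^sub>R v) = c * vmin v"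
proof -
  assume "c > 0"
  moreover obtain i where "vmin v = v $ i" by (rule vmin_attained)
  ultimately show ?thesis using vmin_le[of v] by (intro vmin_eqI[of _ i]) simp_all
qed

lemma vmin_explicit: "vmin v = min (min (v $ 1) (v $ 2)) (min (v $ 3) (v $ 4))"
  unfolding vmin_def UNIV_4 by simp

lemma continuous_on_vmin [continuous_intros]:
  "continuous_on S f \<Longrightarrow> continuous_on S (\<lambda>x. vmin (f x))"
  unfolding vmin_explicit by (intro continuous_intros)

text \<open>Glues two copies of the orthant along their boundary, where the minimal coordinate vanishes, to the
  whole space. The second copy is reflected along the diagonal: \<open>v\<close> is the sum of a boundary point and of
  \<open>vmin v\<close> times \<open>(1, 1, 1, 1)\<close>, and the sign of the second summand is changed.\<close>

definition unfold_wall :: "bool \<Rightarrow> real^4 \<Rightarrow> real^4" where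
  "unfold_wall e v = (if e then v else (\<chi> i. v $ i - 2 * vmin v))"

lemma vmin_unfold_wall: "vmin (unfold_wall e v) = (if e then vmin v else - vmin v)"
proof -
  obtain i where "vmin v = v $ i" by (rule vmin_attained)
  then show ?thesis using vmin_le[of v] by (intro vmin_eqI[of _ i]) (auto simp: unfold_wall_def)
qed

lemma unfold_wall_eq:
  assumes "unfold_wall e v = unfold_wall e' w" "vmin v \<ge> 0" "vmin w \<ge> 0"
  shows "v = w" "e = e' \<or> vmin v = 0"
proof -
  have m: "(if e then vmin v else - vmin v) = (if e' then vmin w else - vmin w)"
    using assms(1) by (metis vmin_unfold_wall)
  then have "e = e' \<or> vmin v = 0" "vmin v = vmin w" using assms(2,3) by (auto split: if_splits)
  then show "v = w" "e = e' \<or> vmin v = 0"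
    using assms(1) m by (auto simp: unfold_wall_def vec_eq_iff split: if_splits)
qed

lemma unfold_wall_zero: "vmin v = 0 \<Longrightarrow> unfold_wall e v = v"
  by (simp add: unfold_wall_def vec_eq_iff)

lemma unfold_wall_permute: "bij \<pi> \<Longrightarrow> (\<chi> i. unfold_wall e v $ \<pi> i) = unfold_wall e (\<chi> i. v $ \<pi> i)"
  by (simp add: unfold_wall_def vec_eq_iff vmin_permute)

lemma unfold_wall_surj: obtains e w where "unfold_wall e w = v" "vmin w \<ge> 0"
proof (cases "vmin v \<ge> 0")
  case True
  then show ?thesis using that[of True v] by (simp add: unfold_wall_def)
next
  case False
  have "unfold_wall False (unfold_wall False v) = v"
    using vmin_unfold_wall[of False v] by (simp add: unfold_wall_def vec_eq_iff)
  then show ?thesis using that[of False "unfold_wall False v"] False vmin_unfold_wall[of False v] by simp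
qed

lemma unfold_wall_scaleR: "c > 0 \<Longrightarrow> unfold_wall e (c *\<^sub>R v) = c *\<^sub>R unfold_wall e v"
  by (simp add: unfold_wall_def vec_eq_iff vmin_scaleR algebra_simps)

lemma continuous_on_unfold_wall:
  "continuous_on S f \<Longrightarrow> continuous_on S (\<lambda>x. unfold_wall e (f x))"
  unfolding unfold_wall_def by (cases e) (auto intro!: continuous_intros)

context chamber
begin

definition coords :: "quaternion \<Rightarrow> real^4" where
  "coords x = (\<chi> i. x \<bullet> \<alpha> i)"

lemma coords_inj: "coords x = coords y \<Longrightarrow> x = y"
  by (rule coords_eq) (simp add: coords_def vec_eq_iff)

lemma coords_surj: "\<exists>x. coords x = v"
proof
  have "(\<Sum>j\<in>UNIV. (v $ j) * (\<alpha> i \<bullet> \<omega> j)) = (\<Sum>j\<in>UNIV. if i = j then v $ j else 0)" for i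
    by (rule sum.cong) (auto simp: dual)
  then show "coords (\<Sum>i\<in>UNIV. (v $ i) *\<^sub>R \<omega> i) = v"
    by (simp add: coords_def vec_eq_iff inner_sum_left inner_commute[of "\<omega> _"])
qed

lemma mem_C_iff: "x \<in> C \<longleftrightarrow> vmin (coords x) \<ge> 0"
proof
  assume "x \<in> C"
  moreover obtain i where "vmin (coords x) = coords x $ i" by (rule vmin_attained)
  ultimately show "vmin (coords x) \<ge> 0" by (simp add: C_def coords_def)
next
  assume "vmin (coords x) \<ge> 0"
  then have "coords x $ i \<ge> 0" for i using vmin_le[of "coords x" i] by linarith
  then show "x \<in> C" by (simp add: C_def coords_def)
qed

text \<open>The point of \<open>\<real>\<^sup>4\<close> that corresponds to the image of \<open>x\<close> in the double of the chamber. The copy is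
  chosen by the orientation of the motion into the chamber. This is a relation because of the
  symmetries of the chamber.\<close>

definition folds_to :: "quaternion \<Rightarrow> real^4 \<Rightarrow> bool" where
  "folds_to x v \<longleftrightarrow> (\<exists>e f. motion e f \<and> f x \<in> C \<and> v = unfold_wall e (coords (f x)))"

lemma folds_to_exists: "\<exists>v. folds_to x v"
  unfolding folds_to_def using chamber_meets_orbit by metis

lemma coords_symmetry:
  assumes "motion e f" "\<And>i. f (\<alpha> i) = \<alpha> (\<pi> i)"
  shows "(\<chi> i. coords (f x) $ \<pi> i) = coords x"
  using motion_props(1)[OF assms(1), of x] by (simp add: coords_def vec_eq_iff flip: assms(2))

text \<open>For an interior point of the chamber, two motions into the chamber differ by a symmetry and have the same
  orientation. For a point on a wall, the orientation does not matter, as both copies agree there.\<close>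

lemma folds_to_unique:
  assumes "folds_to x v" "folds_to x w"
  shows "\<exists>\<pi>\<in>K. v = (\<chi> i. w $ \<pi> i)"
proof -
  obtain e f where f: "motion e f" "f x \<in> C" "v = unfold_wall e (coords (f x))"
    using assms(1) unfolding folds_to_def by blast
  obtain e' g where g: "motion e' g" "g x \<in> C" "w = unfold_wall e' (coords (g x))"
    using assms(2) unfolding folds_to_def by blast
  obtain f' where f': "motion e f'" "\<And>x. f' (f x) = x" "\<And>x. f (f' x) = x" using motion_inverse[OF f(1)] by metis
  have k: "motion (e' = e) (\<lambda>x. g (f' x))" using motion_comp[OF g(1) f'(1)] .
  have kC: "g (f' (f x)) \<in> C" using g(2) by (simp only: f')
  show ?thesis
  proof (cases "vmin (coords (f x)) = 0")
    case False
    then have "vmin (coords (f x)) > 0" using f(2) mem_C_iff by simp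
    then have "\<And>i. f x \<bullet> \<alpha> i > 0" using vmin_le[of "coords (f x)"] by (simp add: coords_def) (metis order_less_le_trans)
    then obtain \<pi> where \<pi>: "e' = e" "\<pi> \<in> K" "\<And>i. g (f' (\<alpha> i)) = \<alpha> (\<pi> i)"
      using chamber_interior_unique[OF k f(2) kC] by blast
    then have "coords (f x) = (\<chi> i. coords (g x) $ \<pi> i)"
      using coords_symmetry[OF k, of \<pi> "f x"] f' by simp
    then have "v = (\<chi> i. w $ \<pi> i)"
      using \<pi> K_bij by (simp add: f g unfold_wall_permute)
    then show ?thesis using \<pi> by blast
  next
    case True
    obtain h \<pi> where h: "motion True h" "h (f x) = g (f' (f x))" "\<pi> \<in> K" "\<And>i. h (\<alpha> i) = \<alpha> (\<pi> i)"
      using chamber_unique[OF k f(2) kC] by blast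
    then have c: "coords (f x) = (\<chi> i. coords (g x) $ \<pi> i)"
      using coords_symmetry[OF h(1,4), of "f x"] f' by simp
    then have "vmin (coords (g x)) = 0" using True vmin_permute[OF K_bij[OF h(3)], of "coords (g x)"] by simp
    then have "v = (\<chi> i. w $ \<pi> i)" using c True by (simp add: f g unfold_wall_zero)
    then show ?thesis using h by blast
  qed
qed

lemma folds_to_permute:
  assumes "folds_to x v" "\<pi> \<in> K"
  shows "folds_to x (\<chi> i. v $ \<pi> i)"
proof -
  obtain e f where f: "motion e f" "f x \<in> C" "v = unfold_wall e (coords (f x))"
    using assms(1) unfolding folds_to_def by blast
  obtain a b where ab: "a \<in> R" "b \<in> R" "\<And>i. a \<star> \<alpha> i \<star> b = \<alpha> (\<pi> i)"
    using symmetry_iff[OF K_bij[OF assms(2)]] assms(2) by blast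
  define h where "h = (\<lambda>x. a \<star> (if True then x else qcnj x) \<star> b)"
  have h: "motion True h" "\<And>i. h (\<alpha> i) = \<alpha> (\<pi> i)" using ab unfolding motion_def h_def by auto
  obtain h' where h': "motion True h'" "\<And>x. h' (h x) = x" "\<And>x. h (h' x) = x" using motion_inverse[OF h(1)] by metis
  have c: "coords (h' (f x)) = (\<chi> i. coords (f x) $ \<pi> i)"
    using coords_symmetry[OF h, of "h' (f x)"] h' by simp
  have "h' (f x) \<in> C" using f(2) K_bij[OF assms(2)] unfolding mem_C_iff c by (simp add: vmin_permute)
  moreover have "motion e (\<lambda>x. h' (f x))" using motion_comp[OF h'(1) f(1)] by simp
  moreover have "(\<chi> i. v $ \<pi> i) = unfold_wall e (coords (h' (f x)))"
    unfolding c f(3) using K_bij[OF assms(2)] by (simp add: unfold_wall_permute)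
  ultimately show ?thesis unfolding folds_to_def by blast
qed

lemma folds_to_orbit:
  assumes "folds_to x v" "a \<in> R" "b \<in> R"
  shows "folds_to (a \<star> x \<star> b) v"
proof -
  obtain e f where f: "motion e f" "f x \<in> C" "v = unfold_wall e (coords (f x))"
    using assms(1) unfolding folds_to_def by blast
  define t where "t = (\<lambda>x. a \<star> (if True then x else qcnj x) \<star> b)"
  have "motion True t" unfolding motion_def t_def using assms by blast
  then obtain g where g: "motion True g" "\<And>x. g (t x) = x" using motion_inverse by metis
  have "motion e (\<lambda>x. f (g x))" using motion_comp[OF f(1) g(1)] by simp
  moreover have "g (a \<star> x \<star> b) = x" using g(2)[of x] by (simp add: t_def)
  ultimately show ?thesis
    unfolding folds_to_def using f by (intro exI[of _ e] exI[of _ "\<lambda>x. f (g x)"]) simp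
qed

text \<open>If the motions of \<open>x\<close> and \<open>y\<close> to their common image in the chamber have different orientations, then this
  image lies on a wall, and the reflection in this wall corrects the orientation.\<close>

lemma folds_to_same:
  assumes "folds_to x v" "folds_to y v"
  shows "\<exists>a\<in>R. \<exists>b\<in>R. y = a \<star> x \<star> b"
proof -
  obtain e f where f: "motion e f" "f x \<in> C" "v = unfold_wall e (coords (f x))"
    using assms(1) unfolding folds_to_def by blast
  obtain e' g where g: "motion e' g" "g y \<in> C" "v = unfold_wall e' (coords (g y))"
    using assms(2) unfolding folds_to_def by blast
  obtain g' where g': "motion e' g'" "\<And>x. g' (g x) = x" using motion_inverse[OF g(1)] by metis
  have eq: "coords (f x) = coords (g y)" and e: "e = e' \<or> vmin (coords (f x)) = 0"
    using unfold_wall_eq[of e "coords (f x)" e' "coords (g y)"] f g mem_C_iff by auto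
  have fg: "f x = g y" using eq by (rule coords_inj)
  have "\<exists>k. motion True k \<and> k x = y"
  proof (cases "e = e'")
    case True
    have "motion (e' = e) (\<lambda>x. g' (f x))" using motion_comp[OF g'(1) f(1)] .
    then show ?thesis using True fg g' by (intro exI[of _ "\<lambda>x. g' (f x)"]) simp
  next
    case False
    then have "vmin (coords (f x)) = 0" using e by blast
    then obtain i where "f x \<bullet> \<alpha> i = 0"
      using vmin_attained[of "coords (f x)"] by (metis coords_def vec_lambda_beta)
    then have "refl i (f x) = f x" by (simp add: refl_def)
    moreover have "motion (e' = (False = e)) (\<lambda>x. g' (refl i (f x)))"
      using motion_comp[OF g'(1) motion_comp[OF motion_refl f(1)]] .
    ultimately show ?thesis using False fg g' by (intro exI[of _ "\<lambda>x. g' (refl i (f x))"]) auto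
  qed
  then obtain k where k: "motion True k" "k x = y" by blast
  then show ?thesis unfolding motion_def by auto
qed

lemma folds_to_surj: "\<exists>x. folds_to x v"
proof -
  obtain e w where w: "unfold_wall e w = v" "vmin w \<ge> 0" by (rule unfold_wall_surj)
  obtain z where z: "coords z = w" using coords_surj by blast
  have m: "motion e (\<lambda>x. if e then x else qcnj x)"
    unfolding motion_def using R_props(5) by (intro bexI[of _ qone]) auto
  have "folds_to (if e then z else qcnj z) v"
    unfolding folds_to_def using w z m
    by (intro exI[of _ e] exI[of _ "\<lambda>x. if e then x else qcnj x"]) (auto simp: mem_C_iff)
  then show ?thesis by blast
qed

lemma folds_to_scaleR:
  assumes "folds_to x v" "c > 0"
  shows "folds_to (c *\<^sub>R x) (c *\<^sub>R v)"
proof -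
  obtain e f where f: "motion e f" "f x \<in> C" "v = unfold_wall e (coords (f x))"
    using assms(1) unfolding folds_to_def by blast
  have "coords (f (c *\<^sub>R x)) = c *\<^sub>R coords (f x)"
    by (simp add: coords_def motion_props[OF f(1)] vec_eq_iff)
  moreover have "f (c *\<^sub>R x) \<in> C" using f(2) assms(2) by (simp add: C_def motion_props[OF f(1)])
  ultimately show ?thesis
    unfolding folds_to_def using f assms(2) by (metis unfold_wall_scaleR)
qed

text \<open>The map \<open>h\<close> divides by the symmetries of the chamber. Continuity holds because \<open>F\<close> is given by one
  continuous formula on each of the finitely many closed sets of points that a fixed motion moves into
  the chamber.\<close>

theorem orbit_map_exists:
  fixes h :: "real^4 \<Rightarrow> quaternion"
  assumes cont: "continuous_on UNIV h" and hom: "\<And>c v. c > 0 \<Longrightarrow> h (c *\<^sub>R v) = c *\<^sub>R h v" 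
    and surj: "surj h" and fib: "\<And>v w. h v = h w \<longleftrightarrow> (\<exists>\<pi>\<in>K. v = (\<chi> i. w $ \<pi> i))"
  shows "\<exists>F. orbit_map R F"
proof -
  define F where "F x = h (SOME v. folds_to x v)" for x
  have F: "F x = h v" if "folds_to x v" for x v
  proof -
    have "folds_to x (SOME v. folds_to x v)" using that by (rule someI)
    then show ?thesis unfolding F_def fib using folds_to_unique that by blast
  qed
  have "continuous_on UNIV F"
  proof -
    let ?t = "\<lambda>(e, a, b) x. a \<star> (if e then x else qcnj x) \<star> b"
    let ?I = "(UNIV :: bool set) \<times> R \<times> R"
    let ?U = "\<lambda>i. {x. ?t i x \<in> C}"
    have mot: "motion (fst i) (?t i)" if "i \<in> ?I" for i
      using that unfolding motion_def by (auto split: prod.splits)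
    have ct: "continuous_on S (?t i)" if "i \<in> ?I" for i S using motion_props(6)[OF mot[OF that]] .
    have "continuous_on (\<Union>i\<in>?I. ?U i) F"
    proof (rule continuous_on_closed_Union)
      show "finite ?I" using finite_R by simp
      fix i assume i: "i \<in> ?I"
      have "closed C" unfolding C_def Collect_all_eq by (intro closed_INT ballI closed_Collect_le continuous_intros)
      then have "closed (?t i -` C)" using ct[OF i] by (intro closed_vimage) auto
      then show "closed (?U i)" by (simp add: vimage_def)
      have "continuous_on (?U i) (\<lambda>x. h (unfold_wall (fst i) (coords (?t i x))))"
        unfolding coords_def
        by (intro continuous_on_compose2[OF cont] continuous_on_unfold_wall continuous_on_vec_lambda 
              continuous_on_inner ct[OF i] continuous_on_const) auto
      moreover have "F x = h (unfold_wall (fst i) (coords (?t i x)))" if "x \<in> ?U i" for x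
        using mot[OF i] that by (intro F) (auto simp: folds_to_def)
      ultimately show "continuous_on (?U i) F" by (metis (no_types, lifting) continuous_on_cong)
    qed
    moreover have "(\<Union>i\<in>?I. ?U i) = UNIV"
    proof -
      have "\<exists>i\<in>?I. x \<in> ?U i" for x
      proof -
        obtain e f where "motion e f" "f x \<in> C" by (rule chamber_meets_orbit)
        then obtain a b where "a \<in> R" "b \<in> R" "a \<star> (if e then x else qcnj x) \<star> b \<in> C"
          unfolding motion_def by blast
        then show ?thesis by (intro bexI[of _ "(e, a, b)"]) simp_all
      qed
      then show ?thesis by blast
    qed
    ultimately show ?thesis by simp
  qed
  moreover have "F (c *\<^sub>R x) = c *\<^sub>R F x" if "c > 0" for c x
    using folds_to_exists[of x] folds_to_scaleR that F hom by metis
  moreover have "surj F"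
    unfolding surj_def
  proof
    fix y
    obtain v where "y = h v" using surj by (rule surjE)
    moreover obtain x where "folds_to x v" using folds_to_surj by blast
    ultimately show "\<exists>x. y = F x" using F by metis
  qed
  moreover have "F x = F y \<longleftrightarrow> (\<exists>a\<in>R. \<exists>b\<in>R. y = a \<star> x \<star> b)" for x y
  proof
    assume eq: "F x = F y"
    obtain v where v: "folds_to x v" using folds_to_exists by blast
    obtain w where w: "folds_to y w" using folds_to_exists by blast
    have "h v = h w" using eq F[OF v] F[OF w] by simp
    then obtain \<pi> where "\<pi> \<in> K" "v = (\<chi> i. w $ \<pi> i)" using fib by blast
    then have "folds_to y v" using folds_to_permute[OF w] by simp
    then show "\<exists>a\<in>R. \<exists>b\<in>R. y = a \<star> x \<star> b" using folds_to_same v by blast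
  next
    assume "\<exists>a\<in>R. \<exists>b\<in>R. y = a \<star> x \<star> b"
    then obtain a b where ab: "a \<in> R" "b \<in> R" "y = a \<star> x \<star> b" by blast
    obtain v where v: "folds_to x v" using folds_to_exists by blast
    then have "folds_to y v" using folds_to_orbit ab by simp
    then show "F x = F y" using F v by simp
  qed
  ultimately show ?thesis unfolding orbit_map_def by blast
qed

end

section \<open>Symmetries of solids\<close>

text \<open>Otherwise all points of \<open>V\<close>, being of the same norm as \<open>x\<close>, would lie in the open half space bounded
  by the tangent plane at \<open>x\<close>.\<close>

lemma on_sphere_in_hull:
  fixes V :: "(real^3) set"
  assumes V: "\<And>v. v \<in> V \<Longrightarrow> norm v = r" and x: "x \<in> convex hull V" "norm x = r"
  shows "x \<in> V"
proof (rule ccontr)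
  assume "x \<notin> V"
  have "V \<subseteq> {y. x \<bullet> y < r * r}"
  proof clarify
    fix v assume v: "v \<in> V"
    then have "x - v \<noteq> 0" using \<open>x \<notin> V\<close> by auto
    then have "0 < (x - v) \<bullet> (x - v)" by simp
    also have "\<dots> = x \<bullet> x + v \<bullet> v - 2 * (x \<bullet> v)"
      unfolding inner_diff_left inner_diff_right by (simp add: inner_commute)
    also have "\<dots> = r * r + r * r - 2 * (x \<bullet> v)"
      using V[OF v] x(2) by (simp add: dot_square_norm power2_eq_square)
    finally show "x \<bullet> v < r * r" by simp
  qed
  then have "convex hull V \<subseteq> {y. x \<bullet> y < r * r}"
    by (rule hull_minimal) (rule convex_halfspace_lt)
  then have "x \<bullet> x < r * r" using x by blast
  then show False using x(2) by (simp add: dot_square_norm power2_eq_square)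
qed

lemma norm_rot: "norm q = 1 \<Longrightarrow> norm (rot q *v x) = norm x"
  using rotation_matrix_rot[of q] orthogonal_transformation_norm[of "(*v) (rot q)"]
  by (simp add: rotation_matrix_def orthogonal_transformation_matrix)

text \<open>The vertices are the points of the solid on its circumscribed sphere, so symmetries permute them.\<close>

lemma lift_symmetries_hull:
  assumes V: "\<And>v. v \<in> V \<Longrightarrow> norm v = r" and fin: "finite V"
  shows "q \<in> lift (rotational_symmetries (convex hull V)) \<longleftrightarrow> norm q = 1 \<and> (\<forall>v\<in>V. rot q *v v \<in> V)"
proof -
  have hull: "(\<lambda>x. rot q *v x) ` (convex hull V) = convex hull ((\<lambda>x. rot q *v x) ` V)"
    by (rule convex_hull_linear_image) (rule matrix_vector_mul_linear)
  have "(\<lambda>x. rot q *v x) ` (convex hull V) = convex hull V \<longleftrightarrow> (\<forall>v\<in>V. rot q *v v \<in> V)" if q: "norm q = 1"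
  proof
    assume eq: "(\<lambda>x. rot q *v x) ` (convex hull V) = convex hull V"
    show "\<forall>v\<in>V. rot q *v v \<in> V"
    proof
      fix v assume v: "v \<in> V"
      then have "rot q *v v \<in> convex hull V" using eq hull_inc[of v V] by blast
      then show "rot q *v v \<in> V" using on_sphere_in_hull[of V r] V norm_rot[OF q] v by metis
    qed
  next
    assume sub: "\<forall>v\<in>V. rot q *v v \<in> V"
    have "inj (\<lambda>x. rot q *v x)"
    proof (rule injI)
      fix x y assume "rot q *v x = rot q *v y"
      then have "rot (qcnj q) *v (rot q *v x) = rot (qcnj q) *v (rot q *v y)" by simp
      then show "x = y" using q by (simp add: matrix_vector_mul_assoc flip: rot_qmul)
    qed
    then have "(\<lambda>x. rot q *v x) ` V = V"
      using sub fin by (intro endo_inj_surj) (auto intro: inj_on_subset)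
    then show "(\<lambda>x. rot q *v x) ` (convex hull V) = convex hull V" using hull by simp
  qed
  then show ?thesis
    by (auto simp: lift_def rotational_symmetries_def SO3_simps rotation_matrix_rot)
qed

lemma subgroup_rotational_symmetries: "subgroup (rotational_symmetries P) SO3"
proof (rule group.subgroupI[OF group_SO3])
  show "rotational_symmetries P \<subseteq> carrier SO3" by (auto simp: rotational_symmetries_def)
  have "mat 1 \<in> rotational_symmetries P"
    using rotation_matrix_rot[of qone] by (simp add: rotational_symmetries_def SO3_simps)
  then show "rotational_symmetries P \<noteq> {}" by blast
  fix A assume A: "A \<in> rotational_symmetries P"
  then have rA: "A \<in> carrier SO3" "rotation_matrix A" and im: "(\<lambda>x. A *v x) ` P = P"
    by (auto simp: rotational_symmetries_def SO3_simps)
  have "transpose A ** A = mat 1" using rA(2) by (simp add: rotation_matrix_def orthogonal_matrix_def)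
  then have "(\<lambda>x. transpose A *v x) ` (\<lambda>x. A *v x) ` P = P"
    by (simp only: image_image matrix_vector_mul_assoc matrix_vector_mul_lid image_ident)
  then show "inv\<^bsub>SO3\<^esub> A \<in> rotational_symmetries P"
    using rA im by (simp add: rotational_symmetries_def inv_SO3 SO3_simps rotation_matrix_transpose)
  fix B assume B: "B \<in> rotational_symmetries P"
  then have "(\<lambda>x. (A ** B) *v x) ` P = (\<lambda>x. A *v x) ` (\<lambda>x. B *v x) ` P"
    by (simp add: image_image matrix_vector_mul_assoc)
  then show "A \<otimes>\<^bsub>SO3\<^esub> B \<in> rotational_symmetries P"
    using A B by (simp add: rotational_symmetries_def SO3_simps rotation_matrix_mult)
qed

text \<open>The orthogonal part of the similarity may reverse the orientation. Replacing it by its negative does not change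
  the conjugate group, so it may be taken to be a rotation.\<close>

lemma lift_similar:
  assumes "similar_centred P P'"
  obtains p where "norm p = 1" "lift (rotational_symmetries P') = qconj p ` lift (rotational_symmetries P)"
proof -
  obtain c Q where c: "c > 0" "orthogonal_matrix Q" "P' = (\<lambda>x. c *\<^sub>R (Q *v x)) ` P"
    using assms by (auto simp: similar_centred_def)
  have "\<exists>e. e \<noteq> 0 \<and> rotation_matrix (e *\<^sub>R Q) \<and> (e = 1 \<or> e = - 1)"
  proof (cases "det Q = 1")
    case True
    then show ?thesis using c by (intro exI[of _ 1]) (simp add: rotation_matrix_def)
  next
    case False
    then have "det Q = -1" using det_orthogonal_matrix[OF c(2)] by blast
    moreover have "det (- 1 *\<^sub>R Q) = - det Q" by (simp add: det_3)
    moreover have "orthogonal_matrix (- 1 *\<^sub>R Q)" using c(2)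
      by (simp add: orthogonal_matrix_def transpose_def matrix_matrix_mult_def)
    ultimately show ?thesis by (intro exI[of _ "-1"]) (simp add: rotation_matrix_def)
  qed
  then obtain e where e: "rotation_matrix (e *\<^sub>R Q)" "e = 1 \<or> e = - 1" by blast
  then obtain p where p: "norm p = 1" "rot p = e *\<^sub>R Q" using rot_surj by metis
  define T where "T x = (c * e) *\<^sub>R (rot p *v x)" for x
  have "e * e = 1" using e by auto
  then have TQ: "c *\<^sub>R (Q *v x) = T x" for x by (simp add: T_def p scaleR_matrix_vector_assoc[symmetric])
  have injT: "inj T"
  proof (rule injI)
    fix x y assume "T x = T y"
    then have "rot p *v x = rot p *v y" using c(1) e(2) by (auto simp: T_def)
    then have "rot (qcnj p) *v (rot p *v x) = rot (qcnj p) *v (rot p *v y)" by simp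
    then show "x = y" using p(1) by (simp add: matrix_vector_mul_assoc flip: rot_qmul)
  qed
  have key: "q \<in> lift (rotational_symmetries P') \<longleftrightarrow> qconj (qcnj p) q \<in> lift (rotational_symmetries P)" for q
  proof -
    have n: "norm (qconj (qcnj p) q) = norm q" using p by (simp add: qconj_def)
    have "rot q *v T x = T (rot (qconj (qcnj p) q) *v x)" for x
    proof -
      have "p \<star> qconj (qcnj p) q = q \<star> p" using p by (simp add: qconj_def qmul_assoc)
      then have "rot p *v (rot (qconj (qcnj p) q) *v x) = rot q *v (rot p *v x)"
        by (simp add: matrix_vector_mul_assoc flip: rot_qmul)
      then show ?thesis by (simp add: T_def matrix_vector_mult_scaleR)
    qed
    then have "(\<lambda>x. rot q *v x) ` P' = T ` (\<lambda>x. rot (qconj (qcnj p) q) *v x) ` P" and "P' = T ` P"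
      by (simp_all add: c(3) TQ image_image)
    then have "(\<lambda>x. rot q *v x) ` P' = P' \<longleftrightarrow> (\<lambda>x. rot (qconj (qcnj p) q) *v x) ` P = P"
      by (simp add: inj_image_eq_iff[OF injT])
    then show ?thesis using n by (auto simp: lift_def rotational_symmetries_def SO3_simps rotation_matrix_rot)
  qed
  have "lift (rotational_symmetries P') = qconj p ` lift (rotational_symmetries P)"
  proof (intro equalityI subsetI)
    fix q assume "q \<in> lift (rotational_symmetries P')"
    then have "qconj (qcnj p) q \<in> lift (rotational_symmetries P)" using key by blast
    then show "q \<in> qconj p ` lift (rotational_symmetries P)" using qconj_cancel(1)[OF p(1), of q] by (metis image_eqI)
  next
    fix q assume "q \<in> qconj p ` lift (rotational_symmetries P)"
    then show "q \<in> lift (rotational_symmetries P')" using key qconj_cancel(2)[OF p(1)] by auto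
  qed
  then show ?thesis using that p by blast
qed

lemma solid_misorientation_space:
  assumes F: "\<exists>F. orbit_map (lift (rotational_symmetries P)) F" and P: "similar_centred P P'"
  shows "misorientation_space (rotational_symmetries P') (rotational_symmetries P') homeomorphic_space S3"
proof -
  obtain p where p: "norm p = 1" "lift (rotational_symmetries P') = qconj p ` lift (rotational_symmetries P)"
    using lift_similar[OF P] .
  obtain F where "orbit_map (lift (rotational_symmetries P)) F" using F by blast
  then have "orbit_map (lift (rotational_symmetries P')) (\<lambda>x. F (qconj (qcnj p) x))"
    unfolding p(2) by (rule orbit_map_qconj[OF p(1)])
  then show ?thesis by (rule misorientation_space_sphere[OF subgroup_rotational_symmetries])
qed

section \<open>Orientation of quaternion frames\<close>

text \<open>A multiple of the determinant of the four quaternions. The vector \<open>x (cnj y) z - z (cnj y) x\<close> is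
  orthogonal to the three factors and is carried along by the motions, up to the sign of the
  orientation.\<close>

definition vol :: "quaternion \<Rightarrow> quaternion \<Rightarrow> quaternion \<Rightarrow> quaternion \<Rightarrow> real" where
  "vol x y z w = (x \<star> qcnj y \<star> z - z \<star> qcnj y \<star> x) \<bullet> w"

lemma vol_even:
  assumes "norm a = 1" "norm b = 1"
  shows "vol (a \<star> x \<star> b) (a \<star> y \<star> b) (a \<star> z \<star> b) (a \<star> w \<star> b) = vol x y z w"
proof -
  have "(a \<star> x \<star> b) \<star> qcnj (a \<star> y \<star> b) \<star> (a \<star> z \<star> b) = a \<star> (x \<star> qcnj y \<star> z) \<star> b" for x y z
    using assms by (simp add: qmul_assoc qcnj_qmul)
  then have "vol (a \<star> x \<star> b) (a \<star> y \<star> b) (a \<star> z \<star> b) (a \<star> w \<star> b) =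
     (a \<star> (x \<star> qcnj y \<star> z - z \<star> qcnj y \<star> x) \<star> b) \<bullet> (a \<star> w \<star> b)"
    by (simp add: vol_def qmul_diff)
  then show ?thesis using assms by (simp add: vol_def inner_qmul_left inner_qmul_right unit_inner)
qed

lemma vol_odd:
  assumes "norm a = 1" "norm b = 1"
  shows "vol (a \<star> qcnj x \<star> b) (a \<star> qcnj y \<star> b) (a \<star> qcnj z \<star> b) (a \<star> qcnj w \<star> b) = - vol x y z w"
proof -
  have "vol (qcnj x) (qcnj y) (qcnj z) (qcnj w) = - vol x y z w"
  proof -
    have "qcnj (x \<star> qcnj y \<star> z - z \<star> qcnj y \<star> x) = - (qcnj x \<star> qcnj (qcnj y) \<star> qcnj z - qcnj z \<star> qcnj (qcnj y) \<star> qcnj x)"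
      unfolding diff_conv_add_uminus by (simp only: qcnj_simps qcnj_qmul minus_add_distrib minus_minus qmul_assoc add.commute)
    then have "- vol (qcnj x) (qcnj y) (qcnj z) (qcnj w) = qcnj (x \<star> qcnj y \<star> z - z \<star> qcnj y \<star> x) \<bullet> qcnj w"
      unfolding vol_def by (simp only: inner_minus_left)
    then show ?thesis unfolding inner_qcnj vol_def by simp
  qed
  then show ?thesis using vol_even[OF assms] by metis
qed

section \<open>The tetrahedral and octahedral binary groups\<close>

text \<open>Tabulates a function on the index type. Permutations of the simple roots are written in this way as well.\<close>

definition quad :: "'a \<Rightarrow> 'a \<Rightarrow> 'a \<Rightarrow> 'a \<Rightarrow> 4 \<Rightarrow> 'a" where
  "quad x y z w i = (if i = 1 then x else if i = 2 then y else if i = 3 then z else w)"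

lemma quad_simps [simp]: "quad x y z w 1 = x" "quad x y z w 2 = y" "quad x y z w 3 = z" "quad x y z w 4 = w"
  by (simp_all add: quad_def)

lemma motion_preserves_gram:
  assumes "norm a = 1" "norm b = 1" "\<forall>i. a \<star> \<alpha> i \<star> b = \<alpha> (\<pi> i)"
  shows "\<alpha> (\<pi> i) \<bullet> \<alpha> (\<pi> j) = \<alpha> i \<bullet> \<alpha> j"
  using assms by (simp add: inner_qmul_left inner_qmul_right unit_inner flip: assms(3))

lemma odd_motion_preserves_gram:
  assumes "norm a = 1" "norm b = 1" "\<forall>i. a \<star> qcnj (\<alpha> i) \<star> b = \<alpha> (\<pi> i)"
  shows "\<alpha> (\<pi> i) \<bullet> \<alpha> (\<pi> j) = \<alpha> i \<bullet> \<alpha> j"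
  using assms by (simp add: inner_qmul_left inner_qmul_right unit_inner flip: assms(3))

lemma rot_vector:
  "rot (quat a b c d) *v vector [x, y, z] = vector [
     (a*a + b*b - c*c - d*d) * x + 2*(b*c - a*d) * y + 2*(b*d + a*c) * z,
     2*(b*c + a*d) * x + (a*a - b*b + c*c - d*d) * y + 2*(c*d - a*b) * z,
     2*(b*d - a*c) * x + 2*(c*d + a*b) * y + (a*a - b*b - c*c + d*d) * z]"
  by (simp add: rot_quat vec_eq_iff forall_3 matrix_vector_mult_def sum_3)

lemma vector3_eq_iff: "(vector [x, y, z] :: real^3) = vector [x', y', z'] \<longleftrightarrow> x = x' \<and> y = y' \<and> z = z'"
  by (simp add: vec_eq_iff forall_3)

lemma norm_vector3: "norm (vector [x, y, z] :: real^3) = sqrt (x*x + y*y + z*z)"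
  by (simp add: norm_eq_sqrt_inner inner_vec_def sum_3)

text \<open>The diagonal entries of the rotation matrix determine the squares of the components. Of the 27 combinations
  of entries, only those listed make all squares nonnegative.\<close>

lemma squares_of_diagonal:
  fixes a b c d :: real
  assumes n: "a*a + b*b + c*c + d*d = 1"
    and D: "a*a + b*b - c*c - d*d \<in> {-1, 0, 1}" "a*a - b*b + c*c - d*d \<in> {-1, 0, 1}" "a*a - b*b - c*c + d*d \<in> {-1, 0, 1}"
  shows "(a*a, b*b, c*c, d*d) \<in> {(1/4, 1/4, 1/4, 1/4), (1, 0, 0, 0), (0, 1, 0, 0), (0, 0, 1, 0), (0, 0, 0, 1),
     (1/2, 1/2, 0, 0), (1/2, 0, 1/2, 0), (1/2, 0, 0, 1/2), (0, 1/2, 1/2, 0), (0, 1/2, 0, 1/2), (0, 0, 1/2, 1/2)}"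
proof -
  define x y z where xyz: "x = a*a + b*b - c*c - d*d" "y = a*a - b*b + c*c - d*d" "z = a*a - b*b - c*c + d*d"
  have sq: "a*a = (1 + x + y + z) / 4" "b*b = (1 + x - y - z) / 4" "c*c = (1 - x + y - z) / 4" "d*d = (1 - x - y + z) / 4"
    using n by (simp_all add: xyz)
  have "(1 + x + y + z) / 4 \<ge> 0" "(1 + x - y - z) / 4 \<ge> 0" "(1 - x + y - z) / 4 \<ge> 0" "(1 - x - y + z) / 4 \<ge> 0"
    unfolding sq[symmetric] by simp_all
  moreover have "x = -1 \<or> x = 0 \<or> x = 1" "y = -1 \<or> y = 0 \<or> y = 1" "z = -1 \<or> z = 0 \<or> z = 1"
    using D unfolding xyz by auto
  ultimately show ?thesis unfolding sq by (elim disjE) simp_all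
qed

definition oct_vertices :: "(real^3) set" where
  "oct_vertices = (\<Union>s\<in>{1, -1}. {vector [s, 0, 0], vector [0, s, 0], vector [0, 0, s]})"

definition tet_vertices :: "(real^3) set" where
  "tet_vertices = {vector [1, 1, 1], vector [1, -1, -1], vector [-1, 1, -1], vector [-1, -1, 1]}"

definition oct_lift :: "quaternion set" where
  "oct_lift = lift (rotational_symmetries std_octahedron)"

definition tet_lift :: "quaternion set" where
  "tet_lift = lift (rotational_symmetries std_tetrahedron)"

lemma oct_lift_iff: "q \<in> oct_lift \<longleftrightarrow> norm q = 1 \<and> (\<forall>v\<in>oct_vertices. rot q *v v \<in> oct_vertices)"
  unfolding oct_lift_def std_octahedron_def oct_vertices_def[symmetric]
  by (rule lift_symmetries_hull[where r = 1]) (auto simp: oct_vertices_def norm_vector3)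

lemma tet_lift_iff: "q \<in> tet_lift \<longleftrightarrow> norm q = 1 \<and> (\<forall>v\<in>tet_vertices. rot q *v v \<in> tet_vertices)"
  unfolding tet_lift_def std_tetrahedron_def tet_vertices_def[symmetric]
  by (rule lift_symmetries_hull[where r = "sqrt 3"]) (auto simp: tet_vertices_def norm_vector3)

lemma binary_group_solids: "binary_group oct_lift" "binary_group tet_lift"
  unfolding oct_lift_def tet_lift_def by (intro binary_group_lift subgroup_rotational_symmetries)+

text \<open>The vertices are the unit vectors of the coordinate axes up to sign, so the matrix of a symmetry is a
  signed permutation matrix.\<close>

lemma oct_lift_squares:
  assumes "quat a b c d \<in> oct_lift"
  shows "(a*a, b*b, c*c, d*d) \<in> {(1/4, 1/4, 1/4, 1/4), (1, 0, 0, 0), (0, 1, 0, 0), (0, 0, 1, 0), (0, 0, 0, 1),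
     (1/2, 1/2, 0, 0), (1/2, 0, 1/2, 0), (1/2, 0, 0, 1/2), (0, 1/2, 1/2, 0), (0, 1/2, 0, 1/2), (0, 0, 1/2, 1/2)}"
proof (rule squares_of_diagonal)
  show "a*a + b*b + c*c + d*d = 1" using assms by (simp add: oct_lift_iff unit_quat_iff)
  have "rot (quat a b c d) *v vector [1, 0, 0] \<in> oct_vertices" "rot (quat a b c d) *v vector [0, 1, 0] \<in> oct_vertices"
    "rot (quat a b c d) *v vector [0, 0, 1] \<in> oct_vertices"
    using assms unfolding oct_lift_iff by (auto simp: oct_vertices_def)
  then show "a*a + b*b - c*c - d*d \<in> {-1, 0, 1}" "a*a - b*b + c*c - d*d \<in> {-1, 0, 1}" "a*a - b*b - c*c + d*d \<in> {-1, 0, 1}"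
    unfolding rot_vector by (auto simp: oct_vertices_def vector3_eq_iff)
qed

lemma tet_vertex_product: "vector [x, y, z] \<in> tet_vertices \<longleftrightarrow> x \<in> {1, -1} \<and> y \<in> {1, -1} \<and> z = x * y"
  by (auto simp: tet_vertices_def vector3_eq_iff)

lemma square_half: "(x::real) * x = 1 / 4 \<longleftrightarrow> x = 1/2 \<or> x = - (1/2)"
proof -
  have "x * x = 1/4 \<longleftrightarrow> (x - 1/2) * (x + 1/2) = 0" by (simp add: algebra_simps)
  then show ?thesis by auto
qed

lemma product_of_halves: "(a::real) * a = 1 / 2 \<Longrightarrow> b * b = 1 / 2 \<Longrightarrow> a * b = 1/2 \<or> a * b = - (1/2)"
proof -
  assume *: "a * a = 1/2" "b * b = 1/2"
  have "(a * b) * (a * b) = (a * a) * (b * b)" by (simp only: mult_ac)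
  also have "\<dots> = 1/4" unfolding * by simp
  finally have "(a * b) * (a * b) = 1/4" .
  then show ?thesis by (simp only: square_half)
qed

text \<open>Half the sum of two vertices of the tetrahedron is a unit vector on an axis, so the diagonal entries are again in
  \<open>{-1, 0, 1}\<close>. The remaining elements of the octahedral group, with two equal squares
  \<open>1/2\<close>, exchange the tetrahedron with its opposite: they change the sign of the product of the coordinates.\<close>

lemma tet_lift_squares:
  assumes q: "quat a b c d \<in> tet_lift"
  shows "(a*a, b*b, c*c, d*d) \<in> {(1/4, 1/4, 1/4, 1/4), (1, 0, 0, 0), (0, 1, 0, 0), (0, 0, 1, 0), (0, 0, 0, 1)}"
proof -
  let ?q = "quat a b c d"
  have n: "a*a + b*b + c*c + d*d = 1" using q by (simp add: tet_lift_iff unit_quat_iff)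
  have v: "rot ?q *v vector [1, 1, 1] \<in> tet_vertices" "rot ?q *v vector [1, -1, -1] \<in> tet_vertices"
    "rot ?q *v vector [-1, 1, -1] \<in> tet_vertices" "rot ?q *v vector [-1, -1, 1] \<in> tet_vertices"
    using q unfolding tet_lift_iff by (auto simp: tet_vertices_def)
  note w = v[unfolded rot_vector tet_vertex_product]
  have sum: "x + y = 2 * t \<Longrightarrow> x \<in> {1, -1} \<Longrightarrow> y \<in> {1, -1} \<Longrightarrow> t \<in> {-1, 0, 1}" for x y t :: real by auto
  have zpm: "x \<in> {1, -1} \<and> y \<in> {1, -1} \<and> z = x * y \<Longrightarrow> z \<in> {1, -1}" for x y z :: real by auto
  have "a*a + b*b - c*c - d*d \<in> {-1, 0, 1}"
    by (rule sum[OF _ w(1)[THEN conjunct1] w(2)[THEN conjunct1]]) (simp add: algebra_simps)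
  moreover have "a*a - b*b + c*c - d*d \<in> {-1, 0, 1}"
    by (rule sum[OF _ w(1)[THEN conjunct2, THEN conjunct1] w(3)[THEN conjunct2, THEN conjunct1]]) (simp add: algebra_simps)
  moreover have "a*a - b*b - c*c + d*d \<in> {-1, 0, 1}"
    by (rule sum[OF _ zpm[OF w(1)] zpm[OF w(4)]]) (simp add: algebra_simps)
  ultimately have s: "(a*a, b*b, c*c, d*d) \<in> {(1/4, 1/4, 1/4, 1/4), (1, 0, 0, 0), (0, 1, 0, 0), (0, 0, 1, 0), (0, 0, 0, 1),
     (1/2, 1/2, 0, 0), (1/2, 0, 1/2, 0), (1/2, 0, 0, 1/2), (0, 1/2, 1/2, 0), (0, 1/2, 0, 1/2), (0, 0, 1/2, 1/2)}"
    by (rule squares_of_diagonal[OF n])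
  have bad: "\<not> (a*a = 1/2 \<and> b*b = 1/2 \<and> c = 0 \<and> d = 0)" "\<not> (a*a = 1/2 \<and> c*c = 1/2 \<and> b = 0 \<and> d = 0)"
     "\<not> (a*a = 1/2 \<and> d*d = 1/2 \<and> b = 0 \<and> c = 0)" "\<not> (b*b = 1/2 \<and> c*c = 1/2 \<and> a = 0 \<and> d = 0)"
     "\<not> (b*b = 1/2 \<and> d*d = 1/2 \<and> a = 0 \<and> c = 0)" "\<not> (c*c = 1/2 \<and> d*d = 1/2 \<and> a = 0 \<and> b = 0)"
    using w(1) product_of_halves[of a b] product_of_halves[of a c] product_of_halves[of a d]
        product_of_halves[of b c] product_of_halves[of b d] product_of_halves[of c d] by auto
  show ?thesis using s bad by auto
qed

lemma finite_quaternions_by_squares: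
  assumes "finite S" and X: "\<And>a b c d. quat a b c d \<in> X \<Longrightarrow> a*a \<in> S \<and> b*b \<in> S \<and> c*c \<in> S \<and> d*d \<in> S"
  shows "finite X"
proof -
  let ?T = "sqrt ` S \<union> (\<lambda>x. - sqrt x) ` S"
  have T: "x \<in> ?T" if "x * x \<in> S" for x
  proof -
    have "x = sqrt (x * x) \<or> x = - sqrt (x * x)" by (simp add: abs_if)
    then show ?thesis using that by blast
  qed
  have "X \<subseteq> (\<lambda>(a, b, c, d). quat a b c d) ` (?T \<times> ?T \<times> ?T \<times> ?T)"
  proof
    fix q assume q: "q \<in> X"
    obtain a b c d where abcd: "q = quat a b c d" by (rule quat_cases)
    have "(a, b, c, d) \<in> ?T \<times> ?T \<times> ?T \<times> ?T" using X q abcd T by simp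
    then show "q \<in> (\<lambda>(a, b, c, d). quat a b c d) ` (?T \<times> ?T \<times> ?T \<times> ?T)"
      unfolding abcd by (intro image_eqI[of _ _ "(a, b, c, d)"]) simp_all
  qed
  then show ?thesis using assms(1) by (elim finite_subset) (intro finite_imageI finite_cartesian_product finite_UnI)
qed

lemma diff_quat: "quat a b c d - quat e f g h = quat (a-e) (b-f) (c-g) (d-h)"
  by (simp add: quat_def complex_eq_iff)

lemma quad_eta: "\<pi> = quad (\<pi> 1) (\<pi> 2) (\<pi> 3) (\<pi> 4)"
proof
  fix i show "\<pi> i = quad (\<pi> 1) (\<pi> 2) (\<pi> 3) (\<pi> 4) i" using exhaust_4[of i] by auto
qed

lemma bij_quad: "bij (quad a b c d :: 4 \<Rightarrow> 4) \<longleftrightarrow> distinct [a, b, c, d]"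
proof -
  have "bij (quad a b c d) \<longleftrightarrow> inj (quad a b c d)"
    using finite_UNIV_inj_surj[of "quad a b c d"] by (auto simp: bij_def)
  also have "\<dots> \<longleftrightarrow> distinct [a, b, c, d]" by (auto simp: inj_def forall_4)
  finally show ?thesis .
qed

section \<open>The tetrahedral chamber\<close>

text \<open>The last three simple roots are pairwise orthogonal, and the first one is the centre of the diagram \<open>D\<^sub>4\<close>.\<close>

definition tet_root :: "4 \<Rightarrow> quaternion" where
  "tet_root = quad (quat (1/2) (-1/2) (-1/2) (-1/2)) (quat 0 1 0 0) (quat 0 0 1 0) (quat 0 0 0 1)"

definition tet_weight :: "4 \<Rightarrow> quaternion" where
  "tet_weight = quad (quat 2 0 0 0) (quat 1 1 0 0) (quat 1 0 1 0) (quat 1 0 0 1)"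

text \<open>The rotations of the three arms of the diagram \<open>D\<^sub>4\<close>, induced by conjugation with \<open>(1 + i + j + k) / 2\<close>.\<close>

definition tet_symmetries :: "(4 \<Rightarrow> 4) set" where
  "tet_symmetries = {quad 1 2 3 4, quad 1 3 4 2, quad 1 4 2 3}"

lemma tet_gram:
  "tet_root i \<bullet> tet_root j = (if i = j then 1 else if i = 1 \<or> j = 1 then - (1/2) else 0)"
  using exhaust_4[of i] exhaust_4[of j] by (auto simp: tet_root_def inner_quat)

text \<open>The centre of the diagram is the only root that is not orthogonal to two others.\<close>

lemma tet_gram_permutation:
  assumes "bij \<pi>" and g: "\<And>i j. tet_root (\<pi> i) \<bullet> tet_root (\<pi> j) = tet_root i \<bullet> tet_root j"
  shows "\<pi> \<in> {quad 1 2 3 4, quad 1 3 4 2, quad 1 4 2 3, quad 1 2 4 3, quad 1 3 2 4, quad 1 4 3 2}"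
proof -
  have d: "distinct [\<pi> 1, \<pi> 2, \<pi> 3, \<pi> 4]" using assms(1) quad_eta[of \<pi>] bij_quad by metis
  have 1: "\<pi> 1 = 1"
    using g[of 1 2] g[of 1 3] d unfolding tet_gram by (auto split: if_splits)
  have mem: "(\<pi> 2, \<pi> 3, \<pi> 4) \<in> {(2, 3, 4), (3, 4, 2), (4, 2, 3), (2, 4, 3), (3, 2, 4), (4, 3, 2)}"
    using d exhaust_4[of "\<pi> 2"] exhaust_4[of "\<pi> 3"] exhaust_4[of "\<pi> 4"] unfolding 1
    by (elim disjE) simp_all
  have "\<pi> = quad 1 (\<pi> 2) (\<pi> 3) (\<pi> 4)" using quad_eta[of \<pi>] unfolding 1 .
  then have "\<pi> \<in> (\<lambda>(x, y, z). quad 1 x y z) ` {(2, 3, 4), (3, 4, 2), (4, 2, 3), (2, 4, 3), (3, 2, 4), (4, 3, 2)}"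
    by (intro image_eqI[OF _ mem]) (simp only: prod.case)
  then show ?thesis by simp
qed

lemma tet_lift_members:
  "quat (1/2) (-1/2) (-1/2) (-1/2) \<in> tet_lift" "quat (1/2) (1/2) (1/2) (1/2) \<in> tet_lift"
  "quat 0 1 0 0 \<in> tet_lift" "quat 0 0 1 0 \<in> tet_lift" "quat 0 0 0 1 \<in> tet_lift"
  by (auto simp: tet_lift_iff tet_vertices_def rot_vector vector3_eq_iff unit_quat_iff)

lemma tet_unit: "a \<in> tet_lift \<Longrightarrow> norm a = 1" and oct_unit: "a \<in> oct_lift \<Longrightarrow> norm a = 1"
  by (simp_all add: tet_lift_iff oct_lift_iff)

text \<open>Motions \<open>x \<mapsto> a x b\<close> preserve the orientation, so they induce only even permutations of the arms. An
  orientation reversing motion would exchange two arms and fix \<open>1\<close>, a combination of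
  the simple roots. Then \<open>b\<close> is the conjugate of \<open>a\<close>, and \<open>a\<close> is a multiple of a difference such as \<open>j - k\<close>,
  which is not in the group.\<close>

lemma tet_chamber: "chamber tet_lift tet_root tet_weight tet_symmetries"
proof
  show "finite tet_lift"
  proof (rule finite_quaternions_by_squares)
    show "finite {0, 1/4, 1 :: real}" by simp
    show "a*a \<in> {0, 1/4, 1} \<and> b*b \<in> {0, 1/4, 1} \<and> c*c \<in> {0, 1/4, 1} \<and> d*d \<in> {0, 1/4, 1}" 
      if "quat a b c d \<in> tet_lift" for a b c d
      using tet_lift_squares[OF that] by auto
  qed
  show "binary_group tet_lift" by (rule binary_group_solids)
  show "tet_root i \<in> tet_lift" for i
    using exhaust_4[of i] tet_lift_members by (auto simp: tet_root_def)
  show "tet_root i \<bullet> tet_weight j = (if i = j then 1 else 0)" for i j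
    using exhaust_4[of i] exhaust_4[of j] by (auto simp: tet_root_def tet_weight_def inner_quat)
  show "x = (\<Sum>i\<in>UNIV. (x \<bullet> tet_weight i) *\<^sub>R tet_root i)" for x
    by (cases x rule: quat_cases) (simp add: sum_4 tet_root_def tet_weight_def quat_arith)
  show "(\<forall>i. r \<bullet> tet_weight i \<ge> 0) \<or> (\<forall>i. r \<bullet> tet_weight i \<le> 0)" if r: "r \<in> tet_lift" for r
  proof -
    obtain a b c d where abcd: "r = quat a b c d" by (rule quat_cases)
    then have "(a*a, b*b, c*c, d*d) \<in> {(1/4, 1/4, 1/4, 1/4), (1, 0, 0, 0), (0, 1, 0, 0), (0, 0, 1, 0), (0, 0, 0, 1)}"
      using r tet_lift_squares by blast
    then have "(a = 1/2 \<or> a = - (1/2)) \<and> (b = 1/2 \<or> b = - (1/2)) \<and> (c = 1/2 \<or> c = - (1/2)) \<and> (d = 1/2 \<or> d = - (1/2)) \<or>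
      (a = 1 \<or> a = - 1) \<and> b = 0 \<and> c = 0 \<and> d = 0 \<or> (b = 1 \<or> b = - 1) \<and> a = 0 \<and> c = 0 \<and> d = 0 \<or>
      (c = 1 \<or> c = - 1) \<and> a = 0 \<and> b = 0 \<and> d = 0 \<or> (d = 1 \<or> d = - 1) \<and> a = 0 \<and> b = 0 \<and> c = 0"
      by (simp only: insert_iff prod.inject empty_iff square_half square_eq_1_iff mult_eq_0_iff) blast
    then show ?thesis
      unfolding forall_4 abcd tet_weight_def quad_simps inner_quat by (elim disjE conjE) simp_all
  qed
  show bijK: "bij \<pi>" if "\<pi> \<in> tet_symmetries" for \<pi>
    using that unfolding tet_symmetries_def by (auto simp: bij_quad)
  show "(\<exists>a\<in>tet_lift. \<exists>b\<in>tet_lift. \<forall>i. a \<star> tet_root i \<star> b = tet_root (\<pi> i)) \<longleftrightarrow> \<pi> \<in> tet_symmetries" 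
    if b: "bij \<pi>" for \<pi>
  proof
    assume "\<exists>a\<in>tet_lift. \<exists>b\<in>tet_lift. \<forall>i. a \<star> tet_root i \<star> b = tet_root (\<pi> i)"
    then obtain a b where ab: "norm a = 1" "norm b = 1" and eq: "\<forall>i. a \<star> tet_root i \<star> b = tet_root (\<pi> i)"
      using tet_unit by blast
    have "\<pi> \<in> {quad 1 2 3 4, quad 1 3 4 2, quad 1 4 2 3, quad 1 2 4 3, quad 1 3 2 4, quad 1 4 3 2}"
      using tet_gram_permutation[OF b motion_preserves_gram[OF ab eq]] .
    moreover have "vol (tet_root (\<pi> 1)) (tet_root (\<pi> 2)) (tet_root (\<pi> 3)) (tet_root (\<pi> 4)) =
      vol (tet_root 1) (tet_root 2) (tet_root 3) (tet_root 4)"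
      using vol_even[OF ab] eq by metis
    ultimately show "\<pi> \<in> tet_symmetries"
      unfolding tet_symmetries_def by (auto simp: vol_def tet_root_def quat_arith diff_quat)
  next
    let ?w = "quat (1/2) (1/2) (1/2) (1/2)"
    have w: "?w \<in> tet_lift" "qcnj ?w \<in> tet_lift" "qone \<in> tet_lift"
      using tet_lift_members binary_group_solids(2) by (auto simp: binary_group_def)
    have 1: "\<forall>i. qone \<star> tet_root i \<star> qone = tet_root (quad 1 2 3 4 i)"
      "\<forall>i. ?w \<star> tet_root i \<star> qcnj ?w = tet_root (quad 1 3 4 2 i)"
      "\<forall>i. qcnj ?w \<star> tet_root i \<star> ?w = tet_root (quad 1 4 2 3 i)"
      by (simp_all add: forall_4 tet_root_def quat_arith)
    assume "\<pi> \<in> tet_symmetries"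
    then consider "\<pi> = quad 1 2 3 4" | "\<pi> = quad 1 3 4 2" | "\<pi> = quad 1 4 2 3" unfolding tet_symmetries_def by blast
    then show "\<exists>a\<in>tet_lift. \<exists>b\<in>tet_lift. \<forall>i. a \<star> tet_root i \<star> b = tet_root (\<pi> i)"
      using w 1 by cases blast+
  qed
  show "\<exists>i. a \<star> qcnj (tet_root i) \<star> b \<noteq> tet_root (\<pi> i)" if \<pi>: "bij \<pi>" and ab: "a \<in> tet_lift" "b \<in> tet_lift" for \<pi> a b
  proof (rule ccontr)
    assume "\<not> ?thesis"
    then have eq: "\<forall>i. a \<star> qcnj (tet_root i) \<star> b = tet_root (\<pi> i)" by blast
    have n: "norm a = 1" "norm b = 1" using ab tet_unit by auto
    have "\<pi> \<in> {quad 1 2 3 4, quad 1 3 4 2, quad 1 4 2 3, quad 1 2 4 3, quad 1 3 2 4, quad 1 4 3 2}"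
      using tet_gram_permutation[OF \<pi> odd_motion_preserves_gram[OF n eq]] .
    moreover have "vol (tet_root (\<pi> 1)) (tet_root (\<pi> 2)) (tet_root (\<pi> 3)) (tet_root (\<pi> 4)) =
      - vol (tet_root 1) (tet_root 2) (tet_root 3) (tet_root 4)"
      using vol_odd[OF n] eq by metis
    ultimately have t: "\<pi> \<in> {quad 1 2 4 3, quad 1 3 2 4, quad 1 4 3 2}"
      by (auto simp: vol_def tet_root_def quat_arith diff_quat)
    \<comment> \<open>A transposition of the arms also fixes \<open>1\<close>, which gives \<open>a \<star> b = qone\<close>.\<close>
    have one: "qone = 2 *\<^sub>R tet_root 1 + tet_root 2 + tet_root 3 + tet_root 4"
      by (simp add: tet_root_def quat_arith)
    have "a \<star> b = a \<star> qcnj qone \<star> b" by simp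
    also have "\<dots> = 2 *\<^sub>R tet_root (\<pi> 1) + tet_root (\<pi> 2) + tet_root (\<pi> 3) + tet_root (\<pi> 4)"
      unfolding one by (simp add: qmul_add eq del: qcnj_simps(2))
    also have "\<dots> = qone" using t by (auto simp: tet_root_def quat_arith)
    finally have "qcnj a \<star> (a \<star> b) = qcnj a" by simp
    then have b: "b = qcnj a" using n by simp
    obtain p q r u where a: "a = quat p q r u" by (rule quat_cases)
    have "a \<star> qcnj (tet_root i) = tet_root (\<pi> i) \<star> a" for i
    proof -
      have "a \<star> qcnj (tet_root i) \<star> qcnj a \<star> a = tet_root (\<pi> i) \<star> a" using eq b by metis
      then show ?thesis using n by simp
    qed
    then have e: "a \<star> qcnj (tet_root 2) = tet_root (\<pi> 2) \<star> a" "a \<star> qcnj (tet_root 3) = tet_root (\<pi> 3) \<star> a"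
      "a \<star> qcnj (tet_root 4) = tet_root (\<pi> 4) \<star> a" by blast+
    have sq: "(p * p, q * q, r * r, u * u) \<in> {(1/4, 1/4, 1/4, 1/4), (1, 0, 0, 0), (0, 1, 0, 0), (0, 0, 1, 0), (0, 0, 0, 1)}"
      using ab(1) unfolding a by (rule tet_lift_squares)
    from t consider "\<pi> = quad 1 2 4 3" | "\<pi> = quad 1 3 2 4" | "\<pi> = quad 1 4 3 2" by blast
    then show False
    proof cases
      case 1
      have "p = 0 \<and> q = 0 \<and> r = - u"
        using e unfolding 1 a tet_root_def quad_simps quat_arith by (elim conjE, intro conjI; linarith)
      then show False using sq by auto
    next
      case 2
      have "p = 0 \<and> u = 0 \<and> q = - r"
        using e unfolding 2 a tet_root_def quad_simps quat_arith by (elim conjE, intro conjI; linarith)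
      then show False using sq by auto
    next
      case 3
      have "p = 0 \<and> r = 0 \<and> q = - u"
        using e unfolding 3 a tet_root_def quad_simps quat_arith by (elim conjE, intro conjI; linarith)
      then show False using sq by auto
    qed
  qed
qed

lemma permute_vec4_iff: "v = (\<chi> i. w $ quad a b c d i) \<longleftrightarrow> v $ 1 = w $ a \<and> v $ 2 = w $ b \<and> v $ 3 = w $ c \<and> v $ 4 = w $ d"
  by (simp add: vec_eq_iff forall_4)

lemma vec4_exists: "\<exists>v :: real^4. v $ 1 = a \<and> v $ 2 = b \<and> v $ 3 = c \<and> v $ 4 = d"
  by (rule exI[of _ "vector [a, b, c, d]"]) (simp add: vector_4)

lemma cube_roots_of_unity:
  fixes z w :: complex
  defines "e \<equiv> Complex (- 1 / 2) (sqrt 3 / 2)"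
  shows "pw 3 z = pw 3 w \<longleftrightarrow> z = w \<or> z = e * w \<or> z = cnj e * w"
proof -
  have cubes: "u ^ 3 = 1 \<longleftrightarrow> u = 1 \<or> u = e \<or> u = cnj e" for u
  proof -
    have "u ^ 3 - 1 = (u - 1) * ((u - e) * (u - cnj e))"
    proof -
      have "e + cnj e = - 1" "e * cnj e = 1" by (simp_all add: e_def complex_eq_iff)
      moreover have "(u - e) * (u - cnj e) = u * u - (e + cnj e) * u + e * cnj e"
        by (simp add: algebra_simps)
      ultimately have "(u - e) * (u - cnj e) = u * u + u + 1" by simp
      then show ?thesis by (simp add: algebra_simps power3_eq_cube)
    qed
    then show ?thesis by (metis eq_iff_diff_eq_0 mult_eq_0_iff)
  qed
  have "pw 3 z = pw 3 w \<longleftrightarrow> (\<exists>u. u ^ 3 = 1 \<and> z = u * w)" by (rule pw_eq_iff) simp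
  also have "\<dots> \<longleftrightarrow> z = 1 * w \<or> z = e * w \<or> z = cnj e * w"
    unfolding cubes by blast
  finally show ?thesis by simp
qed

text \<open>Cyclic permutations of the last three coordinates fix their sum and rotate the complementary plane by a third
  of a turn.\<close>

definition tet_fold :: "real^4 \<Rightarrow> quaternion" where
  "tet_fold v = (Complex (v $ 1) (v $ 2 + v $ 3 + v $ 4),
     pw 3 (Complex (2 * v $ 2 - v $ 3 - v $ 4) (sqrt 3 * (v $ 3 - v $ 4))))"

lemma tet_fold_eq_iff: "tet_fold v = tet_fold w \<longleftrightarrow> (\<exists>\<pi>\<in>tet_symmetries. v = (\<chi> i. w $ \<pi> i))"
proof -
  let ?e = "Complex (- 1 / 2) (sqrt 3 / 2)"
  let ?z = "\<lambda>v::real^4. Complex (2 * v $ 2 - v $ 3 - v $ 4) (sqrt 3 * (v $ 3 - v $ 4))"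
  have s3: "sqrt 3 * (sqrt 3 * x) = 3 * x" for x by (simp flip: mult.assoc)
  have ez: "?e * ?z w = Complex (2 * w $ 4 - w $ 2 - w $ 3) (sqrt 3 * (w $ 2 - w $ 3))"
     "cnj ?e * ?z w = Complex (2 * w $ 3 - w $ 4 - w $ 2) (sqrt 3 * (w $ 4 - w $ 2))"
    by (simp_all add: complex_eq_iff algebra_simps s3)
  have k: "a + b + c = a' + b' + c' \<and> Complex (2 * a - b - c) (sqrt 3 * (b - c)) = Complex (2 * a' - b' - c') (sqrt 3 * (b' - c'))
     \<longleftrightarrow> a = a' \<and> b = b' \<and> c = c'" for a b c a' b' c' :: real
    by auto
  have "tet_fold v = tet_fold w \<longleftrightarrow> v $ 1 = w $ 1 \<and> v $ 2 + v $ 3 + v $ 4 = w $ 2 + w $ 3 + w $ 4 \<and> pw 3 (?z v) = pw 3 (?z w)"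
    by (auto simp: tet_fold_def)
  also have "\<dots> \<longleftrightarrow> v $ 1 = w $ 1 \<and> 
    ((v $ 2 + v $ 3 + v $ 4 = w $ 2 + w $ 3 + w $ 4 \<and> ?z v = ?z w) \<or>
     (v $ 2 + v $ 3 + v $ 4 = w $ 4 + w $ 2 + w $ 3 \<and> ?z v = ?e * ?z w) \<or>
     (v $ 2 + v $ 3 + v $ 4 = w $ 3 + w $ 4 + w $ 2 \<and> ?z v = cnj ?e * ?z w))"
    unfolding cube_roots_of_unity by argo
  also have "\<dots> \<longleftrightarrow> (\<exists>\<pi>\<in>tet_symmetries. v = (\<chi> i. w $ \<pi> i))"
    unfolding ez k by (auto simp: tet_symmetries_def permute_vec4_iff)
  finally show ?thesis .
qed

lemma tet_fold_regular:
  "continuous_on UNIV tet_fold" "c > 0 \<Longrightarrow> tet_fold (c *\<^sub>R v) = c *\<^sub>R tet_fold v" "surj tet_fold"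
proof -
  show "continuous_on UNIV tet_fold"
    unfolding tet_fold_def Complex_of_real_eq by (intro continuous_intros)
  show "tet_fold (c *\<^sub>R v) = c *\<^sub>R tet_fold v" if "c > 0"
  proof -
    have "Complex (c * v $ 1) (c * v $ 2 + c * v $ 3 + c * v $ 4) = c *\<^sub>R Complex (v $ 1) (v $ 2 + v $ 3 + v $ 4)"
      "Complex (2 * (c * v $ 2) - c * v $ 3 - c * v $ 4) (sqrt 3 * (c * v $ 3 - c * v $ 4)) =
        c *\<^sub>R Complex (2 * v $ 2 - v $ 3 - v $ 4) (sqrt 3 * (v $ 3 - v $ 4))"
      by (simp_all add: complex_eq_iff algebra_simps)
    then show ?thesis
      by (simp only: tet_fold_def vector_scaleR_component real_scaleR_def pw_scaleR[OF that] scaleR_Pair)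
  qed
  show "surj tet_fold"
    unfolding surj_def
  proof
    fix y :: quaternion
    obtain z where z: "pw 3 z = snd y" using pw_surj[of 3] by auto
    define t where "t = Im (fst y)"
    obtain v :: "real^4" where v: "v $ 1 = Re (fst y)" "v $ 2 = (t + Re z) / 3" 
      "v $ 3 = (2 * t - Re z + sqrt 3 * Im z) / 6" "v $ 4 = (2 * t - Re z - sqrt 3 * Im z) / 6"
      using vec4_exists by metis
    have "2 * v $ 2 - v $ 3 - v $ 4 = Re z" "v $ 2 + v $ 3 + v $ 4 = t" "sqrt 3 * (v $ 3 - v $ 4) = Im z"
      unfolding v by (simp_all add: field_simps)
    then have "tet_fold v = (Complex (Re (fst y)) t, pw 3 (Complex (Re z) (Im z)))"
      by (simp only: tet_fold_def v(1))
    then have "tet_fold v = y" by (simp add: z t_def)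
    then show "\<exists>v. y = tet_fold v" by blast
  qed
qed

theorem tetrahedral_orbit_map: "\<exists>F. orbit_map tet_lift F"
  by (rule chamber.orbit_map_exists[OF tet_chamber, of tet_fold])
     (use tet_fold_regular tet_fold_eq_iff in blast)+

section \<open>The octahedral chamber\<close>

text \<open>The scaling factor of the long roots of \<open>F\<^sub>4\<close>, which become unit vectors here.\<close>

definition rh :: real where "rh = sqrt (1 / 2)"

lemma rh: "rh * rh = 1 / 2" "rh > 0" "rh > 1 / 2" "rh < 1"
proof -
  show "rh * rh = 1 / 2" "rh > 0" by (simp_all add: rh_def)
  show "rh > 1 / 2" unfolding rh_def by (rule real_less_rsqrt) (simp add: power2_eq_square)
  show "rh < 1" unfolding rh_def by (rule real_less_lsqrt) simp_all
qed

lemma rh_assoc: "rh * (rh * x) = x / 2"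
  using rh(1) by (simp flip: mult.assoc)

lemma square_rh: "x * x = 1 / 2 \<longleftrightarrow> x = rh \<or> x = - rh"
  unfolding rh(1)[symmetric] by (rule square_eq_iff)

definition oct_root :: "4 \<Rightarrow> quaternion" where
  "oct_root = quad (quat 0 rh (- rh) 0) (quat 0 0 rh (- rh)) (quat 0 0 0 1) (quat (1/2) (-1/2) (-1/2) (-1/2))"

definition oct_weight :: "4 \<Rightarrow> quaternion" where
  "oct_weight = quad (quat (2 * rh) (2 * rh) 0 0) (quat (4 * rh) (2 * rh) (2 * rh) 0) (quat 3 1 1 1) (quat 2 0 0 0)"

text \<open>All roots having length 1, the diagram \<open>F\<^sub>4\<close> can be reversed. This is induced by the motion with
  \<open>a = rh (j + k)\<close> and \<open>b = - j\<close>.\<close>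

definition oct_symmetries :: "(4 \<Rightarrow> 4) set" where
  "oct_symmetries = {quad 1 2 3 4, quad 4 3 2 1}"

lemma oct_gram:
  "oct_root i \<bullet> oct_root j = (if i = j then 1 else if {i, j} = {1, 2} \<or> {i, j} = {3, 4} then - (1/2)
     else if {i, j} = {2, 3} then - rh else 0)"
  using exhaust_4[of i] exhaust_4[of j]
  by (elim disjE) (simp_all add: oct_root_def inner_quat rh rh_assoc doubleton_eq_iff)

lemma oct_gram_permutation:
  assumes "bij \<pi>" and g: "\<And>i j. oct_root (\<pi> i) \<bullet> oct_root (\<pi> j) = oct_root i \<bullet> oct_root j"
  shows "\<pi> \<in> oct_symmetries"
proof -
  have d: "distinct [\<pi> 1, \<pi> 2, \<pi> 3, \<pi> 4]" using assms(1) quad_eta[of \<pi>] bij_quad by metis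
  have "\<pi> 2 \<noteq> \<pi> 3" using d by simp
  then have "{\<pi> 2, \<pi> 3} = {2, 3}"
    using g[of 2 3] rh unfolding oct_gram by (simp add: doubleton_eq_iff split: if_splits)
  then have m: "\<pi> 2 = 2 \<and> \<pi> 3 = 3 \<or> \<pi> 2 = 3 \<and> \<pi> 3 = 2" by (simp add: doubleton_eq_iff)
  have "oct_root (\<pi> 1) \<bullet> oct_root (\<pi> 2) = - (1/2)" "oct_root (\<pi> 3) \<bullet> oct_root (\<pi> 4) = - (1/2)"
    using g[of 1 2] g[of 3 4] by (simp_all add: oct_gram doubleton_eq_iff)
  then have "{\<pi> 1, \<pi> 2} = {1, 2} \<or> {\<pi> 1, \<pi> 2} = {3, 4}" "{\<pi> 3, \<pi> 4} = {1, 2} \<or> {\<pi> 3, \<pi> 4} = {3, 4}"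
    using rh unfolding oct_gram by (auto simp only: split: if_splits)
  then have mem: "(\<pi> 1, \<pi> 2, \<pi> 3, \<pi> 4) \<in> {(1, 2, 3, 4), (4, 3, 2, 1)}"
    using m by (auto simp: doubleton_eq_iff)
  have "\<pi> \<in> (\<lambda>(w, x, y, z). quad w x y z) ` {(1, 2, 3, 4), (4, 3, 2, 1)}"
    by (intro image_eqI[OF _ mem]) (simp only: prod.case, rule quad_eta)
  then show ?thesis by (simp add: oct_symmetries_def)
qed

lemma oct_lift_members:
  "quat 0 rh (- rh) 0 \<in> oct_lift" "quat 0 0 rh (- rh) \<in> oct_lift" "quat 0 0 0 1 \<in> oct_lift"
  "quat (1/2) (-1/2) (-1/2) (-1/2) \<in> oct_lift" "quat 0 0 rh rh \<in> oct_lift" "quat 0 0 (-1) 0 \<in> oct_lift"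
  by (auto simp: oct_lift_iff oct_vertices_def rot_vector vector3_eq_iff unit_quat_iff rh)

lemma oct_positivity:
  assumes q: "quat a b c d \<in> oct_lift"
  shows "(a + b \<ge> 0 \<and> 2 * a + b + c \<ge> 0 \<and> 3 * a + b + c + d \<ge> 0 \<and> a \<ge> 0) \<or>
     (a + b \<le> 0 \<and> 2 * a + b + c \<le> 0 \<and> 3 * a + b + c + d \<le> 0 \<and> a \<le> 0)"
proof -
  have "(a = 1/2 \<or> a = - (1/2)) \<and> (b = 1/2 \<or> b = - (1/2)) \<and> (c = 1/2 \<or> c = - (1/2)) \<and> (d = 1/2 \<or> d = - (1/2)) \<or>
      (a = 1 \<or> a = - 1) \<and> b = 0 \<and> c = 0 \<and> d = 0 \<or> a = 0 \<and> (b = 1 \<or> b = - 1) \<and> c = 0 \<and> d = 0 \<or>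
      a = 0 \<and> b = 0 \<and> (c = 1 \<or> c = - 1) \<and> d = 0 \<or> a = 0 \<and> b = 0 \<and> c = 0 \<and> (d = 1 \<or> d = - 1) \<or>
      (a = rh \<or> a = - rh) \<and> (b = rh \<or> b = - rh) \<and> c = 0 \<and> d = 0 \<or> 
      (a = rh \<or> a = - rh) \<and> b = 0 \<and> (c = rh \<or> c = - rh) \<and> d = 0 \<or>
      (a = rh \<or> a = - rh) \<and> b = 0 \<and> c = 0 \<and> (d = rh \<or> d = - rh) \<or>
      a = 0 \<and> (b = rh \<or> b = - rh) \<and> (c = rh \<or> c = - rh) \<and> d = 0 \<or> 
      a = 0 \<and> (b = rh \<or> b = - rh) \<and> c = 0 \<and> (d = rh \<or> d = - rh) \<or>
      a = 0 \<and> b = 0 \<and> (c = rh \<or> c = - rh) \<and> (d = rh \<or> d = - rh)"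
    using oct_lift_squares[OF q]
    by (simp only: insert_iff prod.inject empty_iff square_half square_rh square_eq_1_iff mult_eq_0_iff disj_absorb simp_thms)
  then show ?thesis using rh(2) by (elim disjE conjE) simp_all
qed

text \<open>Both permutations of the simple roots are even, so an orientation reversing motion that permutes the simple roots
  would annihilate their volume.\<close>

lemma oct_chamber: "chamber oct_lift oct_root oct_weight oct_symmetries"
proof
  show "finite oct_lift"
  proof (rule finite_quaternions_by_squares)
    show "finite {0, 1/4, 1/2, 1 :: real}" by simp
    show "a*a \<in> {0, 1/4, 1/2, 1} \<and> b*b \<in> {0, 1/4, 1/2, 1} \<and> c*c \<in> {0, 1/4, 1/2, 1} \<and> d*d \<in> {0, 1/4, 1/2, 1}" 
      if "quat a b c d \<in> oct_lift" for a b c d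
      using oct_lift_squares[OF that] by auto
  qed
  show "binary_group oct_lift" by (rule binary_group_solids)
  show "oct_root i \<in> oct_lift" for i
    using exhaust_4[of i] oct_lift_members by (auto simp: oct_root_def)
  show "oct_root i \<bullet> oct_weight j = (if i = j then 1 else 0)" for i j
    using exhaust_4[of i] exhaust_4[of j]
    by (elim disjE) (simp_all add: oct_root_def oct_weight_def inner_quat rh rh_assoc mult.left_commute[of rh 2])
  show "x = (\<Sum>i\<in>UNIV. (x \<bullet> oct_weight i) *\<^sub>R oct_root i)" for x
    by (cases x rule: quat_cases)
       (simp add: sum_4 oct_root_def oct_weight_def quat_arith algebra_simps rh rh_assoc)
  show "(\<forall>i. r \<bullet> oct_weight i \<ge> 0) \<or> (\<forall>i. r \<bullet> oct_weight i \<le> 0)" if r: "r \<in> oct_lift" for r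
  proof -
    obtain a b c d where abcd: "r = quat a b c d" by (rule quat_cases)
    have w: "r \<bullet> oct_weight 1 = 2 * rh * (a + b)" "r \<bullet> oct_weight 2 = 2 * rh * (2 * a + b + c)"
      "r \<bullet> oct_weight 3 = 3 * a + b + c + d" "r \<bullet> oct_weight 4 = 2 * a"
      by (simp_all add: abcd oct_weight_def inner_quat algebra_simps)
    have "a + b \<ge> 0 \<and> 2 * a + b + c \<ge> 0 \<and> 3 * a + b + c + d \<ge> 0 \<and> a \<ge> 0 \<or>
     a + b \<le> 0 \<and> 2 * a + b + c \<le> 0 \<and> 3 * a + b + c + d \<le> 0 \<and> a \<le> 0"
      using oct_positivity r unfolding abcd by blast
    then show ?thesis
      unfolding forall_4 w using rh(2) by (auto intro: mult_nonneg_nonneg mult_nonneg_nonpos)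
  qed
  show "bij \<pi>" if "\<pi> \<in> oct_symmetries" for \<pi>
    using that unfolding oct_symmetries_def by (auto simp: bij_quad)
  show "(\<exists>a\<in>oct_lift. \<exists>b\<in>oct_lift. \<forall>i. a \<star> oct_root i \<star> b = oct_root (\<pi> i)) \<longleftrightarrow> \<pi> \<in> oct_symmetries" 
    if b: "bij \<pi>" for \<pi>
  proof
    assume "\<exists>a\<in>oct_lift. \<exists>b\<in>oct_lift. \<forall>i. a \<star> oct_root i \<star> b = oct_root (\<pi> i)"
    then obtain a b where ab: "norm a = 1" "norm b = 1" and eq: "\<forall>i. a \<star> oct_root i \<star> b = oct_root (\<pi> i)"
      using oct_unit by blast
    show "\<pi> \<in> oct_symmetries"
      using oct_gram_permutation[OF b motion_preserves_gram[OF ab eq]] .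
  next
    let ?a = "quat 0 0 rh rh" and ?b = "quat 0 0 (- 1) 0"
    have w: "?a \<in> oct_lift" "?b \<in> oct_lift" "qone \<in> oct_lift"
      using oct_lift_members binary_group_solids(1) by (auto simp: binary_group_def)
    have 1: "\<forall>i. qone \<star> oct_root i \<star> qone = oct_root (quad 1 2 3 4 i)"
      "\<forall>i. ?a \<star> oct_root i \<star> ?b = oct_root (quad 4 3 2 1 i)"
      by (simp_all add: forall_4 oct_root_def quat_arith rh rh_assoc)
    assume "\<pi> \<in> oct_symmetries"
    then consider "\<pi> = quad 1 2 3 4" | "\<pi> = quad 4 3 2 1" unfolding oct_symmetries_def by blast
    then show "\<exists>a\<in>oct_lift. \<exists>b\<in>oct_lift. \<forall>i. a \<star> oct_root i \<star> b = oct_root (\<pi> i)"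
      using w 1 by cases blast+
  qed
  show "\<exists>i. a \<star> qcnj (oct_root i) \<star> b \<noteq> oct_root (\<pi> i)" if \<pi>: "bij \<pi>" and ab: "a \<in> oct_lift" "b \<in> oct_lift" for \<pi> a b
  proof (rule ccontr)
    assume "\<not> ?thesis"
    then have eq: "\<forall>i. a \<star> qcnj (oct_root i) \<star> b = oct_root (\<pi> i)" by blast
    have n: "norm a = 1" "norm b = 1" using ab oct_unit by auto
    have "\<pi> \<in> oct_symmetries"
      using oct_gram_permutation[OF \<pi> odd_motion_preserves_gram[OF n eq]] .
    then have "\<pi> = quad 1 2 3 4 \<or> \<pi> = quad 4 3 2 1" by (simp add: oct_symmetries_def)
    moreover have "vol (oct_root (\<pi> 1)) (oct_root (\<pi> 2)) (oct_root (\<pi> 3)) (oct_root (\<pi> 4)) =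
      - vol (oct_root 1) (oct_root 2) (oct_root 3) (oct_root 4)"
      using vol_odd[OF n] eq by metis
    moreover have "vol (oct_root 1) (oct_root 2) (oct_root 3) (oct_root 4) = vol (oct_root 4) (oct_root 3) (oct_root 2) (oct_root 1)"
      "vol (oct_root 1) (oct_root 2) (oct_root 3) (oct_root 4) \<noteq> 0"
      by (simp_all add: vol_def oct_root_def quat_arith diff_quat rh rh_assoc algebra_simps)
    ultimately show False by (elim disjE) simp_all
  qed
qed

text \<open>Reversing the order of the coordinates fixes the sums and changes the signs of the differences.\<close>

definition oct_fold :: "real^4 \<Rightarrow> quaternion" where
  "oct_fold v = (Complex (v $ 1 + v $ 4) (v $ 2 + v $ 3), pw 2 (Complex (v $ 1 - v $ 4) (v $ 2 - v $ 3)))"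

lemma oct_fold_eq_iff: "oct_fold v = oct_fold w \<longleftrightarrow> (\<exists>\<pi>\<in>oct_symmetries. v = (\<chi> i. w $ \<pi> i))"
  unfolding oct_fold_def prod.inject pw2_eq_iff by (auto simp: oct_symmetries_def permute_vec4_iff complex_eq_iff)

lemma oct_fold_regular:
  "continuous_on UNIV oct_fold" "c > 0 \<Longrightarrow> oct_fold (c *\<^sub>R v) = c *\<^sub>R oct_fold v" "surj oct_fold"
proof -
  show "continuous_on UNIV oct_fold"
    unfolding oct_fold_def Complex_of_real_eq by (intro continuous_intros)
  show "oct_fold (c *\<^sub>R v) = c *\<^sub>R oct_fold v" if "c > 0"
  proof -
    have "Complex (c * v $ 1 + c * v $ 4) (c * v $ 2 + c * v $ 3) = c *\<^sub>R Complex (v $ 1 + v $ 4) (v $ 2 + v $ 3)"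
      "Complex (c * v $ 1 - c * v $ 4) (c * v $ 2 - c * v $ 3) = c *\<^sub>R Complex (v $ 1 - v $ 4) (v $ 2 - v $ 3)"
      by (simp_all add: complex_eq_iff algebra_simps)
    then show ?thesis
      by (simp only: oct_fold_def vector_scaleR_component real_scaleR_def pw_scaleR[OF that] scaleR_Pair)
  qed
  show "surj oct_fold"
    unfolding surj_def
  proof
    fix y :: quaternion
    obtain z where z: "pw 2 z = snd y" using pw_surj[of 2] by auto
    obtain v :: "real^4" where v: "v $ 1 = (Re (fst y) + Re z) / 2" "v $ 2 = (Im (fst y) + Im z) / 2" 
      "v $ 3 = (Im (fst y) - Im z) / 2" "v $ 4 = (Re (fst y) - Re z) / 2"
      using vec4_exists by metis
    have "v $ 1 + v $ 4 = Re (fst y)" "v $ 2 + v $ 3 = Im (fst y)" "v $ 1 - v $ 4 = Re z" "v $ 2 - v $ 3 = Im z"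
      unfolding v by (simp_all add: field_simps)
    then have "oct_fold v = y" by (simp add: oct_fold_def z)
    then show "\<exists>v. y = oct_fold v" by blast
  qed
qed

theorem octahedral_orbit_map: "\<exists>F. orbit_map oct_lift F"
  by (rule chamber.orbit_map_exists[OF oct_chamber, of oct_fold])
     (use oct_fold_regular oct_fold_eq_iff in blast)+

section \<open>The icosahedral binary group\<close>

text \<open>The golden ratio.\<close>

definition phi :: real where "phi = (1 + sqrt 5) / 2"

lemma phi: "phi * phi = phi + 1" "phi > 8 / 5" "phi < 13 / 8" "phi > 0"
proof -
  show "phi * phi = phi + 1" by (simp add: phi_def field_simps)
  have "sqrt 5 > 11 / 5" by (rule real_less_rsqrt) (simp add: power2_eq_square)
  moreover have "sqrt 5 < 9 / 4" by (rule real_less_lsqrt) (simp_all add: power2_eq_square)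
  ultimately show "phi > 8 / 5" "phi < 13 / 8" "phi > 0" unfolding phi_def by simp_all
qed

lemma phi_assoc: "phi * (phi * x) = phi * x + x"
  using phi(1) by (simp add: distrib_right flip: mult.assoc)

definition ico_vertices :: "(real^3) set" where
  "ico_vertices = (\<Union>s\<in>{1, -1}. \<Union>t\<in>{1, -1}.
     {vector [0, s, t * phi], vector [s, t * phi, 0], vector [t * phi, 0, s]})"

lemma ico_vertex_iff: "vector [x, y, z] \<in> ico_vertices \<longleftrightarrow>
   x = 0 \<and> (y = 1 \<or> y = - 1) \<and> (z = phi \<or> z = - phi) \<or>
   z = 0 \<and> (x = 1 \<or> x = - 1) \<and> (y = phi \<or> y = - phi) \<or>
   y = 0 \<and> (z = 1 \<or> z = - 1) \<and> (x = phi \<or> x = - phi)"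
  by (auto simp: ico_vertices_def vector3_eq_iff)

lemma ico_vertex_cases:
  assumes "v \<in> ico_vertices"
  obtains s t where "s = 1 \<or> s = - 1" "t = phi \<or> t = - phi" 
    "v = vector [0, s, t] \<or> v = vector [s, t, 0] \<or> v = vector [t, 0, s]"
  using assms unfolding ico_vertices_def by auto

definition ico_lift :: "quaternion set" where
  "ico_lift = lift (rotational_symmetries std_icosahedron)"

lemma ico_lift_iff: "q \<in> ico_lift \<longleftrightarrow> norm q = 1 \<and> (\<forall>v\<in>ico_vertices. rot q *v v \<in> ico_vertices)"
proof -
  have "std_icosahedron = convex hull ico_vertices"
    unfolding std_icosahedron_def ico_vertices_def Let_def phi_def by (rule refl)
  moreover have "norm v = sqrt (1 + phi * phi)" if "v \<in> ico_vertices" for v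
    using that by (auto simp: ico_vertices_def norm_vector3 add.commute)
  moreover have "finite ico_vertices" by (simp add: ico_vertices_def)
  ultimately show ?thesis unfolding ico_lift_def using lift_symmetries_hull by metis
qed

lemma binary_group_ico: "binary_group ico_lift"
  unfolding ico_lift_def by (intro binary_group_lift subgroup_rotational_symmetries)

lemma ico_liftI:
  assumes "norm q = 1" 
    and "\<And>s t. s = 1 \<or> s = - 1 \<Longrightarrow> t = phi \<or> t = - phi \<Longrightarrow> rot q *v vector [0, s, t] \<in> ico_vertices"
    and "\<And>s t. s = 1 \<or> s = - 1 \<Longrightarrow> t = phi \<or> t = - phi \<Longrightarrow> rot q *v vector [s, t, 0] \<in> ico_vertices"
    and "\<And>s t. s = 1 \<or> s = - 1 \<Longrightarrow> t = phi \<or> t = - phi \<Longrightarrow> rot q *v vector [t, 0, s] \<in> ico_vertices"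
  shows "q \<in> ico_lift"
  unfolding ico_lift_iff using assms by (metis ico_vertex_cases)

lemma ico_lift_members:
  "quat 0 1 0 0 \<in> ico_lift" "quat 0 0 1 0 \<in> ico_lift" "quat 0 0 0 1 \<in> ico_lift"
  "quat (1/2) (1/2) (1/2) (1/2) \<in> ico_lift" "quat (- 1/2) (1/2) (1/2) (1/2) \<in> ico_lift"
  by (rule ico_liftI; (auto simp: rot_vector ico_vertex_iff unit_quat_iff)[1])+

lemma ico_root_members:
  "quat (- 1/2) (- phi / 2) ((phi - 1) / 2) 0 \<in> ico_lift"
  "quat (- 1/2) 0 (- phi / 2) ((phi - 1) / 2) \<in> ico_lift"
proof -
  have n: "norm (quat (- 1/2) (- phi / 2) ((phi - 1) / 2) 0) = 1" "norm (quat (- 1/2) 0 (- phi / 2) ((phi - 1) / 2)) = 1"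
    unfolding unit_quat_iff by (simp_all add: field_simps phi phi_assoc)
  have r: "rot (quat (- 1/2) (- phi / 2) ((phi - 1) / 2) 0) *v vector [x, y, z] = 
       vector [((phi) * x + (- 1) * y + (1 - phi) * z) / 2, ((- 1) * x + (1 - phi) * y - phi * z) / 2,
       ((phi - 1) * x + phi * y - z) / 2]" for x y z
    unfolding rot_vector vector3_eq_iff by (simp add: field_simps phi phi_assoc)
  show "quat (- 1/2) (- phi / 2) ((phi - 1) / 2) 0 \<in> ico_lift"
    by (rule ico_liftI[OF n(1)]; unfold r ico_vertex_iff; elim disjE; simp add: field_simps phi phi_assoc)
  show "quat (- 1/2) 0 (- phi / 2) ((phi - 1) / 2) \<in> ico_lift"
    by (rule ico_liftI[OF n(2)]; unfold rot_vector ico_vertex_iff; elim disjE; simp add: field_simps phi phi_assoc)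
qed

lemma rot_pure:
  "quat 0 ((rot q *v v) $ 1) ((rot q *v v) $ 2) ((rot q *v v) $ 3) = q \<star> quat 0 (v $ 1) (v $ 2) (v $ 3) \<star> qcnj q"
  by (cases q rule: quat_cases)
     (simp add: rot_quat quat_arith matrix_vector_mult_def sum_3 algebra_simps)

text \<open>A rotation that fixes the vertex \<open>(0, 1, phi)\<close> lifts to a quaternion with imaginary part along this
  vertex. The first two coordinates of the image of the adjacent vertex \<open>(0, -1, phi)\<close> are \<open>4 a c phi\<close>
  and \<open>4 c\<^sup>2 (phi + 1) - 1\<close>, and they have to be coordinates of a vertex.\<close>

lemma ico_stabilizer:
  assumes q: "quat a b c d \<in> ico_lift" and fx: "rot (quat a b c d) *v vector [0, 1, phi] = vector [0, 1, phi]"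
  shows "b = 0 \<and> d = c * phi \<and> (c = 0 \<and> (a = 1 \<or> a = - 1) \<or>
    (a = phi / 2 \<or> a = - phi / 2) \<and> (c = (phi - 1) / 2 \<or> c = - (phi - 1) / 2) \<or>
    (a = (phi - 1) / 2 \<or> a = - (phi - 1) / 2) \<and> (c = 1 / 2 \<or> c = - 1 / 2))"
proof -
  let ?q = "quat a b c d" and ?w = "quat 0 0 1 phi"
  have nq: "norm ?q = 1" using q by (simp add: ico_lift_iff)
  have n: "a * a + b * b + c * c + d * d = 1" using nq by (simp add: unit_quat_iff)
  have "?w = ?q \<star> ?w \<star> qcnj ?q"
    using rot_pure[of ?q "vector [0, 1, phi]"] unfolding fx by simp
  then have "?w \<star> ?q = ?q \<star> ?w \<star> (qcnj ?q \<star> ?q)" by (metis qmul_assoc)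
  then have "?w \<star> ?q = ?q \<star> ?w" using nq by simp
  then have "b = - b" "c * phi - d = - (c * phi - d)"
    unfolding quat_arith by auto
  then have bd: "b = 0" "d = c * phi" by auto
  have dd: "d * d = c * c * phi + c * c" by (simp add: bd algebra_simps phi_assoc)
  let ?X = "4 * (a * c * phi)" and ?Y = "4 * (c * c * (phi + 1)) - 1"
  have "rot ?q *v vector [0, - 1, phi] \<in> ico_vertices"
    using q unfolding ico_lift_iff by (auto simp: ico_vertices_def)
  moreover have "\<exists>z. rot ?q *v vector [0, - 1, phi] = vector [?X, ?Y, z]"
  proof -
    have "a * a + c * c - d * d = 1 - 2 * (d * d)" using n unfolding bd(1) by simp
    then have Y: "- (a * a + c * c - d * d) + 2 * (c * d) * phi = ?Y"
      by (simp add: dd) (simp add: bd algebra_simps phi_assoc)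
    have "2 * (b * c - a * d) * - 1 + 2 * (b * d + a * c) * phi = ?X"
      by (simp add: bd algebra_simps)
    moreover have "(a * a - b * b + c * c - d * d) * - 1 + 2 * (c * d - a * b) * phi = ?Y"
      using Y unfolding bd(1) by (simp add: algebra_simps)
    ultimately show ?thesis unfolding rot_vector by (simp only: mult_zero_right add_0) blast
  qed
  ultimately obtain z where "vector [?X, ?Y, z] \<in> ico_vertices" by metis
  then consider "?X = 0" "?Y = 1 \<or> ?Y = - 1" | "?X = 1 \<or> ?X = - 1" "?Y = phi \<or> ?Y = - phi" | "?X = phi \<or> ?X = - phi" "?Y = 0"
    unfolding ico_vertex_iff by argo
  then have "c = 0 \<and> (a = 1 \<or> a = - 1) \<or>
    (a = phi / 2 \<or> a = - phi / 2) \<and> (c = (phi - 1) / 2 \<or> c = - (phi - 1) / 2) \<or>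
    (a = (phi - 1) / 2 \<or> a = - (phi - 1) / 2) \<and> (c = 1 / 2 \<or> c = - 1 / 2)"
  proof cases
    case 1
    then have "a = 0 \<or> c = 0" using phi by simp
    moreover have "c = 0" if "a = 0"
    proof -
      have 2: "c * c * phi + 2 * (c * c) = 1" using n bd dd that by simp
      have "2 * (c * c * phi) + 2 * (c * c) = 1 \<or> c * c * (phi + 1) = 0" using 1(2) by (auto simp: algebra_simps)
      then have "c * c * phi = 0 \<or> c * c * (phi + 1) = 0"
        using 2 by (elim disjE) (rule disjI1, linarith, rule disjI2)
      then show ?thesis using phi by auto
    qed
    ultimately have "c = 0" by blast
    then have "a * a = 1" using n bd by simp
    then show ?thesis using \<open>c = 0\<close> by (simp add: square_eq_1_iff)
  next
    case 2
    have "?Y \<noteq> - phi"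
    proof
      assume "?Y = - phi"
      then have "4 * (c * c * (phi + 1)) = 1 - phi" by simp
      moreover have "c * c * (phi + 1) \<ge> 0" using phi by simp
      ultimately show False using phi by linarith
    qed
    then have "4 * (c * c * (phi + 1)) = 1 + phi" using 2(2) by simp
    then have "(4 * (c * c) - 1) * (phi + 1) = 0" by (simp add: algebra_simps)
    then have "c * c = 1 / 4" using phi by simp
    then have c: "c = 1/2 \<or> c = - (1/2)" by (simp only: square_half)
    have aux: "x * t = 1 \<or> x * t = - 1 \<Longrightarrow> t = 1 \<or> t = - 1 \<Longrightarrow> x = 1 \<or> x = - 1" for x t :: real
      by auto
    have "2 * (a * phi) * (2 * c) = ?X" by simp
    then have "2 * (a * phi) * (2 * c) = 1 \<or> 2 * (a * phi) * (2 * c) = - 1"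
      using 2(1) by (simp only:)
    moreover have "2 * c = 1 \<or> 2 * c = - 1" using c by auto
    ultimately have "2 * (a * phi) = 1 \<or> 2 * (a * phi) = - 1" by (rule aux)
    then have "2 * (a * phi) * (phi - 1) = phi - 1 \<or> 2 * (a * phi) * (phi - 1) = - (phi - 1)" by auto
    moreover have "2 * (a * phi) * (phi - 1) = 2 * a" by (simp add: algebra_simps phi phi_assoc)
    ultimately show ?thesis using c by auto
  next
    case 3
    then have "4 * (c * c) * (phi + 1) * (2 - phi) = 2 - phi" by simp
    moreover have "4 * (c * c) * (phi + 1) * (2 - phi) = 4 * (c * c)" by (simp add: algebra_simps phi phi_assoc)
    ultimately have "(2 * c) * (2 * c) = (phi - 1) * (phi - 1)" by (simp add: algebra_simps phi phi_assoc)
    then have c: "2 * c = phi - 1 \<or> 2 * c = - (phi - 1)" by (simp only: square_eq_iff)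
    have "phi * (4 * (a * c)) = phi * 1 \<or> phi * (4 * (a * c)) = phi * (- 1)" using 3(1) by (auto simp: algebra_simps)
    then have "4 * (a * c) = 1 \<or> 4 * (a * c) = - 1" using phi by (simp only: mult_cancel_left) auto
    then have "2 * a * (2 * c) = 1 \<or> 2 * a * (2 * c) = - 1" by auto
    moreover have "x * t = 1 \<or> x * t = - 1 \<Longrightarrow> t = m \<or> t = - m \<Longrightarrow> x * m = 1 \<or> x * m = - 1" for x t m :: real
      by auto
    ultimately have "2 * a * (phi - 1) = 1 \<or> 2 * a * (phi - 1) = - 1" using c by blast
    then have "2 * a * (phi - 1) * phi = phi \<or> 2 * a * (phi - 1) * phi = - phi" by auto
    moreover have "2 * a * (phi - 1) * phi = 2 * a" by (simp add: algebra_simps phi phi_assoc)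
    ultimately show ?thesis using c by auto
  qed
  then show ?thesis using bd by blast
qed

text \<open>Representatives, up to sign, of the lift of the stabilizer of the vertex \<open>(0, 1, phi)\<close>.\<close>

definition ico_stabilizer_lift :: "quaternion set" where
  "ico_stabilizer_lift = {qone, quat (phi/2) 0 ((phi-1)/2) (1/2), quat (phi/2) 0 (-(phi-1)/2) (-1/2),
     quat ((phi-1)/2) 0 (1/2) (phi/2), quat ((phi-1)/2) 0 (-1/2) (-phi/2)}"

lemma ico_stabilizer_lift:
  assumes "q \<in> ico_lift" "rot q *v vector [0, 1, phi] = vector [0, 1, phi]"
  shows "q \<in> ico_stabilizer_lift \<or> - q \<in> ico_stabilizer_lift"
proof -
  obtain a b c d where q: "q = quat a b c d" by (rule quat_cases)
  have s: "(phi - 1) * phi = 1" "(phi - 1) / 2 * phi = 1 / 2" "- (phi - 1) / 2 * phi = - 1 / 2" by (simp_all add: algebra_simps phi)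
  have "b = 0 \<and> d = c * phi \<and> (c = 0 \<and> (a = 1 \<or> a = - 1) \<or>
    (a = phi / 2 \<or> a = - phi / 2) \<and> (c = (phi - 1) / 2 \<or> c = - (phi - 1) / 2) \<or>
    (a = (phi - 1) / 2 \<or> a = - (phi - 1) / 2) \<and> (c = 1 / 2 \<or> c = - 1 / 2))"
    using ico_stabilizer assms unfolding q by blast
  then have "a = 1 \<and> b = 0 \<and> c = 0 \<and> d = 0 \<or> a = - 1 \<and> b = 0 \<and> c = 0 \<and> d = 0 \<or>
      a = phi / 2 \<and> b = 0 \<and> c = (phi - 1) / 2 \<and> d = 1/2 \<or> a = phi / 2 \<and> b = 0 \<and> c = - (phi - 1) / 2 \<and> d = - 1/2 \<or>
      a = - phi / 2 \<and> b = 0 \<and> c = (phi - 1) / 2 \<and> d = 1/2 \<or> a = - phi / 2 \<and> b = 0 \<and> c = - (phi - 1) / 2 \<and> d = - 1/2 \<or>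
      a = (phi - 1) / 2 \<and> b = 0 \<and> c = 1/2 \<and> d = phi/2 \<or> a = (phi - 1) / 2 \<and> b = 0 \<and> c = - 1/2 \<and> d = - phi/2 \<or>
      a = - (phi - 1) / 2 \<and> b = 0 \<and> c = 1/2 \<and> d = phi/2 \<or> a = - (phi - 1) / 2 \<and> b = 0 \<and> c = - 1/2 \<and> d = - phi/2"
  proof -
    assume *: "b = 0 \<and> d = c * phi \<and> (c = 0 \<and> (a = 1 \<or> a = - 1) \<or>
      (a = phi / 2 \<or> a = - phi / 2) \<and> (c = (phi - 1) / 2 \<or> c = - (phi - 1) / 2) \<or>
      (a = (phi - 1) / 2 \<or> a = - (phi - 1) / 2) \<and> (c = 1 / 2 \<or> c = - 1 / 2))"
    then have d: "d = c * phi" by blast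
    have "c = (phi - 1) / 2 \<Longrightarrow> d = 1 / 2" "c = - (phi - 1) / 2 \<Longrightarrow> d = - 1 / 2"
      by (simp_all only: d s(2,3))
    moreover have "c = 1 / 2 \<Longrightarrow> d = phi / 2" "c = - 1 / 2 \<Longrightarrow> d = - phi / 2" "c = 0 \<Longrightarrow> d = 0"
      by (simp_all add: d)
    ultimately have "c = (phi - 1) / 2 \<longrightarrow> d = 1 / 2" "c = - (phi - 1) / 2 \<longrightarrow> d = - 1 / 2"
      "c = 1 / 2 \<longrightarrow> d = phi / 2" "c = - 1 / 2 \<longrightarrow> d = - phi / 2" "c = 0 \<longrightarrow> d = 0"
      by blast+
    then show ?thesis using * by argo
  qed
  then show ?thesis
    unfolding q ico_stabilizer_lift_def by (elim disjE conjE) (simp_all add: quat_arith)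
qed

text \<open>Representatives, up to sign, of the tetrahedral subgroup, which permutes the twelve vertices simply transitively:
  a cyclic permutation of the coordinates followed by an even number of sign changes.\<close>

definition vertex_transporters :: "quaternion set" where
  "vertex_transporters = {u \<star> c | u c. u \<in> {qone, quat 0 1 0 0, quat 0 0 1 0, quat 0 0 0 1} \<and>
      c \<in> {qone, quat (1/2) (1/2) (1/2) (1/2), quat (-1/2) (1/2) (1/2) (1/2)}}"

lemma vertex_transporters_ico: "t \<in> vertex_transporters \<Longrightarrow> t \<in> ico_lift"
  unfolding vertex_transporters_def using ico_lift_members binary_group_ico
  by (auto simp: binary_group_def)

lemma vertex_transporter_exists:
  assumes "v \<in> ico_vertices"
  shows "\<exists>t\<in>vertex_transporters. rot t *v v = vector [0, 1, phi]"
proof -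
  obtain s t where st: "s = 1 \<or> s = - 1" "t = phi \<or> t = - phi" 
    and v: "v = vector [0, s, t] \<or> v = vector [s, t, 0] \<or> v = vector [t, 0, s]"
    using assms by (rule ico_vertex_cases)
  have "\<exists>c\<in>{qone, quat (1/2) (1/2) (1/2) (1/2), quat (-1/2) (1/2) (1/2) (1/2)}. rot c *v v = vector [0, s, t]"
    using v by (auto simp: qone_quat rot_vector vector3_eq_iff)
  then obtain c where c: "c \<in> {qone, quat (1/2) (1/2) (1/2) (1/2), quat (-1/2) (1/2) (1/2) (1/2)}"
    "rot c *v v = vector [0, s, t]" by blast
  have "\<exists>u\<in>{qone, quat 0 1 0 0, quat 0 0 1 0, quat 0 0 0 1}. rot u *v vector [0, s, t] = vector [0, 1, phi]"
    using st by (elim disjE) (simp_all add: qone_quat rot_vector vector3_eq_iff)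
  then obtain u where u: "u \<in> {qone, quat 0 1 0 0, quat 0 0 1 0, quat 0 0 0 1}"
    "rot u *v vector [0, s, t] = vector [0, 1, phi]" by blast
  have "rot (u \<star> c) *v v = vector [0, 1, phi]"
    using c u by (simp add: rot_qmul flip: matrix_vector_mul_assoc)
  then show ?thesis using c(1) u(1) unfolding vertex_transporters_def by blast
qed

text \<open>The stabilizer of a vertex and a transitive set of transporters generate the group. This gives the
  120 elements explicitly.\<close>

lemma ico_lift_decompose:
  assumes q: "q \<in> ico_lift"
  shows "\<exists>t\<in>vertex_transporters. \<exists>p\<in>ico_stabilizer_lift. q = qcnj t \<star> p \<or> q = - (qcnj t \<star> p)"
proof -
  have "vector [0, 1, phi] \<in> ico_vertices" by (simp add: ico_vertex_iff)
  then have "rot q *v vector [0, 1, phi] \<in> ico_vertices" using q ico_lift_iff by blast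
  then obtain t where t: "t \<in> vertex_transporters" "rot t *v (rot q *v vector [0, 1, phi]) = vector [0, 1, phi]"
    using vertex_transporter_exists by blast
  have tI: "t \<in> ico_lift" using t vertex_transporters_ico by blast
  have "rot (t \<star> q) *v vector [0, 1, phi] = vector [0, 1, phi]"
    using t(2) by (simp add: rot_qmul matrix_vector_mul_assoc)
  moreover have "t \<star> q \<in> ico_lift" using tI q binary_group_ico by (simp add: binary_group_def)
  ultimately have "t \<star> q \<in> ico_stabilizer_lift \<or> - (t \<star> q) \<in> ico_stabilizer_lift"
    using ico_stabilizer_lift by blast
  moreover have "qcnj t \<star> (t \<star> q) = q" "- (qcnj t \<star> - (t \<star> q)) = q" using tI by (simp_all add: ico_lift_iff)
  ultimately show ?thesis using t(1) by metis
qed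

section \<open>The icosahedral chamber\<close>

definition ico_root :: "4 \<Rightarrow> quaternion" where
  "ico_root = quad (quat 0 1 0 0) (quat (- 1/2) (- phi / 2) ((phi - 1) / 2) 0) (quat 1 0 0 0)
     (quat (- 1/2) 0 (- phi / 2) ((phi - 1) / 2))"

definition ico_weight :: "4 \<Rightarrow> quaternion" where
  "ico_weight = quad (quat 0 1 (1 + phi) (2 + 3 * phi)) (quat 0 0 (2 * phi) (2 + 4 * phi))
     (quat 1 0 phi (1 + 3 * phi)) (quat 0 0 0 (2 * phi))"

lemma ico_weight_coords:
  "quat a b c d \<bullet> ico_weight 1 = b + (1 + phi) * c + (2 + 3 * phi) * d"
  "quat a b c d \<bullet> ico_weight 2 = 2 * phi * (c + (1 + phi) * d)"
  "quat a b c d \<bullet> ico_weight 3 = a + phi * c + (1 + 3 * phi) * d"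
  "quat a b c d \<bullet> ico_weight 4 = 2 * phi * d"
  by (simp_all add: ico_weight_def inner_quat algebra_simps phi phi_assoc)

lemma ico_nonneg:
  assumes "d \<ge> 0" "c + (1 + phi) * d \<ge> 0" "b + (1 + phi) * c + (2 + 3 * phi) * d \<ge> 0" "a + phi * c + (1 + 3 * phi) * d \<ge> 0"
  shows "(\<forall>i. quat a b c d \<bullet> ico_weight i \<ge> 0) \<or> (\<forall>i. quat a b c d \<bullet> ico_weight i \<le> 0)"
  unfolding forall_4 ico_weight_coords using assms phi(4) by simp

lemma ico_nonpos:
  assumes "d \<le> 0" "c + (1 + phi) * d \<le> 0" "b + (1 + phi) * c + (2 + 3 * phi) * d \<le> 0" "a + phi * c + (1 + 3 * phi) * d \<le> 0"
  shows "(\<forall>i. quat a b c d \<bullet> ico_weight i \<ge> 0) \<or> (\<forall>i. quat a b c d \<bullet> ico_weight i \<le> 0)"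
  unfolding forall_4 ico_weight_coords using assms phi(4) by (simp add: mult_nonneg_nonpos)


text \<open>The twelve transporters and the five rotations about a vertex give one root out of each of the 60 pairs of
  opposite roots. Their coefficients are
  linear in \<open>phi\<close> after reduction by \<open>phi\<^sup>2 = phi + 1\<close>, and the bounds on \<open>phi\<close> decide their signs.\<close>

lemma ico_positivity_table:
  "\<forall>u\<in>{quat 1 0 0 0, quat 0 1 0 0, quat 0 0 1 0, quat 0 0 0 1}.
   \<forall>c\<in>{quat 1 0 0 0, quat (1/2) (1/2) (1/2) (1/2), quat (-1/2) (1/2) (1/2) (1/2)}.
   \<forall>p\<in>{quat 1 0 0 0, quat (phi/2) 0 ((phi-1)/2) (1/2), quat (phi/2) 0 (-(phi-1)/2) (-1/2),
     quat ((phi-1)/2) 0 (1/2) (phi/2), quat ((phi-1)/2) 0 (-1/2) (-phi/2)}.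
     (\<forall>i. (qcnj (u \<star> c) \<star> p) \<bullet> ico_weight i \<ge> 0) \<or> (\<forall>i. (qcnj (u \<star> c) \<star> p) \<bullet> ico_weight i \<le> 0)"
  by (simp only: ball_simps qmul_quat qcnj_quat; intro conjI TrueI;
       ((rule ico_nonneg; simp add: field_simps phi phi_assoc; insert phi(2,3); linarith)
       | (rule ico_nonpos; simp add: field_simps phi phi_assoc; insert phi(2,3); linarith)))

lemma ico_positivity_basic:
  assumes "t \<in> vertex_transporters" "p \<in> ico_stabilizer_lift"
  shows "(\<forall>i. (qcnj t \<star> p) \<bullet> ico_weight i \<ge> 0) \<or> (\<forall>i. (qcnj t \<star> p) \<bullet> ico_weight i \<le> 0)"
proof -
  obtain u c where t: "t = u \<star> c" and u: "u \<in> {quat 1 0 0 0, quat 0 1 0 0, quat 0 0 1 0, quat 0 0 0 1}"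
    and c: "c \<in> {quat 1 0 0 0, quat (1/2) (1/2) (1/2) (1/2), quat (-1/2) (1/2) (1/2) (1/2)}"
    using assms(1) unfolding vertex_transporters_def qone_quat by blast
  then show ?thesis
    using ico_positivity_table[rule_format, OF u c assms(2)[unfolded ico_stabilizer_lift_def qone_quat]] by simp
qed

lemma ico_positivity:
  assumes "q \<in> ico_lift"
  shows "(\<forall>i. q \<bullet> ico_weight i \<ge> 0) \<or> (\<forall>i. q \<bullet> ico_weight i \<le> 0)"
proof -
  obtain t p where tp: "t \<in> vertex_transporters" "p \<in> ico_stabilizer_lift" "q = qcnj t \<star> p \<or> q = - (qcnj t \<star> p)"
    using ico_lift_decompose[OF assms] by blast
  then show ?thesis using ico_positivity_basic[OF tp(1,2)] by auto
qed

lemma finite_ico_lift: "finite ico_lift"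
proof -
  have "finite vertex_transporters"
    unfolding vertex_transporters_def by (rule finite_image_set2) simp_all
  moreover have "finite ico_stabilizer_lift" by (simp add: ico_stabilizer_lift_def)
  ultimately have "finite ((\<lambda>(t, p). qcnj t \<star> p) ` (vertex_transporters \<times> ico_stabilizer_lift) \<union>
      (\<lambda>(t, p). - (qcnj t \<star> p)) ` (vertex_transporters \<times> ico_stabilizer_lift))" (is "finite ?S")
    by (intro finite_UnI finite_imageI finite_cartesian_product)
  moreover have "ico_lift \<subseteq> ?S"
  proof
    fix q assume "q \<in> ico_lift"
    then obtain t p where tp: "(t, p) \<in> vertex_transporters \<times> ico_stabilizer_lift"
      "q = qcnj t \<star> p \<or> q = - (qcnj t \<star> p)"
      using ico_lift_decompose by blast
    from tp(2) show "q \<in> ?S"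
      using imageI[OF tp(1), of "\<lambda>(t, p). qcnj t \<star> p"] imageI[OF tp(1), of "\<lambda>(t, p). - (qcnj t \<star> p)"] by auto
  qed
  ultimately show ?thesis by (rule finite_subset[rotated])
qed

lemma ico_gram:
  "ico_root i \<bullet> ico_root j = (if i = j then 1 else if {i, j} = {1, 2} then - (phi / 2)
     else if {i, j} = {2, 3} \<or> {i, j} = {3, 4} then - (1/2) else 0)"
  using exhaust_4[of i] exhaust_4[of j]
  by (elim disjE) (simp_all add: ico_root_def inner_quat doubleton_eq_iff field_simps phi phi_assoc)

text \<open>The diagram \<open>H\<^sub>4\<close> is a path whose only edge of weight 5 is at one end, so it has no symmetries.\<close>

lemma ico_gram_permutation:
  assumes "bij \<pi>" and g: "\<And>i j. ico_root (\<pi> i) \<bullet> ico_root (\<pi> j) = ico_root i \<bullet> ico_root j"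
  shows "\<pi> = quad 1 2 3 4"
proof -
  have d: "distinct [\<pi> 1, \<pi> 2, \<pi> 3, \<pi> 4]" using assms(1) quad_eta[of \<pi>] bij_quad by metis
  have ne: "\<pi> 1 \<noteq> \<pi> 2" "\<pi> 2 \<noteq> \<pi> 3" "\<pi> 3 \<noteq> \<pi> 4" using d by simp_all
  have "ico_root (\<pi> 1) \<bullet> ico_root (\<pi> 2) = - (phi / 2)" "ico_root (\<pi> 2) \<bullet> ico_root (\<pi> 3) = - (1/2)"
    "ico_root (\<pi> 3) \<bullet> ico_root (\<pi> 4) = - (1/2)"
    using g[of 1 2] g[of 2 3] g[of 3 4] by (simp_all add: ico_gram doubleton_eq_iff)
  then have e: "{\<pi> 1, \<pi> 2} = {1, 2}" "{\<pi> 2, \<pi> 3} = {2, 3} \<or> {\<pi> 2, \<pi> 3} = {3, 4}"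
     "{\<pi> 3, \<pi> 4} = {2, 3} \<or> {\<pi> 3, \<pi> 4} = {3, 4}"
    using ne phi(2,3) unfolding ico_gram by (auto simp only: split: if_splits)
  then have m: "\<pi> 1 = 1 \<and> \<pi> 2 = 2 \<and> \<pi> 3 = 3"
    by (auto simp: doubleton_eq_iff)
  then have "\<pi> 4 = 4" using e(3) d by (auto simp: doubleton_eq_iff)
  then show ?thesis using m quad_eta[of \<pi>] by metis
qed

lemma ico_unit: "a \<in> ico_lift \<Longrightarrow> norm a = 1"
  by (simp add: ico_lift_iff)

lemma ico_chamber: "chamber ico_lift ico_root ico_weight {quad 1 2 3 4}"
proof
  have one: "qone \<in> ico_lift" using binary_group_ico by (simp add: binary_group_def)
  have q0: "quad 1 2 3 4 i = i" for i :: 4 using exhaust_4[of i] by auto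
  show "finite ico_lift" by (rule finite_ico_lift)
  show "binary_group ico_lift" by (rule binary_group_ico)
  show "ico_root i \<in> ico_lift" for i
    using exhaust_4[of i] ico_lift_members ico_root_members one[unfolded qone_quat] by (auto simp: ico_root_def)
  show "ico_root i \<bullet> ico_weight j = (if i = j then 1 else 0)" for i j
    using exhaust_4[of i] exhaust_4[of j]
    by (elim disjE) (simp_all add: ico_root_def ico_weight_def inner_quat field_simps phi phi_assoc)
  show "x = (\<Sum>i\<in>UNIV. (x \<bullet> ico_weight i) *\<^sub>R ico_root i)" for x
    by (cases x rule: quat_cases)
       (simp add: sum_4 ico_root_def ico_weight_def quat_arith field_simps phi phi_assoc)
  show "(\<forall>i. r \<bullet> ico_weight i \<ge> 0) \<or> (\<forall>i. r \<bullet> ico_weight i \<le> 0)" if "r \<in> ico_lift" for r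
    using that by (rule ico_positivity)
  show "bij \<pi>" if "\<pi> \<in> {quad 1 2 3 4}" for \<pi> :: "4 \<Rightarrow> 4"
    using that by (auto simp: bij_quad)
  show "(\<exists>a\<in>ico_lift. \<exists>b\<in>ico_lift. \<forall>i. a \<star> ico_root i \<star> b = ico_root (\<pi> i)) \<longleftrightarrow> \<pi> \<in> {quad 1 2 3 4}" 
    if b: "bij \<pi>" for \<pi>
  proof
    assume "\<exists>a\<in>ico_lift. \<exists>b\<in>ico_lift. \<forall>i. a \<star> ico_root i \<star> b = ico_root (\<pi> i)"
    then obtain a b where ab: "norm a = 1" "norm b = 1" and eq: "\<forall>i. a \<star> ico_root i \<star> b = ico_root (\<pi> i)"
      using ico_unit by blast
    show "\<pi> \<in> {quad 1 2 3 4}"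
      using ico_gram_permutation[OF b motion_preserves_gram[OF ab eq]] by simp
  next
    assume "\<pi> \<in> {quad 1 2 3 4}"
    then show "\<exists>a\<in>ico_lift. \<exists>b\<in>ico_lift. \<forall>i. a \<star> ico_root i \<star> b = ico_root (\<pi> i)"
      using one by (intro bexI[of _ qone]) (simp_all add: q0)
  qed
  show "\<exists>i. a \<star> qcnj (ico_root i) \<star> b \<noteq> ico_root (\<pi> i)" if \<pi>: "bij \<pi>" and ab: "a \<in> ico_lift" "b \<in> ico_lift" for \<pi> a b
  proof (rule ccontr)
    assume "\<not> ?thesis"
    then have eq: "\<forall>i. a \<star> qcnj (ico_root i) \<star> b = ico_root (\<pi> i)" by blast
    have n: "norm a = 1" "norm b = 1" using ab ico_unit by auto
    have p: "\<pi> = quad 1 2 3 4"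
      using ico_gram_permutation[OF \<pi> odd_motion_preserves_gram[OF n eq]] .
    have "vol (ico_root (\<pi> 1)) (ico_root (\<pi> 2)) (ico_root (\<pi> 3)) (ico_root (\<pi> 4)) =
      - vol (ico_root 1) (ico_root 2) (ico_root 3) (ico_root 4)"
      using vol_odd[OF n] eq by metis
    then have "vol (ico_root 1) (ico_root 2) (ico_root 3) (ico_root 4) = 0" unfolding p by simp
    moreover have "vol (ico_root 1) (ico_root 2) (ico_root 3) (ico_root 4) \<noteq> 0"
      using phi(2,3) by (simp add: vol_def ico_root_def quat_arith diff_quat field_simps phi phi_assoc)
    ultimately show False by simp
  qed
qed

theorem icosahedral_orbit_map: "\<exists>F. orbit_map ico_lift F"
proof (rule chamber.orbit_map_exists[OF ico_chamber])
  let ?h = "\<lambda>v :: real^4. (Complex (v $ 1) (v $ 2), Complex (v $ 3) (v $ 4))"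
  show "continuous_on UNIV ?h" unfolding Complex_of_real_eq by (intro continuous_intros)
  show "?h (c *\<^sub>R v) = c *\<^sub>R ?h v" for c v by (simp add: complex_eq_iff)
  show "surj ?h"
    unfolding surj_def
  proof
    fix y :: quaternion
    obtain v :: "real^4" where "v $ 1 = Re (fst y)" "v $ 2 = Im (fst y)" "v $ 3 = Re (snd y)" "v $ 4 = Im (snd y)"
      using vec4_exists by metis
    then have "?h v = y" by simp
    then show "\<exists>v. y = ?h v" by metis
  qed
  show "?h v = ?h w \<longleftrightarrow> (\<exists>\<pi>\<in>{quad 1 2 3 4}. v = (\<chi> i. w $ \<pi> i))" for v w
    by (auto simp: permute_vec4_iff)
qed

theorem proposition1p4:
  fixes G :: "(real^3^3) set"
  shows "(is_D 2 G \<or> is_D 4 G \<or> is_D 6 G \<or> is_T G \<or> is_O G \<or> is_I G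
            \<longrightarrow> misorientation_space G G homeomorphic_space S3) \<and>
         (is_C 2 G \<or> is_C 3 G \<or> is_C 4 G \<or> is_C 6 G \<or> is_D 3 G
            \<longrightarrow> misorientation_space G G homeomorphic_space RP3)"
proof -
  have "misorientation_space G G homeomorphic_space S3" if "is_T G"
    using that solid_misorientation_space tetrahedral_orbit_map unfolding tet_lift_def is_T_def regular_tetrahedron_def by metis
  moreover have "misorientation_space G G homeomorphic_space S3" if "is_O G"
    using that solid_misorientation_space octahedral_orbit_map unfolding oct_lift_def is_O_def regular_octahedron_def by metis
  moreover have "misorientation_space G G homeomorphic_space S3" if "is_I G"
    using that solid_misorientation_space icosahedral_orbit_map unfolding ico_lift_def is_I_def regular_icosahedron_def by metis
  moreover have "misorientation_space G G homeomorphic_space S3" if "is_D 2 G \<or> is_D 4 G \<or> is_D 6 G"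
    using that even_dihedral_misorientation_space[of _ G] by auto
  moreover have "misorientation_space G G homeomorphic_space RP3" if "is_D 3 G"
    using odd_dihedral_misorientation_space[OF that] by simp
  ultimately show ?thesis using cyclic_misorientation_space by blast
qed

end
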